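(* Let $\{\boldsymbol u_\eta\}$ be a divergence free sequence, uniformly bounded in $L^2(\Omega;\mathbb{R}^3)$. Then there exist a subsequence $\{\boldsymbol u_{\eta_k}\}$ and a function $\boldsymbol u_0\in L^2(\Omega,\mathcal H_\sharp(\mathrm{div}_{\mathbf R_0},Y^m))$ such that $\boldsymbol u_{\eta_k}$ two-scale converges weakly for the matrix $\mathbf R$ to $\boldsymbol u_0(\boldsymbol x,\boldsymbol y)$, and $\boldsymbol u_0$ satisfies $$\mathrm{div}_{\mathbf R}\,\boldsymbol u_0(\boldsymbol x,\boldsymbol y)=0\ \text{ a.e. in }\Omega\times Y^m,\qquad \mathrm{div}\int_{Y^m}\boldsymbol u_0(\boldsymbol x,\boldsymbol y)\,d\boldsymbol y=0\ \text{ a.e. in }\Omega.$$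
   Context: $\Omega\subset\mathbb{R}^3$ is a bounded open set with Lipschitz boundary; $\eta>0$ is a parameter tending to $0$. $\mathbf R$ is a real matrix with $m$ rows and $3$ columns, $m>3$, satisfying $\mathbf R^T\boldsymbol k\neq\boldsymbol 0$ for all $\boldsymbol k\in\mathbb{Z}^m\setminus\{\boldsymbol 0\}$. $Y^m=]0,1[^m$; the subscript $\sharp$ denotes $Y^m$-periodicity in $\boldsymbol y$. Weak two-scale convergence for $\mathbf R$: $(u_\eta)\subset L^2(\Omega)$ converges to $u_0\in L^2(\Omega\times Y^m)$ if $\lim_{\eta\to0}\int_\Omega u_\eta(\boldsymbol x)\varphi(\boldsymbol x,\mathbf R\boldsymbol x/\eta)\,d\boldsymbol x=\int\!\!\int_{\Omega\times Y^m}u_0\varphi\,d\boldsymbol x\,d\boldsymbol y$ for every $\varphi\in L^2(\Omega,C_\sharp(Y^m))$ (componentwise for vector fields). $\mathrm{div}_{\mathbf R}\,\boldsymbol u=(\mathbf R^T\nabla_{\boldsymbol y})\cdot\boldsymbol u$, and $\mathcal H_\sharp(\mathrm{div}_{\mathbf R_0},Y^m)=\{\boldsymbol u\in L^2_\sharp(Y^m;\mathbb{R}^3):\mathrm{div}_{\mathbf R}\,\boldsymbol u=0\}$. *)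

theory Defs
  imports "HOL-Analysis.Analysis"
begin

(* The boundary is locally the graph of a Lipschitz function over the hyperplane
   orthogonal to e, with S lying strictly on the e-side of the graph. *)
definition lipschitz_boundary :: "'a::euclidean_space set \<Rightarrow> bool" where
  "lipschitz_boundary S \<longleftrightarrow>
     (\<forall>p\<in>frontier S. \<exists>r>0. \<exists>e \<gamma> L. norm e = 1 \<and> L-lipschitz_on {z. z \<bullet> e = 0} (\<gamma> :: 'a \<Rightarrow> real) \<and>
        S \<inter> ball p r = {x \<in> ball p r. \<gamma> (x - (x \<bullet> e) *\<^sub>R e) < x \<bullet> e})"

(* L^2 functions are represented by Lebesgue measurable functions, not by classes. *)
definition L2_on :: "'a::euclidean_space set \<Rightarrow> ('a \<Rightarrow> 'b::euclidean_space) set" where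
  "L2_on S = {f. f \<in> borel_measurable (lebesgue_on S) \<and>
                 integrable (lebesgue_on S) (\<lambda>x. (norm (f x))\<^sup>2)}"

definition L2_norm :: "'a::euclidean_space set \<Rightarrow> ('a \<Rightarrow> 'b::euclidean_space) \<Rightarrow> real" where
  "L2_norm S f = sqrt (LINT x|lebesgue_on S. (norm (f x))\<^sup>2)"

definition unit_cell :: "(real^'m) set" where
  "unit_cell = {y. \<forall>i. 0 < y $ i \<and> y $ i < 1}"

definition integer_vec :: "real^'m \<Rightarrow> bool" where
  "integer_vec k \<longleftrightarrow> (\<forall>i. k $ i \<in> \<int>)"

definition periodic :: "(real^'m \<Rightarrow> 'b) \<Rightarrow> bool" where
  "periodic f \<longleftrightarrow> (\<forall>k y. integer_vec k \<longrightarrow> f (y + k) = f y)"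

definition grad :: "(real^'n \<Rightarrow> real) \<Rightarrow> real^'n \<Rightarrow> real^'n" where
  "grad f x = (\<chi> i. frechet_derivative f (at x) (axis i 1))"

primrec C_k :: "nat \<Rightarrow> (real^'n \<Rightarrow> real) \<Rightarrow> bool" where
  "C_k 0 f \<longleftrightarrow> continuous_on UNIV f"
| "C_k (Suc k) f \<longleftrightarrow> (\<forall>x. f differentiable (at x)) \<and> (\<forall>i. C_k k (\<lambda>x. grad f x $ i))"

definition smooth :: "(real^'n \<Rightarrow> real) \<Rightarrow> bool" where
  "smooth f \<longleftrightarrow> (\<forall>k. C_k k f)"

definition test_functions :: "(real^'n) set \<Rightarrow> (real^'n \<Rightarrow> real) set" where
  "test_functions S =
     {\<phi>. smooth \<phi> \<and> compact (closure {x. \<phi> x \<noteq> 0}) \<and> closure {x. \<phi> x \<noteq> 0} \<subseteq> S}"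

definition periodic_test_functions :: "(real^'m \<Rightarrow> real) set" where
  "periodic_test_functions = {w. smooth w \<and> periodic w}"

(* Distributional divergences: functionals of the test function given as last argument. *)
definition distr_div :: "(real^'n) set \<Rightarrow> (real^'n \<Rightarrow> real^'n) \<Rightarrow> (real^'n \<Rightarrow> real) \<Rightarrow> real" where
  "distr_div S v \<phi> = - (LINT x|lebesgue_on S. v x \<bullet> grad \<phi> x)"

definition distr_div_R ::
    "real^'n^'m \<Rightarrow> (real^'m \<Rightarrow> real^'n) \<Rightarrow> (real^'m \<Rightarrow> real) \<Rightarrow> real" where
  "distr_div_R R v w = - (LINT y|lebesgue_on unit_cell. v y \<bullet> (transpose R *v grad w y))"

definition div_free_on :: "(real^'n) set \<Rightarrow> (real^'n \<Rightarrow> real^'n) \<Rightarrow> bool" where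
  "div_free_on S v \<longleftrightarrow> (\<forall>\<phi>\<in>test_functions S. distr_div S v \<phi> = 0)"

definition div_R_free :: "real^'n^'m \<Rightarrow> (real^'m \<Rightarrow> real^'n) \<Rightarrow> bool" where
  "div_R_free R v \<longleftrightarrow> (\<forall>w\<in>periodic_test_functions. distr_div_R R v w = 0)"

definition H_div_R0 :: "real^'n^'m \<Rightarrow> (real^'m \<Rightarrow> real^'n) set" where
  "H_div_R0 R = {v. periodic v \<and> v \<in> L2_on unit_cell \<and> div_R_free R v}"

(* L^2(S, H_div_R0 R), via the identification of the Bochner space
   L^2(S, L^2(unit_cell)) with L^2(S \<times> unit_cell). *)
definition L2_H_div_R0 ::
    "(real^'n) set \<Rightarrow> real^'n^'m \<Rightarrow> ((real^'n) \<times> (real^'m) \<Rightarrow> real^'n) set" where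
  "L2_H_div_R0 S R =
     {v. v \<in> L2_on (S \<times> unit_cell) \<and> (AE x in lebesgue_on S. (\<lambda>y. v (x, y)) \<in> H_div_R0 R)}"

definition C_per :: "((real^'m) \<Rightarrow>\<^sub>C real) set" where
  "C_per = {f. periodic (apply_bcontfun f)}"

(* The Bochner space L^2(S, C_per), C_per carrying the supremum norm. Strong measurability
   is spelled out, because the type of bounded continuous functions is not second countable. *)
definition L2_C_per :: "(real^'n) set \<Rightarrow> (real^'n \<Rightarrow> ((real^'m) \<Rightarrow>\<^sub>C real)) set" where
  "L2_C_per S =
     {\<Phi>. (\<forall>x\<in>S. \<Phi> x \<in> C_per) \<and>
         (\<exists>s :: nat \<Rightarrow> real^'n \<Rightarrow> ((real^'m) \<Rightarrow>\<^sub>C real).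
            (\<forall>j. simple_function (lebesgue_on S) (s j) \<and> (\<forall>x\<in>S. s j x \<in> C_per)) \<and>
            (AE x in lebesgue_on S. (\<lambda>j. s j x) \<longlonglongrightarrow> \<Phi> x)) \<and>
         integrable (lebesgue_on S) (\<lambda>x. (norm (\<Phi> x))\<^sup>2)}"

definition weak_two_scale_converges ::
    "(real^'n) set \<Rightarrow> real^'n^'m \<Rightarrow> (nat \<Rightarrow> real) \<Rightarrow> (nat \<Rightarrow> real^'n \<Rightarrow> real) \<Rightarrow>
     ((real^'n) \<times> (real^'m) \<Rightarrow> real) \<Rightarrow> bool" where
  "weak_two_scale_converges S R \<eta> u u0 \<longleftrightarrow>
     (\<forall>n. u n \<in> L2_on S) \<and> u0 \<in> L2_on (S \<times> unit_cell) \<and>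
     (\<forall>\<Phi>\<in>L2_C_per S.
        (\<lambda>n. LINT x|lebesgue_on S. u n x * apply_bcontfun (\<Phi> x) ((1 / \<eta> n) *\<^sub>R (R *v x)))
        \<longlonglongrightarrow>
        (LINT z|lebesgue_on (S \<times> unit_cell). u0 z * apply_bcontfun (\<Phi> (fst z)) (snd z)))"

end

theory Submission
  imports Defs "HOL-Library.Diagonal_Subsequence"
begin

text \<open>
The matrix \<open>R\<close> winds \<open>\<real>\<^sup>n\<close> densely around the \<open>m\<close>-torus: because \<open>R\<^sup>T k \<noteq> 0\<close> for every nonzero
integer vector \<open>k\<close>, a character \<open>cos (2 \<pi> k \<bullet> y + \<theta>)\<close> evaluated at \<open>y = R x / \<eta>\<close> is a plane wave in
\<open>x\<close> whose frequency \<open>2 \<pi> R\<^sup>T k / \<eta>\<close> tends to infinity. By the Riemann--Lebesgue lemma its integral over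
any bounded open set vanishes in the limit, which is also its mean over the cell. Hence
\<open>\<integral>\<^sub>S f (x, R x / \<eta>) dx\<close> tends to the integral of \<open>f\<close> over \<open>S \<times> Y\<close> for every linear combination
\<open>f\<close> of products of an indicator of an open set in \<open>x\<close> and a character in \<open>y\<close>
(\<open>mean_value_tensor_poly\<close>). These combinations form an algebra, so the statement applies to \<open>f\<^sup>2\<close>.

This gives compactness. Along a diagonal subsequence the pairings of \<open>u\<^sub>\<eta>\<close> with countably many such
products converge, and the limit is a linear functional of \<open>f\<close> that is bounded by
\<open>C (\<integral> f\<^sup>2)\<^bsup>1/2\<^esup>\<close>, by Cauchy--Schwarz and the mean value property of \<open>f\<^sup>2\<close>. The Riesz representation
theorem (\<open>Riesz_representation_sq_int\<close>) yields \<open>u\<^sub>0\<close>. Pairing with \<open>u\<^sub>\<eta>\<close> and with \<open>u\<^sub>0\<close> are uniformly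
bounded functionals on \<open>L\<^sup>2(S, C\<^sub>p\<^sub>e\<^sub>r)\<close>, so the convergence passes to the closed span of the products,
and this span is the whole space: a Dynkin class argument reaches all measurable sets, the
Stone--Weierstrass theorem on the torus reaches all continuous periodic functions, and strong
measurability does the rest (\<open>converges_if_generators\<close>).

The two divergence conditions come from testing \<open>div u\<^sub>\<eta> = 0\<close>. The test function
\<open>\<eta> \<phi>(x) w(R x / \<eta>)\<close> has gradient \<open>\<phi> R\<^sup>T \<nabla>w + \<eta> w \<nabla>\<phi>\<close>, where the last term disappears in the
limit; what remains says that \<open>x \<mapsto> \<integral>\<^sub>Y u\<^sub>0(x, y) \<bullet> R\<^sup>T \<nabla>w(y) dy\<close> is orthogonal to all \<open>\<phi>\<close>, hence zero almost
everywhere by the fundamental lemma of the calculus of variations. The exceptional null set depends on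
\<open>w\<close>, but the gradients of all periodic test functions contain a countable uniformly dense subfamily, and
so one null set serves every \<open>w\<close>. Test functions \<open>\<phi>(x)\<close> alone give the condition on the cell average.
\<close>

section \<open>Square-integrable functions and the Riesz representation theorem\<close>

text \<open>
Square integrability is a predicate on functions, not on classes, because test functions are evaluated along
the graph \<open>x \<mapsto> (x, R x / \<eta>)\<close>.
\<close>

definition sq_int :: "'a measure \<Rightarrow> ('a \<Rightarrow> real) \<Rightarrow> bool" where
  "sq_int M f \<longleftrightarrow> f \<in> borel_measurable M \<and> integrable M (\<lambda>x. (f x)\<^sup>2)"

lemma sq_int_mult:
  assumes "sq_int M f" "sq_int M g"
  shows "integrable M (\<lambda>x. f x * g x)"
proof (rule Bochner_Integration.integrable_bound)
  show "integrable M (\<lambda>x. (f x)\<^sup>2 + (g x)\<^sup>2)" using assms by (auto simp: sq_int_def)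
  show "(\<lambda>x. f x * g x) \<in> borel_measurable M" using assms by (auto simp: sq_int_def)
  have "\<bar>a * b\<bar> \<le> a\<^sup>2 + b\<^sup>2" for a b :: real
  proof -
    have "2 * (\<bar>a\<bar> * \<bar>b\<bar>) \<le> a\<^sup>2 + b\<^sup>2"
      using sum_squares_bound[of "\<bar>a\<bar>" "\<bar>b\<bar>"] by (simp add: mult.assoc)
    moreover have "0 \<le> \<bar>a\<bar> * \<bar>b\<bar>" by simp
    ultimately show ?thesis unfolding abs_mult by linarith
  qed
  then show "AE x in M. norm (f x * g x) \<le> norm ((f x)\<^sup>2 + (g x)\<^sup>2)" by simp
qed

lemma sq_int_add:
  assumes "sq_int M f" "sq_int M g" shows "sq_int M (\<lambda>x. f x + g x)"
  using sq_int_mult[OF assms] assms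
  by (auto simp: sq_int_def power2_sum mult.assoc)

lemma sq_int_scale:
  assumes "sq_int M f" shows "sq_int M (\<lambda>x. c * f x)"
  using assms by (auto simp: sq_int_def power_mult_distrib)

lemma sq_int_diff:
  assumes "sq_int M f" "sq_int M g" shows "sq_int M (\<lambda>x. f x - g x)"
  using sq_int_add[OF assms(1) sq_int_scale[OF assms(2), of "-1"]] by simp

text \<open>
The discriminant criterion, including the degenerate case \<open>a = 0\<close>.
\<close>

lemma quadratic_nonneg_linear_coeff:
  fixes a b c :: real
  assumes "\<And>t. c + 2 * t * b + t\<^sup>2 * a \<ge> 0" "a \<ge> 0"
  shows "b\<^sup>2 \<le> a * c"
proof (cases "a = 0")
  case True
  have "b = 0"
  proof (rule ccontr)
    assume "b \<noteq> 0"
    with assms(1)[of "-(c+1)/(2*b)"] True show False by (simp add: field_simps)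
  qed
  with True show ?thesis by simp
next
  case False
  then have "a > 0" using assms(2) by simp
  with assms(1)[of "-b/a"] show ?thesis by (simp add: field_simps power2_eq_square)
qed

lemma integral_sq_add:
  assumes "sq_int M f" "sq_int M g"
  shows "(LINT x|M. (f x + t * g x)\<^sup>2) =
    (LINT x|M. (f x)\<^sup>2) + 2 * t * (LINT x|M. f x * g x) + t\<^sup>2 * (LINT x|M. (g x)\<^sup>2)"
proof -
  have "(LINT x|M. (f x + t * g x)\<^sup>2) =
    (LINT x|M. (f x)\<^sup>2 + (2 * t) * (f x * g x) + t\<^sup>2 * (g x)\<^sup>2)"
    by (rule Bochner_Integration.integral_cong) (auto simp: power2_eq_square algebra_simps)
  also have "\<dots> = (LINT x|M. (f x)\<^sup>2) + 2 * t * (LINT x|M. f x * g x) + t\<^sup>2 * (LINT x|M. (g x)\<^sup>2)"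
    using assms sq_int_mult[OF assms] by (subst Bochner_Integration.integral_add | auto simp: sq_int_def)+
  finally show ?thesis .
qed

lemma Cauchy_Schwarz_sq_int:
  assumes "sq_int M f" "sq_int M g"
  shows "\<bar>LINT x|M. f x * g x\<bar> \<le> sqrt (LINT x|M. (f x)\<^sup>2) * sqrt (LINT x|M. (g x)\<^sup>2)"
proof -
  have "(LINT x|M. f x * g x)\<^sup>2 \<le> (LINT x|M. (g x)\<^sup>2) * (LINT x|M. (f x)\<^sup>2)"
    by (rule quadratic_nonneg_linear_coeff) (simp_all add: integral_sq_add[OF assms, symmetric])
  from real_sqrt_le_mono[OF this] show ?thesis by (simp add: real_sqrt_mult mult.commute)
qed

text \<open>
Completeness of \<open>L\<^sup>2\<close> in quantitative form: a geometric rate gives convergence almost everywhere, and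
Fatou's lemma transfers the rate to the limit.
\<close>

lemma Cauchy_sequence_sq_int_limit:
  assumes f: "\<And>n. sq_int M (f n)"
    and cauchy: "\<And>m n. n \<le> m \<Longrightarrow> (LINT x|M. (f m x - f n x)\<^sup>2) \<le> (1/8)^n"
  obtains u where "sq_int M u" "\<And>n. (LINT x|M. (u x - f n x)\<^sup>2) \<le> (1/8)^n"
proof -
  have meas[measurable]: "\<And>n. f n \<in> borel_measurable M" using f by (auto simp: sq_int_def)
  have nn: "(\<integral>\<^sup>+x. ennreal ((f m x - f n x)\<^sup>2) \<partial>M) \<le> ennreal ((1/8)^n)" if "n \<le> m" for m n
    using sq_int_diff[OF f f, of m n] cauchy[OF that]
    by (subst nn_integral_eq_integral) (auto simp: sq_int_def intro!: ennreal_leI)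
  \<comment> \<open>The weight \<open>2\<^sup>n\<close> is absorbed by the rate \<open>8\<^sup>-\<^sup>n\<close>, and almost everywhere finiteness of the weighted sum
    makes the increments decay geometrically.\<close>
  have "(\<integral>\<^sup>+x. (\<Sum>n. ennreal (2^n * (f (Suc n) x - f n x)\<^sup>2)) \<partial>M)
      = (\<Sum>n. \<integral>\<^sup>+x. ennreal (2^n * (f (Suc n) x - f n x)\<^sup>2) \<partial>M)"
    by (rule nn_integral_suminf) auto
  also have "\<dots> \<le> (\<Sum>n. ennreal ((1/4)^n))"
  proof (rule suminf_le)
    fix n
    have "(\<integral>\<^sup>+x. ennreal (2^n * (f (Suc n) x - f n x)\<^sup>2) \<partial>M)
        = ennreal (2^n) * (\<integral>\<^sup>+x. ennreal ((f (Suc n) x - f n x)\<^sup>2) \<partial>M)"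
      by (subst nn_integral_cmult[symmetric]) (auto simp: ennreal_mult)
    also have "\<dots> \<le> ennreal (2^n) * ennreal ((1/8)^n)"
      by (intro mult_left_mono nn) auto
    also have "\<dots> = ennreal ((1/4)^n)"
      by (subst ennreal_mult[symmetric]) (auto simp: power_mult_distrib[symmetric])
    finally show "(\<integral>\<^sup>+x. ennreal (2^n * (f (Suc n) x - f n x)\<^sup>2) \<partial>M) \<le> ennreal ((1/4)^n)" .
  qed auto
  also have "\<dots> = ennreal (\<Sum>n. (1/4)^n)"
    by (rule suminf_ennreal2) (auto intro: summable_geometric)
  also have "\<dots> < \<infinity>" by simp
  finally have fin: "(\<integral>\<^sup>+x. (\<Sum>n. ennreal (2^n * (f (Suc n) x - f n x)\<^sup>2)) \<partial>M) \<noteq> \<infinity>" by simp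
  have AEfin: "AE x in M. (\<Sum>n. ennreal (2^n * (f (Suc n) x - f n x)\<^sup>2)) \<noteq> \<infinity>"
    by (rule nn_integral_noteq_infinite[OF _ fin]) measurable
  have conv: "AE x in M. convergent (\<lambda>n. f n x)"
    using AEfin
  proof eventually_elim
    case (elim x)
    then have "summable (\<lambda>n. 2^n * (f (Suc n) x - f n x)\<^sup>2)"
      by (intro summable_suminf_not_top) auto
    then have "(\<lambda>n. 2^n * (f (Suc n) x - f n x)\<^sup>2) \<longlonglongrightarrow> 0" by (rule summable_LIMSEQ_zero)
    then have "Bseq (\<lambda>n. 2^n * (f (Suc n) x - f n x)\<^sup>2)" 
      using convergent_def convergent_imp_Bseq by blast
    then obtain K where K: "K > 0" "\<And>n. norm (2^n * (f (Suc n) x - f n x)\<^sup>2) \<le> K"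
      by (auto simp: Bseq_def)
    have bd: "norm (f (Suc n) x - f n x) \<le> sqrt K * (sqrt (1/2))^n" for n
    proof -
      have "(f (Suc n) x - f n x)\<^sup>2 \<le> K * (1/2)^n"
        using K(2)[of n] by (simp add: field_simps power_one_over)
      from real_sqrt_le_mono[OF this] show ?thesis
        by (simp only: real_sqrt_mult real_sqrt_power[symmetric] real_sqrt_abs real_norm_def)
    qed
    have "summable (\<lambda>n. f (Suc n) x - f n x)"
      by (rule summable_comparison_test'[OF _ bd])
        (intro summable_mult summable_geometric, auto)
    then have "convergent (\<lambda>n. \<Sum>i<n. f (Suc i) x - f i x)"
      by (simp add: summable_iff_convergent)
    then have "convergent (\<lambda>n. f n x - f 0 x)" 
      by (simp only: sum_lessThan_telescope[where f="\<lambda>i. f i x"])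
    then have "convergent (\<lambda>n. (f n x - f 0 x) + f 0 x)" by (intro convergent_add convergent_const)
    then show ?case by simp
  qed
  define u where "u x = lim (\<lambda>n. f n x)" for x
  have um[measurable]: "u \<in> borel_measurable M" unfolding u_def by measurable
  have lim: "AE x in M. (\<lambda>n. f n x) \<longlonglongrightarrow> u x"
    using conv by eventually_elim (simp add: u_def convergent_LIMSEQ_iff)
  have fatou: "(\<integral>\<^sup>+x. ennreal ((u x - f n x)\<^sup>2) \<partial>M) \<le> ennreal ((1/8)^n)" for n
  proof -
    have "(\<integral>\<^sup>+x. ennreal ((u x - f n x)\<^sup>2) \<partial>M)
        = (\<integral>\<^sup>+x. liminf (\<lambda>m. ennreal ((f m x - f n x)\<^sup>2)) \<partial>M)"
    proof (rule nn_integral_cong_AE, use lim in eventually_elim)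
      case (elim x)
      have "(\<lambda>m. ennreal ((f m x - f n x)\<^sup>2)) \<longlonglongrightarrow> ennreal ((u x - f n x)\<^sup>2)"
        by (intro tendsto_intros elim)
      from lim_imp_Liminf[OF sequentially_bot this] show ?case by (rule sym)
    qed
    also have "\<dots> \<le> liminf (\<lambda>m. \<integral>\<^sup>+x. ennreal ((f m x - f n x)\<^sup>2) \<partial>M)"
      by (rule nn_integral_liminf) auto
    also have "\<dots> \<le> ennreal ((1/8)^n)"
      by (rule Liminf_le) (auto intro!: eventually_sequentiallyI[of n] nn)
    finally show ?thesis .
  qed
  have du: "sq_int M (\<lambda>x. u x - f n x)" for n
    unfolding sq_int_def
  proof (intro conjI integrableI_bounded)
    show "(\<integral>\<^sup>+ x. ennreal (norm ((u x - f n x)\<^sup>2)) \<partial>M) < \<infinity>"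
      using fatou[of n] by (auto intro: le_less_trans)
  qed auto
  show ?thesis
  proof
    show "sq_int M u" using sq_int_add[OF du[of 0] f[of 0]] by simp
    show "(LINT x|M. (u x - f n x)\<^sup>2) \<le> (1/8)^n" for n
      using fatou[of n] du[of n] by (subst (asm) nn_integral_eq_integral) (auto simp: sq_int_def)
  qed
qed

text \<open>
Minimising \<open>\<parallel>f\<parallel>\<^sup>2 - 2 l f\<close> over the subspace \<open>D\<close>: a minimising sequence is Cauchy, and the first-order
condition at its limit is the representation formula. The minimiser lies in the \<open>L\<^sup>2\<close>-closure of \<open>D\<close>, so \<open>D\<close>
may be a mere space of functions.
\<close>

theorem Riesz_representation_sq_int:
  fixes D :: "('a \<Rightarrow> real) set" and l :: "('a \<Rightarrow> real) \<Rightarrow> real"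
  assumes D: "\<And>f. f \<in> D \<Longrightarrow> sq_int M f" "D \<noteq> {}"
    and Dadd: "\<And>f g. f \<in> D \<Longrightarrow> g \<in> D \<Longrightarrow> (\<lambda>x. f x + g x) \<in> D"
    and Dscale: "\<And>f c. f \<in> D \<Longrightarrow> (\<lambda>x. c * f x) \<in> D"
    and ladd: "\<And>f g. f \<in> D \<Longrightarrow> g \<in> D \<Longrightarrow> l (\<lambda>x. f x + g x) = l f + l g"
    and lscale: "\<And>f c. f \<in> D \<Longrightarrow> l (\<lambda>x. c * f x) = c * l f"
    and bound: "\<And>f. f \<in> D \<Longrightarrow> \<bar>l f\<bar> \<le> C * sqrt (LINT x|M. (f x)\<^sup>2)"
  obtains u where "sq_int M u" "\<And>f. f \<in> D \<Longrightarrow> (LINT x|M. u x * f x) = l f"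
proof -
  define J where "J f = (LINT x|M. (f x)\<^sup>2) - 2 * l f" for f
  have Jge: "J f \<ge> - (C\<^sup>2)" if "f \<in> D" for f
  proof -
    define N where "N = sqrt (LINT x|M. (f x)\<^sup>2)"
    have "(LINT x|M. (f x)\<^sup>2) = N\<^sup>2" by (simp add: N_def)
    moreover have "0 \<le> (N - C)\<^sup>2" by simp
    moreover have "l f \<le> C * N" using bound[OF that] by (simp add: N_def)
    ultimately show ?thesis by (simp add: J_def power2_eq_square algebra_simps)
  qed
  have bdd: "bdd_below (J ` D)" using Jge by (auto intro!: bdd_belowI)
  define j where "j = Inf (J ` D)"
  have jle: "j \<le> J f" if "f \<in> D" for f unfolding j_def using bdd that by (auto intro: cINF_lower)
  have "\<exists>f\<in>D. J f < j + (1/4) * (1/8)^n" for n :: nat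
  proof -
    have "Inf (J ` D) < j + (1/4) * (1/8)^n" by (simp add: j_def)
    from cInf_lessD[OF _ this] D(2) show ?thesis by auto
  qed
  then obtain f where f: "\<And>n. f n \<in> D" "\<And>n::nat. J (f n) < j + (1/4) * (1/8)^n" by metis
  have L: "l (\<lambda>x. f x + t * g x) = l f + t * l g" if "f \<in> D" "g \<in> D" for f g t
    by (simp add: ladd[OF that(1) Dscale[OF that(2)]] lscale that)
  have DD: "(\<lambda>x. f x + t * g x) \<in> D" if "f \<in> D" "g \<in> D" for f g t
    using that by (intro Dadd Dscale) auto
  have J: "J (\<lambda>x. f x + t * g x) = J f + 2 * t * ((LINT x|M. f x * g x) - l g) + t\<^sup>2 * (LINT x|M. (g x)\<^sup>2)"
    if "f \<in> D" "g \<in> D" for f g t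
    using that by (simp add: J_def L integral_sq_add D algebra_simps)
  \<comment> \<open>The midpoint of two near-minimisers cannot go below the infimum, so the parallelogram law forces
    them to be close.\<close>
  have para: "(LINT x|M. (f m x - f n x)\<^sup>2) \<le> (1/8)^n" if "n \<le> m" for m n
  proof -
    let ?I = "\<lambda>f. LINT x|M. (f x)\<^sup>2"
    let ?h = "\<lambda>x. (1/2) * (f m x + 1 * f n x)"
    have h: "?h \<in> D" using f by (intro Dscale DD)
    have "?I ?h = (1/4) * ?I (\<lambda>x. f m x + 1 * f n x)"
      by (subst integral_mult_right_zero[symmetric], rule Bochner_Integration.integral_cong)
        (auto simp: power2_eq_square algebra_simps)
    moreover have "l ?h = (1/2) * (l (f m) + l (f n))"
      using lscale[OF DD[OF f(1)[of m] f(1)[of n], of 1], of "1/2"] L[OF f(1)[of m] f(1)[of n], of 1] by simp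
    moreover have "j \<le> J ?h" by (rule jle[OF h])
    ultimately have h2: "4 * j \<le> ?I (\<lambda>x. f m x + 1 * f n x) - 4 * (l (f m) + l (f n))"
      by (simp add: J_def)
    have "?I (\<lambda>x. f m x + 1 * f n x) + ?I (\<lambda>x. f m x + (-1) * f n x) = 2 * ?I (f m) + 2 * ?I (f n)"
      by (simp only: integral_sq_add[OF D(1)[OF f(1)] D(1)[OF f(1)]]) simp
    then have "(LINT x|M. (f m x - f n x)\<^sup>2) \<le> 2 * (J (f m) - j) + 2 * (J (f n) - j)"
      using h2 by (simp add: J_def)
    also have "\<dots> \<le> (1/2) * (1/8)^m + (1/2) * (1/8)^n" using f(2)[of m] f(2)[of n] by simp
    also have "\<dots> \<le> (1/2) * (1/8)^n + (1/2) * (1/8)^n"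
      using that by (intro add_mono mult_left_mono power_decreasing) auto
    finally show ?thesis by simp
  qed
  from Cauchy_sequence_sq_int_limit[of M f, OF D(1)[OF f(1)] para]
  obtain u where u: "sq_int M u" "\<And>n. (LINT x|M. (u x - f n x)\<^sup>2) \<le> (1/8)^n" by blast
  have "(LINT x|M. u x * g x) = l g" if g: "g \<in> D" for g
  proof -
    let ?G = "LINT x|M. (g x)\<^sup>2"
    let ?d = "(LINT x|M. u x * g x) - l g"
    have lim: "(\<lambda>n. LINT x|M. f n x * g x) \<longlonglongrightarrow> (LINT x|M. u x * g x)"
    proof (rule Lim_transform2[OF tendsto_const])
      have "\<bar>(LINT x|M. u x * g x) - (LINT x|M. f n x * g x)\<bar> \<le> (sqrt (1/8))^n * sqrt ?G" for n
      proof -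
        have "(LINT x|M. u x * g x) - (LINT x|M. f n x * g x) = (LINT x|M. (u x - f n x) * g x)"
          using sq_int_mult[OF u(1) D(1)[OF g]] sq_int_mult[OF D(1)[OF f(1)] D(1)[OF g]]
          by (simp add: left_diff_distrib)
        moreover have "\<bar>LINT x|M. (u x - f n x) * g x\<bar> \<le> sqrt ((1/8)^n) * sqrt ?G"
          by (intro order_trans[OF Cauchy_Schwarz_sq_int] mult_right_mono real_sqrt_le_mono u
              sq_int_diff D f g) auto
        ultimately show ?thesis by (simp only: real_sqrt_power)
      qed
      moreover have "(\<lambda>n. (sqrt (1/8))^n * sqrt ?G) \<longlonglongrightarrow> 0"
        by (intro tendsto_mult_left_zero LIMSEQ_realpow_zero) auto
      ultimately show "(\<lambda>n. (LINT x|M. u x * g x) - (LINT x|M. f n x * g x)) \<longlonglongrightarrow> 0"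
        unfolding real_norm_def[symmetric] by (rule Lim_null_comparison[OF always_eventually[OF allI]])
    qed
    have "0 \<le> 0 + 2 * t * ?d + t\<^sup>2 * ?G" for t
    proof -
      have "0 \<le> (1/4) * (1/8)^n + 2 * t * ((LINT x|M. f n x * g x) - l g) + t\<^sup>2 * ?G" for n
        using f(2)[of n] J[OF f(1)[of n] g, of t] jle[OF DD[OF f(1)[of n] g, of t]] by linarith
      moreover have "(\<lambda>n. (1/4) * (1/8)^n + 2 * t * ((LINT x|M. f n x * g x) - l g) + t\<^sup>2 * ?G)
         \<longlonglongrightarrow> (1/4) * 0 + 2 * t * ?d + t\<^sup>2 * ?G"
        by (intro tendsto_intros lim LIMSEQ_realpow_zero) auto
      ultimately show ?thesis by (intro LIMSEQ_le_const[where X="\<lambda>n. (1/4) * (1/8)^n + 2 * t * ((LINT x|M. f n x * g x) - l g) + t\<^sup>2 * ?G"]) auto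
    qed
    from quadratic_nonneg_linear_coeff[OF this] show ?thesis by simp
  qed
  with u show ?thesis using that by blast
qed

section \<open>Lebesgue measure on subsets and on products with the unit cell\<close>

lemma borel_measurable_lebesgue_on:
  "f \<in> borel_measurable borel \<Longrightarrow> f \<in> borel_measurable (lebesgue_on T)"
  by (intro measurable_restrict_space1 measurable_completion) simp

lemma open_bounded_lebesgue:
  fixes S :: "'a::euclidean_space set"
  assumes "open S" "bounded S"
  shows "S \<in> sets borel" "S \<in> sets lebesgue" "emeasure lebesgue S < \<infinity>"
  using assms emeasure_bounded_finite[OF assms(2)] by (auto intro: sets_completionI_sets)

lemma LINT_lebesgue_on_borel:
  fixes f :: "'a::euclidean_space \<Rightarrow> real"
  assumes [measurable]: "S \<in> sets borel" "f \<in> borel_measurable borel"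
  shows "(LINT x|lebesgue_on S. f x) = (LINT x|lborel. indicator S x * f x)"
  by (subst integral_restrict_space) (auto simp: integral_completion)

lemma integrable_lebesgue_on_borel_iff:
  fixes f :: "'a::euclidean_space \<Rightarrow> 'b::euclidean_space"
  assumes [measurable]: "S \<in> sets borel" "f \<in> borel_measurable borel"
  shows "integrable (lebesgue_on S) f \<longleftrightarrow> integrable lborel (\<lambda>x. indicator S x *\<^sub>R f x)"
proof -
  have "integrable (lebesgue_on S) f \<longleftrightarrow> integrable lebesgue (\<lambda>x. indicator S x *\<^sub>R f x)"
    by (rule integrable_restrict_space) auto
  then show ?thesis by (simp add: integrable_completion)
qed

lemma AE_lebesgue_on_iff:
  assumes "S \<in> sets borel"
  shows "(AE x in lebesgue_on S. P x) \<longleftrightarrow> (AE x in lborel. x \<in> S \<longrightarrow> P x)"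
  using assms by (subst AE_restrict_space_iff) (auto simp: AE_completion_iff)

lemma integral_lebesgue_on_subset:
  fixes f :: "'a::euclidean_space \<Rightarrow> real"
  assumes "S \<in> sets lebesgue" "T \<in> sets lebesgue" "T \<subseteq> S"
  shows "(LINT x|lebesgue_on T. f x) = (LINT x|lebesgue_on S. f x * indicator T x)"
  using assms by (subst (1 2) integral_restrict_space) (auto intro!: Bochner_Integration.integral_cong simp: indicator_def)

text \<open>
Completeness of Lebesgue measure: modification on a null set preserves measurability.
\<close>

lemma borel_measurable_lebesgue_on_AE:
  fixes f g :: "'a::euclidean_space \<Rightarrow> real"
  assumes T: "T \<in> sets lebesgue" and f: "f \<in> borel_measurable (lebesgue_on T)"
    and ae: "AE x in lebesgue_on T. f x = g x"
  shows "g \<in> borel_measurable (lebesgue_on T)"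
proof -
  have T': "T \<inter> space lebesgue \<in> sets lebesgue" using T by simp
  have "(\<lambda>x. indicator T x *\<^sub>R f x) \<in> borel_measurable lebesgue"
    using f unfolding borel_measurable_restrict_space_iff[OF T'] .
  moreover have "AE x in lebesgue. indicator T x *\<^sub>R f x = indicator T x *\<^sub>R g x"
    using ae unfolding AE_restrict_space_iff[OF T'] by eventually_elim (auto simp: indicator_def)
  ultimately have "(\<lambda>x. indicator T x *\<^sub>R g x) \<in> borel_measurable lebesgue"
    by (rule borel_measurable_AE)
  then show ?thesis unfolding borel_measurable_restrict_space_iff[OF T'] .
qed

lemma borel_measurable_lebesgue_on_AE_LIMSEQ:
  fixes f :: "nat \<Rightarrow> 'a::euclidean_space \<Rightarrow> real"
  assumes T: "T \<in> sets lebesgue" and f: "\<And>j. f j \<in> borel_measurable (lebesgue_on T)"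
    and ae: "AE x in lebesgue_on T. (\<lambda>j. f j x) \<longlonglongrightarrow> g x"
  shows "g \<in> borel_measurable (lebesgue_on T)"
proof (rule borel_measurable_lebesgue_on_AE[OF T])
  show "(\<lambda>x. lim (\<lambda>j. f j x)) \<in> borel_measurable (lebesgue_on T)"
    using f by measurable
  show "AE x in lebesgue_on T. lim (\<lambda>j. f j x) = g x"
    using ae by eventually_elim (rule limI)
qed

text \<open>
Sections of a Borel function are Borel, whereas sections of a Lebesgue measurable function need not be
measurable; limits are therefore replaced by Borel versions before Fubini is applied.
\<close>

lemma borel_representative:
  fixes u :: "'a::euclidean_space \<Rightarrow> real"
  assumes T: "T \<in> sets lebesgue" and u: "u \<in> borel_measurable (lebesgue_on T)"
  obtains u' where "u' \<in> borel_measurable borel" "AE x in lebesgue_on T. u x = u' x"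
proof -
  have T': "T \<inter> space lebesgue \<in> sets lebesgue" using T by simp
  have "(\<lambda>x. indicator T x *\<^sub>R u x) \<in> borel_measurable lebesgue"
    using u unfolding borel_measurable_restrict_space_iff[OF T'] .
  from completion_ex_borel_measurable_real[OF this]
  obtain u' where u': "u' \<in> borel_measurable lborel" "AE x in lborel. indicator T x *\<^sub>R u x = u' x" by auto
  have "AE x in lebesgue_on T. u x = u' x"
    unfolding AE_restrict_space_iff[OF T'] using AE_completion[OF u'(2)] by eventually_elim auto
  with u'(1) that show ?thesis by auto
qed

lemma sq_int_bounded_on:
  assumes "T \<in> sets lebesgue" "emeasure lebesgue T < \<infinity>" "f \<in> borel_measurable (lebesgue_on T)"
    "\<And>x. x \<in> T \<Longrightarrow> \<bar>f x\<bar> \<le> (K::real)"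
  shows "sq_int (lebesgue_on T) f"
proof -
  have "finite_measure (lebesgue_on T)"
    using assms by (intro finite_measureI) (simp add: emeasure_restrict_space)
  moreover have "\<bar>f x\<bar>\<^sup>2 \<le> K\<^sup>2" if "x \<in> T" for x by (rule power_mono) (use assms(4)[OF that] in auto)
  ultimately have "integrable (lebesgue_on T) (\<lambda>x. (f x)\<^sup>2)"
    using assms(3) by (intro finite_measure.integrable_const_bound[where B="K\<^sup>2"]) auto
  with assms(3) show ?thesis by (simp add: sq_int_def)
qed

lemma sq_int_integrable:
  assumes "T \<in> sets lebesgue" "emeasure lebesgue T < \<infinity>" "sq_int (lebesgue_on T) f"
  shows "integrable (lebesgue_on T) f"
  using sq_int_mult[OF assms(3) sq_int_bounded_on[OF assms(1,2), of "\<lambda>_. 1" 1]] by simp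

lemma sq_int_mult_bounded:
  fixes f g :: "'a::euclidean_space \<Rightarrow> real"
  assumes f: "sq_int (lebesgue_on T) f" and g: "g \<in> borel_measurable (lebesgue_on T)"
    and K: "\<And>x. x \<in> T \<Longrightarrow> \<bar>g x\<bar> \<le> K"
  shows "sq_int (lebesgue_on T) (\<lambda>x. f x * g x)"
proof -
  have m: "(\<lambda>x. f x * g x) \<in> borel_measurable (lebesgue_on T)"
    using f g by (auto simp: sq_int_def intro: borel_measurable_times)
  have "integrable (lebesgue_on T) (\<lambda>x. (f x * g x)\<^sup>2)"
  proof (rule Bochner_Integration.integrable_bound[OF _ borel_measurable_power[OF m] AE_I2])
    show "integrable (lebesgue_on T) (\<lambda>x. (f x)\<^sup>2 * K\<^sup>2)" using f by (simp add: sq_int_def)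
    fix x assume "x \<in> space (lebesgue_on T)"
    then have "\<bar>g x\<bar>\<^sup>2 \<le> K\<^sup>2" by (intro power_mono K) auto
    then show "norm ((f x * g x)\<^sup>2) \<le> norm ((f x)\<^sup>2 * K\<^sup>2)"
      by (simp add: power_mult_distrib mult_left_mono)
  qed
  with m show ?thesis by (simp add: sq_int_def)
qed

lemma continuous_sq_int:
  fixes f :: "'a::euclidean_space \<Rightarrow> real"
  assumes S: "open S" "bounded S" and f: "continuous_on UNIV f"
  shows "sq_int (lebesgue_on S) f"
proof -
  have "compact (closure S)" using S(2) by (simp add: compact_closure)
  then have "bounded (f ` closure S)"
    by (intro compact_imp_bounded compact_continuous_image continuous_on_subset[OF f]) auto
  then obtain K where "\<And>x. x \<in> closure S \<Longrightarrow> \<bar>f x\<bar> \<le> K" by (auto simp: bounded_iff)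
  then show ?thesis using open_bounded_lebesgue[OF S] f closure_subset[of S]
    by (intro sq_int_bounded_on[where K=K] borel_measurable_lebesgue_on borel_measurable_continuous_onI) auto
qed

lemma unit_cell_eq_box: "unit_cell = box 0 (1 :: real^'m)"
  by (auto simp: unit_cell_def mem_box_cart)

lemma emeasure_unit_cell [simp]: "emeasure lborel (unit_cell :: (real^'m) set) = 1"
  by (auto simp: unit_cell_eq_box emeasure_lborel_box_eq Basis_vec_def inner_axis intro!: prod.neutral)

lemma borel_unit_cell [measurable, simp]: "unit_cell \<in> sets borel"
  by (simp add: unit_cell_eq_box)

lemma unit_cell_lebesgue: "unit_cell \<in> sets lebesgue" "emeasure lebesgue (unit_cell :: (real^'m) set) = 1"
  by (auto intro: sets_completionI_sets)

lemma sq_int_cell_const: "sq_int (lebesgue_on (unit_cell :: (real^'m) set)) (\<lambda>_. 1)"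
  by (rule sq_int_bounded_on[of _ _ 1]) (auto simp: unit_cell_lebesgue)

text \<open>
Preimages of null sets under the projection are null, which upgrades Borel to Lebesgue measurability.
\<close>

lemma fst_lebesgue_measurable:
  "fst \<in> (lebesgue :: ('a::euclidean_space \<times> 'b::euclidean_space) measure) \<rightarrow>\<^sub>M (lebesgue :: 'a measure)"
proof (rule completion.measurable_completion2)
  show m: "fst \<in> (lebesgue :: ('a \<times> 'b) measure) \<rightarrow>\<^sub>M (lborel :: 'a measure)"
    by (rule measurable_completion) (simp add: lborel_prod[symmetric] borel_prod[symmetric])
  show "null_sets lborel \<subseteq> null_sets (distr (lebesgue :: ('a \<times> 'b) measure) lborel fst)"
  proof
    fix A :: "'a set" assume A: "A \<in> null_sets lborel"
  then have [measurable]: "A \<in> sets borel" by auto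
  have "emeasure (lborel \<Otimes>\<^sub>M lborel) (A \<times> (UNIV :: 'b set)) = emeasure lborel A * emeasure lborel (UNIV :: 'b set)"
    by (rule lborel.emeasure_pair_measure_Times) auto
  also have "\<dots> = 0" using A by auto
  finally have "A \<times> (UNIV :: 'b set) \<in> null_sets lborel"
    by (auto simp: lborel_prod null_sets_def borel_prod[symmetric])
  moreover have "fst -` A \<inter> space lebesgue = A \<times> (UNIV :: 'b set)" by auto
  ultimately show "A \<in> null_sets (distr (lebesgue :: ('a \<times> 'b) measure) lborel fst)"
    using A by (simp add: null_sets_distr_iff[OF m] null_sets_completionI)
  qed
qed

lemma sets_lebesgue_Times_borel:
  fixes A :: "'a::euclidean_space set" and B :: "'b::euclidean_space set"
  assumes "A \<in> sets lebesgue" "B \<in> sets borel"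
  shows "A \<times> B \<in> sets lebesgue"
proof -
  have "UNIV \<times> B \<in> sets (borel \<Otimes>\<^sub>M borel :: ('a \<times> 'b) measure)" using assms(2) by (intro pair_measureI) auto
  then have "UNIV \<times> B \<in> sets (borel :: ('a \<times> 'b) measure)" unfolding borel_prod .
  then have "UNIV \<times> B \<in> sets (lebesgue :: ('a \<times> 'b) measure)" by (simp add: sets_completionI_sets)
  moreover have "fst -` A \<inter> space (lebesgue :: ('a \<times> 'b) measure) \<in> sets lebesgue"
    by (rule measurable_sets[OF fst_lebesgue_measurable assms(1)])
  ultimately have "(fst -` A \<inter> space (lebesgue :: ('a \<times> 'b) measure)) \<inter> (UNIV \<times> B) \<in> sets lebesgue"
    by (rule sets.Int[rotated])
  also have "(fst -` A \<inter> space (lebesgue :: ('a \<times> 'b) measure)) \<inter> (UNIV \<times> B) = A \<times> B" by auto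
  finally show ?thesis .
qed

lemma emeasure_lebesgue_Times_cell:
  fixes A :: "'a::euclidean_space set"
  assumes "A \<in> sets lebesgue"
  shows "emeasure lebesgue (A \<times> (unit_cell :: (real^'m) set)) = emeasure lebesgue A"
proof -
  let ?U = "unit_cell :: (real^'m) set"
  obtain B N N' where B: "A = B \<union> N" "N \<subseteq> N'" "N' \<in> null_sets lborel" "B \<in> sets lborel"
    using assms by (elim sets_completionE)
  then have Bb[measurable]: "B \<in> sets borel" by simp
  have BU: "B \<times> ?U \<in> sets lborel" unfolding borel_prod[symmetric] sets_lborel by (intro pair_measureI) auto
  have N: "AE x in lebesgue. x \<notin> N'" using B(3) by (auto intro: AE_not_in AE_completion)
  have N2: "AE z in (lebesgue :: ('a \<times> (real^'m)) measure). fst z \<notin> N'"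
  proof -
    have "emeasure (lborel \<Otimes>\<^sub>M lborel) (N' \<times> (UNIV :: (real^'m) set)) = emeasure lborel N' * emeasure lborel (UNIV :: (real^'m) set)"
      using B(3) by (intro lborel.emeasure_pair_measure_Times) auto
    then have "N' \<times> (UNIV :: (real^'m) set) \<in> null_sets lborel"
      using B(3) by (auto simp: lborel_prod null_sets_def borel_prod[symmetric])
    from AE_completion[OF AE_not_in[OF this]] show ?thesis by eventually_elim auto
  qed
  have "emeasure lebesgue (A \<times> ?U) = emeasure lebesgue (B \<times> ?U)"
  proof (rule emeasure_eq_AE)
    show "AE z in lebesgue. z \<in> A \<times> ?U \<longleftrightarrow> z \<in> B \<times> ?U"
      using N2 by eventually_elim (use B in auto)
  qed (use BU sets_lebesgue_Times_borel[OF assms borel_unit_cell] in auto)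
  also have "\<dots> = emeasure (lborel \<Otimes>\<^sub>M lborel) (B \<times> ?U)" using BU by (simp add: lborel_prod)
  also have "\<dots> = emeasure lborel B" by (subst lborel.emeasure_pair_measure_Times) auto
  also have "\<dots> = emeasure lebesgue B" by simp
  also have "\<dots> = emeasure lebesgue A"
  proof (rule emeasure_eq_AE)
    show "AE x in lebesgue. x \<in> B \<longleftrightarrow> x \<in> A" using N by eventually_elim (use B in auto)
  qed (use assms in auto)
  finally show ?thesis .
qed

text \<open>
The cell has measure one, so the projection of \<open>S \<times> Y\<close> onto \<open>S\<close> preserves measure. Functions of \<open>x\<close> can
thus be treated alike on \<open>S\<close> and on \<open>S \<times> Y\<close>.
\<close>

lemma distr_fst_lebesgue_on_cell:
  fixes S :: "'a::euclidean_space set"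
  assumes S: "S \<in> sets lebesgue"
  shows "fst \<in> lebesgue_on (S \<times> (unit_cell :: (real^'m) set)) \<rightarrow>\<^sub>M lebesgue_on S"
    and "distr (lebesgue_on (S \<times> (unit_cell :: (real^'m) set))) (lebesgue_on S) fst = lebesgue_on S"
proof -
  let ?U = "unit_cell :: (real^'m) set"
  show m: "fst \<in> lebesgue_on (S \<times> ?U) \<rightarrow>\<^sub>M lebesgue_on S"
    by (rule measurable_restrict_space3[OF fst_lebesgue_measurable]) auto
  show "distr (lebesgue_on (S \<times> ?U)) (lebesgue_on S) fst = lebesgue_on S"
  proof (rule measure_eqI)
    fix A assume "A \<in> sets (distr (lebesgue_on (S \<times> ?U)) (lebesgue_on S) fst)"
    then have A: "A \<in> sets (lebesgue_on S)" by simp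
    then have A': "A \<in> sets lebesgue" "A \<subseteq> S" using S by (auto simp: sets_restrict_space_iff)
    have "emeasure (distr (lebesgue_on (S \<times> ?U)) (lebesgue_on S) fst) A = emeasure (lebesgue_on (S \<times> ?U)) (A \<times> ?U)"
      using A A' by (subst emeasure_distr[OF m A]) (auto intro!: arg_cong2[where f=emeasure])
    also have "\<dots> = emeasure lebesgue (A \<times> ?U)"
      using A' sets_lebesgue_Times_borel[OF S borel_unit_cell] by (intro emeasure_restrict_space) auto
    also have "\<dots> = emeasure (lebesgue_on S) A"
      using A' S by (simp add: emeasure_lebesgue_Times_cell emeasure_restrict_space)
    finally show "emeasure (distr (lebesgue_on (S \<times> ?U)) (lebesgue_on S) fst) A = emeasure (lebesgue_on S) A" .
  qed simp
qed

lemma cell_mean_measurable: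
  fixes f :: "(real^'n) \<times> (real^'m) \<Rightarrow> real"
  assumes f: "f \<in> borel_measurable borel"
  shows "(\<lambda>y. f (x, y)) \<in> borel_measurable borel"
    and "(\<lambda>x. LINT y|lebesgue_on unit_cell. f (x, y)) \<in> borel_measurable borel"
proof -
  have [measurable]: "f \<in> borel_measurable (borel \<Otimes>\<^sub>M borel)" using f by (simp add: borel_prod)
  show sec: "(\<lambda>y. f (x, y)) \<in> borel_measurable borel" for x by measurable
  have "(\<lambda>x. LINT y|lborel. indicator unit_cell y * f (x, y)) \<in> borel_measurable lborel"
    by (rule lborel.borel_measurable_lebesgue_integral) (auto simp: case_prod_beta')
  then show "(\<lambda>x. LINT y|lebesgue_on unit_cell. f (x, y)) \<in> borel_measurable borel"
    by (simp add: LINT_lebesgue_on_borel sec)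
qed

lemma Fubini_cell:
  fixes f :: "(real^'n) \<times> (real^'m) \<Rightarrow> real"
  assumes S: "S \<in> sets borel" and f: "f \<in> borel_measurable borel"
    and int: "integrable (lebesgue_on (S \<times> unit_cell)) f"
  shows "(LINT z|lebesgue_on (S \<times> unit_cell). f z) = (LINT x|lebesgue_on S. LINT y|lebesgue_on unit_cell. f (x, y))"
    and "AE x in lebesgue_on S. integrable (lebesgue_on unit_cell) (\<lambda>y. f (x, y))"
    and "integrable (lebesgue_on S) (\<lambda>x. LINT y|lebesgue_on unit_cell. f (x, y))"
proof -
  let ?U = "unit_cell :: (real^'m) set"
  note [measurable] = S
  have [measurable]: "f \<in> borel_measurable (borel \<Otimes>\<^sub>M borel)" using f by (simp add: borel_prod)
  have SU: "S \<times> ?U \<in> sets borel" unfolding borel_prod[symmetric] by (intro pair_measureI) auto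
  let ?g = "\<lambda>(x, y). indicator S x * (indicator ?U y * f (x, y))"
  have g: "(\<lambda>z. indicator (S \<times> ?U) z *\<^sub>R f z) = ?g" by (auto simp: indicator_def)
  have int2: "integrable (lborel \<Otimes>\<^sub>M lborel) ?g"
    using int unfolding integrable_lebesgue_on_borel_iff[OF SU f] g by (simp add: lborel_prod)
  note sec = cell_mean_measurable(1)[OF f] and meas = cell_mean_measurable(2)[OF f]
  have secint: "(LINT y|lebesgue_on ?U. f (x, y)) = (LINT y|lborel. indicator ?U y * f (x, y))" for x
    by (rule LINT_lebesgue_on_borel) (use sec in auto)
  have "AE x in lborel. integrable lborel (\<lambda>y. indicator S x * (indicator ?U y * f (x, y)))"
    using lborel_pair.AE_integrable_fst[OF int2] by simp
  then show "AE x in lebesgue_on S. integrable (lebesgue_on ?U) (\<lambda>y. f (x, y))"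
    unfolding AE_lebesgue_on_iff[OF S]
    by eventually_elim (auto simp: integrable_lebesgue_on_borel_iff sec)
  have "integrable lborel (\<lambda>x. LINT y|lborel. indicator S x * (indicator ?U y * f (x, y)))"
    using lborel_pair.integrable_fst'[OF int2] by simp
  then show "integrable (lebesgue_on S) (\<lambda>x. LINT y|lebesgue_on ?U. f (x, y))"
    by (simp add: integrable_lebesgue_on_borel_iff S meas) (simp add: secint)
  have "(LINT z|lebesgue_on (S \<times> ?U). f z) = (LINT z|lborel. ?g z)"
    by (subst LINT_lebesgue_on_borel[OF SU f]) (use g in simp)
  also have "\<dots> = (LINT x|lborel. LINT y|lborel. indicator S x * (indicator ?U y * f (x, y)))"
    using lborel_pair.integral_fst'[OF int2] by (simp add: lborel_prod)
  also have "\<dots> = (LINT x|lebesgue_on S. LINT y|lebesgue_on ?U. f (x, y))"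
    by (subst LINT_lebesgue_on_borel[OF S meas]) (simp add: secint)
  finally show "(LINT z|lebesgue_on (S \<times> ?U). f z) = (LINT x|lebesgue_on S. LINT y|lebesgue_on ?U. f (x, y))" .
qed

text \<open>
Averaging over a space of total mass one is a contraction in \<open>L\<^sup>2\<close>.
\<close>

lemma sq_int_cell_mean:
  fixes f :: "(real^'n) \<times> (real^'m) \<Rightarrow> real"
  assumes S: "S \<in> sets borel" and f: "f \<in> borel_measurable borel"
    and sq: "sq_int (lebesgue_on (S \<times> unit_cell)) f"
  shows "sq_int (lebesgue_on S) (\<lambda>x. LINT y|lebesgue_on unit_cell. f (x, y))"
proof -
  let ?U = "unit_cell :: (real^'m) set"
  have f2: "(\<lambda>z. (f z)\<^sup>2) \<in> borel_measurable borel" using f by measurable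
  have int2: "integrable (lebesgue_on (S \<times> ?U)) (\<lambda>z. (f z)\<^sup>2)" using sq by (simp add: sq_int_def)
  note sec = cell_mean_measurable(1)[OF f] and meas = cell_mean_measurable(2)[OF f]
  have "AE x in lebesgue_on S. (LINT y|lebesgue_on ?U. f (x, y))\<^sup>2 \<le> (LINT y|lebesgue_on ?U. (f (x, y))\<^sup>2)"
    using Fubini_cell(2)[OF S f2 int2]
  proof eventually_elim
    case (elim x)
    then have s: "sq_int (lebesgue_on ?U) (\<lambda>y. f (x, y))"
      using borel_measurable_lebesgue_on[OF sec] by (simp add: sq_int_def)
    have "\<bar>LINT y|lebesgue_on ?U. f (x, y) * 1\<bar> \<le> sqrt (LINT y|lebesgue_on ?U. (f (x, y))\<^sup>2) * sqrt (LINT y|lebesgue_on ?U. (1::real)\<^sup>2)"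
      by (rule Cauchy_Schwarz_sq_int[OF s sq_int_cell_const])
    also have "(LINT y|lebesgue_on ?U. (1::real)\<^sup>2) = 1"
      by (simp add: emeasure_restrict_space unit_cell_lebesgue measure_def)
    finally have "\<bar>LINT y|lebesgue_on ?U. f (x, y)\<bar> \<le> sqrt (LINT y|lebesgue_on ?U. (f (x, y))\<^sup>2)" by simp
    from power_mono[OF this, of 2] show ?case by simp
  qed
  then have "integrable (lebesgue_on S) (\<lambda>x. (LINT y|lebesgue_on ?U. f (x, y))\<^sup>2)"
    using borel_measurable_lebesgue_on[OF meas]
    by (intro Bochner_Integration.integrable_bound[OF Fubini_cell(3)[OF S f2 int2]]) auto
  then show ?thesis using borel_measurable_lebesgue_on[OF meas] by (simp add: sq_int_def)
qed

section \<open>Trigonometric polynomials on the torus\<close>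

text \<open>
The phase is a multiple of \<open>\<pi>/2\<close>: this covers sine and cosine with one formula, keeps the family countable and
makes it closed under the product-to-sum formula.
\<close>

definition trig :: "real^'m \<Rightarrow> int \<Rightarrow> real^'m \<Rightarrow> real" where
  "trig k j y = cos (2 * pi * (k \<bullet> y) + of_int j * pi / 2)"

inductive trig_poly :: "(real^'m \<Rightarrow> real) \<Rightarrow> bool" where
  trig: "integer_vec k \<Longrightarrow> trig_poly (trig k j)"
| add: "trig_poly f \<Longrightarrow> trig_poly g \<Longrightarrow> trig_poly (\<lambda>y. f y + g y)"
| scale: "trig_poly f \<Longrightarrow> trig_poly (\<lambda>y. c * f y)"

lemma integer_vec_simps [simp]:
  "integer_vec 0" "integer_vec (axis i 1)"
  "integer_vec a \<Longrightarrow> integer_vec b \<Longrightarrow> integer_vec (a + b)"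
  "integer_vec a \<Longrightarrow> integer_vec b \<Longrightarrow> integer_vec (a - b)"
  by (auto simp: integer_vec_def axis_def)

lemma trig_mult:
  "trig k j y * trig k' j' y = (1/2) * trig (k - k') (j - j') y + (1/2) * trig (k + k') (j + j') y"
  unfolding trig_def cos_times_cos by (simp add: algebra_simps add_divide_distrib diff_divide_distrib)

lemma trig_poly_mult:
  assumes "trig_poly f" "trig_poly g"
  shows "trig_poly (\<lambda>y. f y * g y)"
  using assms(1)
proof induction
  case (trig k j)
  from assms(2) show ?case
  proof induction
    case (trig k' j')
    then show ?case unfolding trig_mult
      using \<open>integer_vec k\<close> by (intro trig_poly.intros) auto
  next
    case (add f g)
    from trig_poly.add[OF add(3,4)] show ?case by (simp only: distrib_left)
  next
    case (scale f c)
    from trig_poly.scale[OF scale(2), of c] show ?case by (simp add: mult_ac)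
  qed
next
  case (add f' g')
  from trig_poly.add[OF add(3,4)] show ?case by (simp only: distrib_right)
next
  case (scale f c)
  from trig_poly.scale[OF scale(2), of c] show ?case by (simp add: mult_ac)
qed

lemma trig_poly_const: "trig_poly (\<lambda>y. c)"
  using trig_poly.scale[OF trig_poly.trig[of 0 0], of c] by (simp add: trig_def)

lemma integer_vec_inner:
  fixes k l :: "real^'m"
  assumes "integer_vec k" "integer_vec l" shows "k \<bullet> l \<in> \<int>"
  using assms by (auto simp: inner_vec_def integer_vec_def intro!: Ints_sum Ints_mult)

lemma periodic_trig: "integer_vec k \<Longrightarrow> periodic (trig k j)"
  for k :: "real^'m"
  unfolding periodic_def
proof (intro allI impI)
  fix l y :: "real^'m" assume "integer_vec k" "integer_vec l"
  then obtain n where "k \<bullet> l = of_int n" using integer_vec_inner Ints_cases by metis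
  then have "2 * pi * (k \<bullet> (y + l)) + of_int j * pi / 2 = (2 * pi * (k \<bullet> y) + of_int j * pi / 2) + 2 * pi * of_int n"
    by (simp add: inner_add_right algebra_simps)
  then show "trig k j (y + l) = trig k j y"
    unfolding trig_def by (metis sin_cos_eq_iff)
qed

lemma periodic_trig_poly: "trig_poly f \<Longrightarrow> periodic f"
  by (induction rule: trig_poly.induct) (use periodic_trig in \<open>auto simp: periodic_def\<close>)

lemma continuous_trig [continuous_intros]:
  fixes f :: "'a::t2_space \<Rightarrow> real^'m"
  shows "continuous_on A f \<Longrightarrow> continuous_on A (\<lambda>x. trig k j (f x))"
  unfolding trig_def by (auto intro!: continuous_intros)

lemma continuous_trig_poly: "trig_poly f \<Longrightarrow> continuous_on A f"
  by (induction rule: trig_poly.induct) (auto intro!: continuous_intros continuous_on_id)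

lemma abs_trig_le: "\<bar>trig k j y\<bar> \<le> 1"
  by (simp add: trig_def)

text \<open>
Coordinatewise, the covering map \<open>\<real>\<^sup>m \<rightarrow> (S\<^sup>1)\<^sup>m\<close>; continuous periodic functions are exactly the continuous
functions on its compact range.
\<close>

definition torus_map :: "real^'m \<Rightarrow> complex^'m" where
  "torus_map y = (\<chi> i. cis (2 * pi * y $ i))"

lemma torus_map_eq_iff: "torus_map y = torus_map z \<longleftrightarrow> integer_vec (y - z)"
proof -
  have "cis (2 * pi * a) = cis (2 * pi * b) \<longleftrightarrow> a - b \<in> \<int>" for a b :: real
  proof -
    have "cis (2 * pi * a) = cis (2 * pi * b) \<longleftrightarrow> (\<exists>n::int. 2 * pi * a = 2 * pi * b + 2 * pi * n)"
      by (simp add: complex_eq_iff sin_cos_eq_iff[symmetric] conj_commute)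
    also have "\<dots> \<longleftrightarrow> (\<exists>n::int. a - b = n)"
    proof -
      have "2 * pi * a = 2 * pi * b + 2 * pi * n \<longleftrightarrow> a - b = n" for n :: real
      proof -
        have "2 * pi * a = 2 * pi * b + 2 * pi * n \<longleftrightarrow> (2 * pi) * a = (2 * pi) * (b + n)"
          by (simp add: algebra_simps)
        then show ?thesis by (simp only: mult_cancel_left) (auto simp: algebra_simps)
      qed
      then show ?thesis by simp
    qed
    finally show ?thesis by (auto simp: Ints_def)
  qed
  then show ?thesis by (simp add: torus_map_def vec_eq_iff integer_vec_def)
qed

lemma torus_map_range: "range torus_map = torus_map ` cbox 0 (1 :: real^'m)"
proof -
  have "torus_map y \<in> torus_map ` cbox 0 1" for y :: "real^'m"
  proof (rule image_eqI)
    show "torus_map y = torus_map (\<chi> i. frac (y $ i))"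
      by (simp add: torus_map_eq_iff integer_vec_def frac_def)
    show "(\<chi> i. frac (y $ i)) \<in> cbox 0 (1 :: real^'m)"
      by (auto simp: mem_box_cart frac_lt_1 less_imp_le)
  qed
  then show ?thesis by auto
qed

lemma continuous_torus_map: "continuous_on A torus_map"
  unfolding torus_map_def cis_conv_exp by (intro continuous_intros continuous_on_vec_lambda)

lemma compact_torus: "compact (range (torus_map :: real^'m \<Rightarrow> _))"
  unfolding torus_map_range by (intro compact_continuous_image continuous_torus_map compact_cbox)

text \<open>
The factor is continuous because \<open>torus_map\<close>, restricted to the compact closed cell, is a closed map.
\<close>

lemma periodic_factor_torus:
  fixes g :: "real^'m \<Rightarrow> real"
  assumes "continuous_on UNIV g" "periodic g"
  obtains h where "continuous_on (range torus_map) h" "\<And>y. h (torus_map y) = g y"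
proof -
  define h where "h z = g (SOME y. torus_map y = z)" for z
  have h: "h (torus_map y) = g y" for y
  proof -
    let ?z = "SOME z. torus_map z = torus_map y"
    have "torus_map ?z = torus_map y" by (rule someI[of _ y]) simp
    then have "integer_vec (?z - y)" by (simp add: torus_map_eq_iff)
    with assms(2) have "g (y + (?z - y)) = g y" unfolding periodic_def by blast
    then show ?thesis by (simp add: h_def)
  qed
  have "continuous_on (range torus_map) h"
    unfolding continuous_on_closed_vimage[OF compact_imp_closed[OF compact_torus]]
  proof (intro allI impI)
    fix B :: "real set" assume "closed B"
    have "h -` B \<inter> range torus_map = torus_map ` (cbox 0 1 \<inter> g -` B)"
      unfolding torus_map_range using h by auto
    moreover have "closed (g -` B)"
      using assms(1) \<open>closed B\<close> by (simp add: continuous_on_eq_continuous_at closed_vimage)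
    ultimately show "closed (h -` B \<inter> range torus_map)"
      by (auto intro!: compact_imp_closed compact_continuous_image continuous_torus_map compact_Int_closed)
  qed
  with h that show ?thesis by blast
qed

text \<open>
Stone--Weierstrass on the torus: trigonometric polynomials form an algebra, and the real and imaginary parts
of the coordinates separate points.
\<close>

theorem trig_poly_dense:
  fixes g :: "real^'m \<Rightarrow> real"
  assumes "continuous_on UNIV g" "periodic g" "e > 0"
  shows "\<exists>f. trig_poly f \<and> (\<forall>y. \<bar>g y - f y\<bar> < e)"
proof -
  obtain h where h: "continuous_on (range torus_map) h" "\<And>y. h (torus_map y) = g y"
    using periodic_factor_torus[OF assms(1,2)] by blast
  define P :: "(complex^'m \<Rightarrow> real) \<Rightarrow> bool" where
    "P p \<longleftrightarrow> continuous_on (range torus_map) p \<and> trig_poly (\<lambda>y. p (torus_map y))" for p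
  have "\<exists>p. P p \<and> (\<forall>z\<in>range torus_map. \<bar>h z - p z\<bar> < e)"
  proof (rule Stone_Weierstrass_HOL[OF compact_torus _ _ _ _ _ h(1) assms(3)])
    fix z w :: "complex^'m" assume zw: "z \<in> range torus_map \<and> w \<in> range torus_map \<and> z \<noteq> w"
    then obtain i where i: "z $ i \<noteq> w $ i" by (auto simp: vec_eq_iff)
    have "P (\<lambda>z. Re (z $ i))"
    proof -
      have "(\<lambda>y. Re (torus_map y $ i)) = trig (axis i 1) 0"
        by (auto simp: torus_map_def trig_def inner_axis inner_axis' fun_eq_iff)
      then show ?thesis by (auto simp: P_def intro!: continuous_intros trig_poly.trig)
    qed
    moreover have "P (\<lambda>z. Im (z $ i))"
    proof -
      have "(\<lambda>y. Im (torus_map y $ i)) = trig (axis i 1) (-1)"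
        by (auto simp: torus_map_def trig_def inner_axis inner_axis' fun_eq_iff cos_diff)
      then show ?thesis by (auto simp: P_def intro!: continuous_intros trig_poly.trig)
    qed
    ultimately show "\<exists>f. P f \<and> f z \<noteq> f w" using i complex_eqI by metis
  qed (auto simp: P_def trig_poly_const intro!: continuous_intros trig_poly.add trig_poly_mult)
  then obtain p where "P p" "\<forall>z\<in>range torus_map. \<bar>h z - p z\<bar> < e" by blast
  with h(2) show ?thesis by (intro exI[of _ "\<lambda>y. p (torus_map y)"]) (auto simp: P_def)
qed

lemma integral_cis_period:
  fixes k :: real
  assumes "k \<in> \<int>" "k \<noteq> 0"
  shows "(LINT t|lborel. indicator {0<..<1} t *\<^sub>R cis (2 * pi * (k * t))) = 0"
proof -
  define c where "c = 2 * pi * k * \<i>"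
  have c: "c \<noteq> 0" using assms by (simp add: c_def)
  have cis: "cis (2 * pi * (k * t)) = exp (c * of_real t)" for t
    by (simp add: cis_conv_exp c_def mult_ac)
  have "has_bochner_integral lborel (\<lambda>t. indicator {0..1} t *\<^sub>R exp (c * of_real t))
      (exp (c * of_real 1) / c - exp (c * of_real 0) / c)"
  proof (rule has_bochner_integral_FTC_Icc)
    show "((\<lambda>t. exp (c * of_real t) / c) has_vector_derivative exp (c * of_real t)) (at t within {0..1})" for t
      by (rule has_vector_derivative_real_field, rule DERIV_cong)
        (auto intro!: derivative_eq_intros simp: c)
  qed (auto intro!: continuous_intros)
  moreover have "exp (c * of_real 1) = 1"
    using assms by (auto simp: c_def exp_eq_1 elim!: Ints_cases)
  ultimately have "(LINT t|lborel. indicator {0..1} t *\<^sub>R exp (c * of_real t)) = 0"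
    by (simp add: has_bochner_integral_integral_eq)
  also have "(LINT t|lborel. indicator {0..1} t *\<^sub>R exp (c * of_real t)) =
      (LINT t|lborel. indicator {0<..<1} t *\<^sub>R exp (c * of_real t))"
  proof (rule integral_cong_AE)
    have "AE t in lborel. t \<noteq> (0::real) \<and> t \<noteq> 1"
      by (intro AE_conjI AE_lborel_singleton)
    then show "AE t in lborel. indicator {0..1} t *\<^sub>R exp (c * of_real t) = indicator {0<..<1} t *\<^sub>R exp (c * of_real t)"
      by eventually_elim (auto simp: indicator_def)
  qed auto
  finally show ?thesis by (simp add: cis)
qed

text \<open>
The integral of \<open>exp (2 \<pi> i k \<bullet> y)\<close> over the cell factors into one-dimensional integrals over a period, and one of
the frequencies is nonzero.
\<close>

lemma integral_trig_cell:
  fixes k :: "real^'m"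
  assumes "integer_vec k" "k \<noteq> 0"
  shows "(LINT y|lborel. indicator unit_cell y * trig k j y) = 0"
proof -
  let ?f = "\<lambda>b::real^'m. \<lambda>t. indicator {0<..<1} t *\<^sub>R cis (2 * pi * ((k \<bullet> b) * t))"
  have int: "integrable lborel (?f b)" for b
    by (rule Bochner_Integration.integrable_bound[OF integrable_real_indicator[of "{0<..<1::real}"]])
      (auto simp: cis_conv_exp indicator_def)
  have prod: "(\<Prod>b\<in>Basis. ?f b (y \<bullet> b)) = indicator unit_cell y *\<^sub>R cis (2 * pi * (k \<bullet> y))" for y :: "real^'m"
  proof -
    have "(\<Prod>b\<in>Basis. ?f b (y \<bullet> b)) = (\<Prod>b\<in>Basis. of_real (indicator {0<..<1} (y \<bullet> b))) *
        (\<Prod>b\<in>Basis. cis (2 * pi * ((k \<bullet> b) * (y \<bullet> b))))"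
      by (simp add: scaleR_conv_of_real prod.distrib)
    also have "(\<Prod>b\<in>Basis. cis (2 * pi * ((k \<bullet> b) * (y \<bullet> b)))) = cis (2 * pi * (k \<bullet> y))"
      by (simp add: cis_conv_exp exp_sum[symmetric] euclidean_inner[of k y] sum_distrib_left sum_distrib_right mult_ac)
    moreover have "(\<Prod>b\<in>Basis. indicator {0<..<1} (y \<bullet> b)) = (indicator unit_cell y :: real)"
    proof (cases "y \<in> unit_cell")
      case False
      then obtain i where "\<not> (0 < y $ i \<and> y $ i < 1)" by (auto simp: unit_cell_def)
      then obtain b :: "real^'m" where "b \<in> Basis" "\<not> (0 < y \<bullet> b \<and> y \<bullet> b < 1)"
        by (intro that[of "axis i 1"]) (auto simp: Basis_vec_def inner_axis)
      then have "(\<Prod>b\<in>Basis. indicator {0<..<1} (y \<bullet> b)) = (0::real)"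
        by (intro prod_zero bexI[of _ b]) auto
      with False show ?thesis by simp
    next
      case True
      then have "(\<Prod>b\<in>Basis. indicator {0<..<1} (y \<bullet> b)) = (1::real)"
        unfolding unit_cell_eq_box box_def by (intro prod.neutral) (auto simp: Basis_vec_def inner_axis)
      with True show ?thesis by simp
    qed
    ultimately show ?thesis by (simp add: scaleR_conv_of_real of_real_prod[symmetric])
  qed
  obtain i where i: "k $ i \<noteq> 0" using assms(2) by (auto simp: vec_eq_iff)
  let ?b = "axis i 1 :: real^'m"
  interpret product_sigma_finite "\<lambda>b::real^'m. lborel :: real measure" by standard
  have "(LINT y|lborel. indicator unit_cell y *\<^sub>R cis (2 * pi * (k \<bullet> y))) =
      (LINT y|lborel. (\<Prod>b\<in>Basis. ?f b (y \<bullet> b)))" by (simp only: prod)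
  also have "\<dots> = (LINT x|(\<Pi>\<^sub>M b\<in>Basis. lborel). (\<Prod>b\<in>Basis. ?f b (x b)))"
    by (subst lborel_eq, subst integral_distr) (auto simp: cis_conv_exp intro!: prod.cong Bochner_Integration.integral_cong)
  also have "\<dots> = (\<Prod>b\<in>Basis. LINT t|lborel. ?f b t)"
    by (rule product_integral_prod) (auto intro: int)
  also have "\<dots> = 0"
  proof (rule prod_zero)
    have "k \<bullet> ?b \<in> \<int>" "k \<bullet> ?b \<noteq> 0" using i assms(1) by (auto simp: inner_axis integer_vec_def)
    from integral_cis_period[OF this] show "\<exists>b\<in>Basis. (LINT t|lborel. ?f b t) = 0"
      by (intro bexI[of _ ?b]) (auto simp: Basis_vec_def)
  qed auto
  finally have 0: "(LINT y|lborel. indicator unit_cell y *\<^sub>R cis (2 * pi * (k \<bullet> y))) = 0" .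
  have intc: "integrable lborel (\<lambda>y. indicator unit_cell y *\<^sub>R cis (2 * pi * (k \<bullet> y)))"
    by (rule Bochner_Integration.integrable_bound[OF integrable_real_indicator[of "unit_cell :: (real^'m) set"]])
      (auto simp: cis_conv_exp indicator_def unit_cell_eq_box emeasure_lborel_box_eq)
  have "(LINT y|lborel. indicator unit_cell y * trig k j y) =
     (LINT y|lborel. Re (cis (of_int j * pi / 2) * (indicator unit_cell y *\<^sub>R cis (2 * pi * (k \<bullet> y)))))"
    by (rule Bochner_Integration.integral_cong) (auto simp: trig_def cos_add algebra_simps)
  also have "\<dots> = Re (LINT y|lborel. (cis (of_int j * pi / 2) * (indicator unit_cell y *\<^sub>R cis (2 * pi * (k \<bullet> y)))))"
    by (intro integral_Re integrable_mult_right intc)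
  also have "\<dots> = 0" by (subst integral_mult_right_zero) (simp only: 0, simp)
  finally show ?thesis .
qed

section \<open>The mean value property of oscillating functions\<close>

text \<open>
Translation by half a period flips the sign of the wave, so twice the integral is bounded by the measure of the
symmetric difference of \<open>A\<close> and its translate. That measure tends to \<open>0\<close> by dominated convergence, since \<open>A\<close> is
open: a point of \<open>A\<close> stays in \<open>A\<close> under small translations.
\<close>

lemma Riemann_Lebesgue_open:
  fixes A :: "'a::euclidean_space set"
  assumes "open A" "emeasure lborel A < \<infinity>"
    and \<xi>: "filterlim (\<lambda>n. norm (\<xi> n)) at_top sequentially"
  shows "(\<lambda>n::nat. LINT x|lborel. indicator A x * cos (\<xi> n \<bullet> x + \<theta>)) \<longlonglongrightarrow> 0"
proof -
  have [measurable]: "A \<in> sets borel" using assms(1) by simp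
  \<comment> \<open>A translation by \<open>h\<close> is half a period of the wave and changes its sign.\<close>
  define h where "h n = (pi / (norm (\<xi> n))\<^sup>2) *\<^sub>R \<xi> n" for n
  have norm_h: "norm (h n) = pi / norm (\<xi> n)" for n
    by (simp add: h_def power2_eq_square)
  have "(\<lambda>n. norm (h n)) \<longlonglongrightarrow> 0"
    unfolding norm_h by (rule real_tendsto_divide_at_top[OF tendsto_const \<xi>])
  then have h0: "h \<longlonglongrightarrow> 0" by (rule tendsto_norm_zero_cancel)
  let ?A = "indicator A :: 'a \<Rightarrow> real"
  let ?T = "\<lambda>n x. ?A (h n + x)"
  let ?c = "\<lambda>n x. cos (\<xi> n \<bullet> x + \<theta>)"
  have intA: "integrable lborel ?A" using assms(2) by simp
  have translate: "(LINT x|lborel. f (t + x)) = (LINT x|lborel. f x)"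
    if [measurable]: "f \<in> borel_measurable borel" for f :: "'a \<Rightarrow> real" and t
    by (subst (2) lborel_distr_plus[of t, symmetric], subst integral_distr) auto
  have intT: "integrable lborel (?T n)" for n
    by (rule integrable_distr[where M'=borel and M=lborel and T="(+) (h n)"]) (auto simp: lborel_distr_plus intA)
  have intAT: "integrable lborel (\<lambda>x. ?A x * ?T n x)" for n
    by (rule Bochner_Integration.integrable_bound[OF intA]) (auto simp: indicator_def)
  have intc: "integrable lborel (\<lambda>x. ?A x * ?c n x)" for n
    by (rule Bochner_Integration.integrable_bound[OF intA]) (auto simp: indicator_def)
  have intcT: "integrable lborel (\<lambda>x. ?T n x * ?c n x)" for n
    by (rule Bochner_Integration.integrable_bound[OF intT[of n]]) (auto simp: indicator_def)
  have "eventually (\<lambda>n. norm (\<xi> n) > 0) sequentially"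
    using \<xi> unfolding filterlim_at_top_dense by (rule spec)
  then have bound: "eventually (\<lambda>n. norm (LINT x|lborel. ?A x * ?c n x) \<le>
      (LINT x|lborel. ?A x) - (LINT x|lborel. ?A x * ?T n x)) sequentially"
  proof eventually_elim
    case (elim n)
    then have "\<xi> n \<bullet> h n = pi" by (simp add: h_def power2_norm_eq_inner)
    then have shift: "?c n (h n + x) = - ?c n x" for x
      by (simp add: inner_add_right add.assoc)
    have "(LINT x|lborel. ?A x * ?c n x) = (LINT x|lborel. ?T n x * ?c n (h n + x))"
      by (rule translate[symmetric]) measurable
    also have "\<dots> = - (LINT x|lborel. ?T n x * ?c n x)" by (simp add: shift)
    finally have "2 * (LINT x|lborel. ?A x * ?c n x) = (LINT x|lborel. ?A x * ?c n x - ?T n x * ?c n x)"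
      by (simp add: intc intcT)
    also have "norm \<dots> \<le> (LINT x|lborel. ?A x + ?T n x - 2 * (?A x * ?T n x))"
      by (rule Bochner_Integration.integral_norm_bound_integral)
        (intro Bochner_Integration.integrable_diff intc intcT,
          intro Bochner_Integration.integrable_diff Bochner_Integration.integrable_add intA intT
          intAT integrable_mult_right, auto simp: indicator_def)
    also have "\<dots> = (LINT x|lborel. ?A x) + (LINT x|lborel. ?T n x) - 2 * (LINT x|lborel. ?A x * ?T n x)"
      using intA intT[of n] intAT[of n] by simp
    also have "(LINT x|lborel. ?T n x) = (LINT x|lborel. ?A x)" by (rule translate) measurable
    finally show ?case by simp
  qed
  have "(\<lambda>n. LINT x|lborel. ?A x * ?T n x) \<longlonglongrightarrow> (LINT x|lborel. ?A x)"
  proof (rule integral_dominated_convergence[where w="?A"])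
    show "AE x in lborel. (\<lambda>n. ?A x * ?T n x) \<longlonglongrightarrow> ?A x"
    proof (intro AE_I2)
      fix x
      show "(\<lambda>n. ?A x * ?T n x) \<longlonglongrightarrow> ?A x"
      proof (cases "x \<in> A")
        case True
        have "(\<lambda>n. h n + x) \<longlonglongrightarrow> 0 + x" by (intro tendsto_intros h0)
        then have "eventually (\<lambda>n. h n + x \<in> A) sequentially"
          using assms(1) True by (auto dest: topological_tendstoD)
        then have "eventually (\<lambda>n. ?A x * ?T n x = ?A x) sequentially"
          by eventually_elim (use True in simp)
        then show ?thesis by (rule tendsto_eventually)
      qed simp
    qed
  qed (auto simp: indicator_def intA)
  from tendsto_diff[OF tendsto_const[of "LINT x|lborel. ?A x"] this]
  have "(\<lambda>n. (LINT x|lborel. ?A x) - (LINT x|lborel. ?A x * ?T n x)) \<longlonglongrightarrow> 0" by simp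
  from Lim_null_comparison[OF bound this] show ?thesis .
qed

inductive_set tensor_poly :: "(real^'n) set set \<Rightarrow> ((real^'n) \<times> (real^'m) \<Rightarrow> real) set" for \<B> where
  tensor: "B \<in> \<B> \<Longrightarrow> integer_vec k \<Longrightarrow> (\<lambda>z. indicator B (fst z) * trig k j (snd z)) \<in> tensor_poly \<B>"
| add: "f \<in> tensor_poly \<B> \<Longrightarrow> g \<in> tensor_poly \<B> \<Longrightarrow> (\<lambda>z. f z + g z) \<in> tensor_poly \<B>"
| scale: "f \<in> tensor_poly \<B> \<Longrightarrow> (\<lambda>z. c * f z) \<in> tensor_poly \<B>"

text \<open>
Closure under products is what allows the mean value property to be applied to squares.
\<close>

lemma tensor_poly_mult:
  fixes f g :: "(real^'n) \<times> (real^'m) \<Rightarrow> real"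
  assumes \<B>: "\<And>A B. A \<in> \<B> \<Longrightarrow> B \<in> \<B> \<Longrightarrow> A \<inter> B \<in> \<B>"
    and "f \<in> tensor_poly \<B>" "g \<in> tensor_poly \<B>"
  shows "(\<lambda>z. f z * g z) \<in> tensor_poly \<B>"
  using assms(2)
proof induction
  case (tensor B k j)
  from assms(3) show ?case
  proof induction
    case (tensor B' k' j')
    have "(\<lambda>z. (indicator B (fst z) * trig k j (snd z)) * (indicator B' (fst z) * trig k' j' (snd z))) =
      (\<lambda>z::(real^'n) \<times> (real^'m). (1/2) * (indicator (B \<inter> B') (fst z) * trig (k - k') (j - j') (snd z)) +
          (1/2) * (indicator (B \<inter> B') (fst z) * trig (k + k') (j + j') (snd z)))"
    proof
      fix z :: "(real^'n) \<times> (real^'m)"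
      have "(indicator B (fst z) * trig k j (snd z)) * (indicator B' (fst z) * trig k' j' (snd z)) =
         indicator (B \<inter> B') (fst z) * (trig k j (snd z) * trig k' j' (snd z))"
        by (simp add: indicator_inter_arith mult_ac)
      then show "(indicator B (fst z) * trig k j (snd z)) * (indicator B' (fst z) * trig k' j' (snd z)) =
        (1/2) * (indicator (B \<inter> B') (fst z) * trig (k - k') (j - j') (snd z)) +
          (1/2) * (indicator (B \<inter> B') (fst z) * trig (k + k') (j + j') (snd z))"
        unfolding trig_mult by (simp add: algebra_simps)
    qed
    moreover have "B \<inter> B' \<in> \<B>" "integer_vec (k - k')" "integer_vec (k + k')"
      using \<open>B \<in> \<B>\<close> \<open>integer_vec k\<close> \<open>B' \<in> \<B>\<close> \<open>integer_vec k'\<close> by (auto intro: \<B>)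
    ultimately show ?case by (simp only:) (intro tensor_poly.intros)
  next
    case (add f g)
    from tensor_poly.add[OF add(3,4)] show ?case by (simp only: distrib_left)
  next
    case (scale f c)
    from tensor_poly.scale[OF scale(2), of c] show ?case by (simp add: mult_ac)
  qed
next
  case (add f' g')
  from tensor_poly.add[OF add(3,4)] show ?case by (simp only: distrib_right)
next
  case (scale f c)
  from tensor_poly.scale[OF scale(2), of c] show ?case by (simp add: mult_ac)
qed

lemma tensor_poly_measurable:
  assumes "f \<in> tensor_poly \<B>" "\<And>B. B \<in> \<B> \<Longrightarrow> B \<in> sets borel"
  shows "f \<in> borel_measurable borel"
  using assms(1)
proof induction
  case (tensor B k j)
  have [measurable]: "B \<in> sets borel" by (rule assms(2)[OF tensor(1)])
  have [measurable]: "trig k j \<in> borel_measurable borel"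
    by (intro borel_measurable_continuous_onI continuous_trig continuous_on_id)
  show ?case unfolding borel_prod[symmetric] by measurable
qed auto

lemma tensor_poly_bounded:
  assumes "f \<in> tensor_poly \<B>"
  shows "\<exists>K. \<forall>z. \<bar>f z\<bar> \<le> K"
  using assms
proof induction
  case (tensor B k j)
  then show ?case by (intro exI[of _ 1]) (auto simp: indicator_def abs_trig_le)
next
  case (add f g)
  then obtain K L where "\<forall>z. \<bar>f z\<bar> \<le> K" "\<forall>z. \<bar>g z\<bar> \<le> L" by blast
  then show ?case by (intro exI[of _ "K + L"]) (meson abs_triangle_ineq add_mono order_trans)
next
  case (scale f c)
  then obtain K where "\<forall>z. \<bar>f z\<bar> \<le> K" by blast
  then show ?case by (intro exI[of _ "\<bar>c\<bar> * K"]) (auto simp: abs_mult intro!: mult_left_mono)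
qed

lemma tensor_poly_sq_int:
  assumes f: "f \<in> tensor_poly \<B>" and \<B>: "\<And>B. B \<in> \<B> \<Longrightarrow> B \<in> sets borel"
    and T: "T \<in> sets lebesgue" "emeasure lebesgue T < \<infinity>" and h: "h \<in> borel \<rightarrow>\<^sub>M borel"
  shows "sq_int (lebesgue_on T) (\<lambda>x. f (h x))"
proof -
  obtain K where K: "\<And>z. \<bar>f z\<bar> \<le> K" using tensor_poly_bounded[OF f] by blast
  show ?thesis
    by (rule sq_int_bounded_on[OF T borel_measurable_lebesgue_on K])
      (rule measurable_compose[OF h tensor_poly_measurable[OF f \<B>]])
qed

locale oscillation =
  fixes R :: "real^'n^'m" and \<eta> :: "nat \<Rightarrow> real"
  assumes nonresonant: "\<And>k :: real^'m. integer_vec k \<Longrightarrow> k \<noteq> 0 \<Longrightarrow> transpose R *v k \<noteq> 0"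
    and eta_pos: "\<And>n. \<eta> n > 0" and eta_lim: "\<eta> \<longlonglongrightarrow> 0"

begin

definition fast :: "nat \<Rightarrow> real^'n \<Rightarrow> real^'m" where
  "fast n x = (1 / \<eta> n) *\<^sub>R (R *v x)"

lemma continuous_fast: "continuous_on A (fast n)"
  unfolding fast_def by (intro continuous_intros matrix_vector_mult_linear_continuous_on)

lemma fast_measurable [measurable]: "fast n \<in> borel_measurable borel"
  by (rule borel_measurable_continuous_onI) (rule continuous_fast)

lemma fast_pair_measurable: "(\<lambda>x. (x, fast n x)) \<in> borel \<rightarrow>\<^sub>M borel"
  unfolding borel_prod[symmetric] by measurable

text \<open>
Only the zero frequency survives; for \<open>k \<noteq> 0\<close> nonresonance makes the frequency \<open>2 \<pi> R\<^sup>T k / \<eta>\<close> diverge.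
\<close>

lemma mean_value_trig:
  fixes A :: "(real^'n) set"
  assumes "open A" "emeasure lborel A < \<infinity>" and k: "integer_vec k"
  shows "(\<lambda>n. LINT x|lborel. indicator A x * trig k j (fast n x)) \<longlonglongrightarrow>
    measure lborel A * (LINT y|lborel. indicator unit_cell y * trig k j y)"
proof (cases "k = 0")
  case True
  have A: "A \<in> sets borel" using assms(1) by simp
  have "trig k j y = trig k j 0" for y using True by (simp add: trig_def)
  then have eq: "trig k j = (\<lambda>_. trig k j 0)" by auto
  show ?thesis by (subst (1 2) eq) (simp add: A measure_def)
next
  case False
  define \<xi> where "\<xi> n = (2 * pi / \<eta> n) *\<^sub>R (transpose R *v k)" for n
  have "k \<bullet> (R *v x) = (transpose R *v k) \<bullet> x" for x
    by (simp add: transpose_matrix_vector dot_lmul_matrix)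
  then have *: "trig k j (fast n x) = cos (\<xi> n \<bullet> x + of_int j * pi / 2)" for n x
    by (simp add: trig_def fast_def \<xi>_def mult_ac)
  have lim: "filterlim (\<lambda>n. norm (\<xi> n)) at_top sequentially"
  proof -
    have "LIM n sequentially. (2 * pi * norm (transpose R *v k)) / \<eta> n :> at_top"
    proof (rule LIM_at_top_divide)
      show "0 < 2 * pi * norm (transpose R *v k)" using nonresonant[OF k False] by simp
    qed (auto simp: eta_pos eta_lim)
    moreover have "norm (\<xi> n) = (2 * pi * norm (transpose R *v k)) / \<eta> n" for n
      using eta_pos[of n] by (simp add: \<xi>_def)
    ultimately show ?thesis by simp
  qed
  show ?thesis unfolding * integral_trig_cell[OF k False]
    using Riemann_Lebesgue_open[OF assms(1,2) lim] by simp
qed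

theorem mean_value_tensor_poly:
  assumes S: "open S" "bounded S" and \<B>: "\<And>B. B \<in> \<B> \<Longrightarrow> open B"
    and f: "f \<in> tensor_poly \<B>"
  shows "(\<lambda>n. LINT x|lebesgue_on S. f (x, fast n x)) \<longlonglongrightarrow> (LINT z|lebesgue_on (S \<times> unit_cell). f z)"
proof -
  let ?U = "unit_cell :: (real^'m) set"
  note Sm = open_bounded_lebesgue[OF S]
  have SU: "S \<times> ?U \<in> sets lebesgue" "emeasure lebesgue (S \<times> ?U) < \<infinity>"
    using sets_lebesgue_Times_borel[OF Sm(2) borel_unit_cell] Sm(3)
    by (auto simp: emeasure_lebesgue_Times_cell[OF Sm(2)])
  have Bb: "B \<in> sets borel" if "B \<in> \<B>" for B using \<B>[OF that] by simp
  have int1: "integrable (lebesgue_on S) (\<lambda>x. f (x, fast n x))" if "f \<in> tensor_poly \<B>" for f n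
    by (rule sq_int_integrable[OF Sm(2,3) tensor_poly_sq_int[OF that Bb Sm(2,3) fast_pair_measurable]])
  have int2: "integrable (lebesgue_on (S \<times> ?U)) f" if "f \<in> tensor_poly \<B>" for f
    by (rule sq_int_integrable[OF SU tensor_poly_sq_int[OF that Bb SU measurable_ident[unfolded id_def]]])
  show ?thesis using f
  proof induction
    case (tensor B k j)
    let ?f = "\<lambda>z::(real^'n) \<times> (real^'m). indicator B (fst z) * trig k j (snd z) :: real"
    have f: "?f \<in> tensor_poly \<B>" by (rule tensor_poly.tensor[OF tensor])
    note fm = tensor_poly_measurable[OF f Bb]
    have SB: "open (S \<inter> B)" using S \<B>[OF tensor(1)] by auto
    have SBb: "S \<inter> B \<in> sets borel" using SB by simp
    have "emeasure lborel (S \<inter> B) < \<infinity>"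
      using emeasure_bounded_finite[OF bounded_subset[OF S(2)], of "S \<inter> B"] by simp
    from mean_value_trig[OF SB this tensor(2), of j]
    have lim: "(\<lambda>n. LINT x|lborel. indicator (S \<inter> B) x * trig k j (fast n x)) \<longlonglongrightarrow>
        measure lborel (S \<inter> B) * (LINT y|lborel. indicator ?U y * trig k j y)" .
    have "(LINT x|lebesgue_on S. ?f (x, fast n x)) = (LINT x|lborel. indicator S x * ?f (x, fast n x))" for n
      by (rule LINT_lebesgue_on_borel[OF Sm(1) measurable_compose[OF fast_pair_measurable fm]])
    also have "(\<lambda>x. indicator S x * ?f (x, fast n x)) = (\<lambda>x. indicator (S \<inter> B) x * trig k j (fast n x))" for n
      by (simp add: fun_eq_iff indicator_def)
    finally have "(LINT x|lebesgue_on S. ?f (x, fast n x)) =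
        (LINT x|lborel. indicator (S \<inter> B) x * trig k j (fast n x))" for n .
    moreover have "(LINT z|lebesgue_on (S \<times> ?U). ?f z) =
        measure lborel (S \<inter> B) * (LINT y|lborel. indicator ?U y * trig k j y)"
    proof -
      have tm: "trig k j \<in> borel_measurable borel"
        by (intro borel_measurable_continuous_onI continuous_trig continuous_on_id)
      have "(LINT z|lebesgue_on (S \<times> ?U). ?f z) = (LINT x|lebesgue_on S. LINT y|lebesgue_on ?U. ?f (x, y))"
        by (rule Fubini_cell(1)[OF Sm(1) fm int2[OF f]])
      also have "\<dots> = (LINT x|lebesgue_on S. indicator B x * (LINT y|lebesgue_on ?U. trig k j y))"
        by (simp only: fst_conv snd_conv integral_mult_right_zero)
      also have "\<dots> = (LINT x|lborel. indicator (S \<inter> B) x * (LINT y|lebesgue_on ?U. trig k j y))"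
        using Bb[OF tensor(1)]
        by (subst LINT_lebesgue_on_borel[OF Sm(1)]) (auto simp: indicator_inter_arith mult.assoc)
      also have "\<dots> = measure lborel (S \<inter> B) * (LINT y|lborel. indicator ?U y * trig k j y)"
        using SBb by (simp add: LINT_lebesgue_on_borel[OF borel_unit_cell tm])
      finally show ?thesis .
    qed
    ultimately show ?case using lim by (simp only:)
  next
    case (add f g)
    then show ?case by (simp add: int1 int2 tendsto_add)
  next
    case (scale f c)
    from tendsto_mult_left[OF scale(2), of c] show ?case by simp
  qed
qed

end

section \<open>Square-integrable maps into the continuous periodic functions\<close>

text \<open>
The measurability part of membership in \<open>L\<^sup>2(S, C\<^sub>p\<^sub>e\<^sub>r)\<close>, split off so that linearity and norms can be handled before
integrability.
\<close>

definition strongly_measurable_on :: "(real^'n) set \<Rightarrow> (real^'n \<Rightarrow> ((real^'m) \<Rightarrow>\<^sub>C real)) \<Rightarrow> bool" where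
  "strongly_measurable_on S \<Phi> \<longleftrightarrow> (\<forall>x\<in>S. \<Phi> x \<in> C_per) \<and>
     (\<exists>s :: nat \<Rightarrow> real^'n \<Rightarrow> ((real^'m) \<Rightarrow>\<^sub>C real).
        (\<forall>j. simple_function (lebesgue_on S) (s j) \<and> (\<forall>x\<in>S. s j x \<in> C_per)) \<and>
        (AE x in lebesgue_on S. (\<lambda>j. s j x) \<longlonglongrightarrow> \<Phi> x))"

lemma strongly_measurable_onE:
  assumes "strongly_measurable_on S \<Phi>"
  obtains s where "\<And>j. simple_function (lebesgue_on S) (s j)" "\<And>j x. x \<in> S \<Longrightarrow> s j x \<in> C_per"
      "AE x in lebesgue_on S. (\<lambda>j. s j x) \<longlonglongrightarrow> \<Phi> x"
  using assms unfolding strongly_measurable_on_def by (elim conjE exE) (rule that, auto)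

lemma L2_C_per_iff:
  "\<Phi> \<in> L2_C_per S \<longleftrightarrow> strongly_measurable_on S \<Phi> \<and> integrable (lebesgue_on S) (\<lambda>x. (norm (\<Phi> x))\<^sup>2)"
  by (auto simp: L2_C_per_def strongly_measurable_on_def)

lemma C_per_simps [simp]:
  "0 \<in> C_per" "f \<in> C_per \<Longrightarrow> g \<in> C_per \<Longrightarrow> f + g \<in> C_per"
  "f \<in> C_per \<Longrightarrow> c *\<^sub>R f \<in> C_per"
  "f \<in> C_per \<Longrightarrow> g \<in> C_per \<Longrightarrow> f - g \<in> C_per"
  by (auto simp: C_per_def periodic_def)

lemma strongly_measurable_on_linear:
  assumes "strongly_measurable_on S \<Phi>" "strongly_measurable_on S \<Psi>"
  shows "strongly_measurable_on S (\<lambda>x. a *\<^sub>R \<Phi> x + b *\<^sub>R \<Psi> x)"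
proof -
  from assms(1) obtain s where s: "\<And>j. simple_function (lebesgue_on S) (s j)" "\<And>j x. x \<in> S \<Longrightarrow> s j x \<in> C_per"
      "AE x in lebesgue_on S. (\<lambda>j. s j x) \<longlonglongrightarrow> \<Phi> x" by (rule strongly_measurable_onE) (rule that, auto)
  from assms(2) obtain t where t: "\<And>j. simple_function (lebesgue_on S) (t j)" "\<And>j x. x \<in> S \<Longrightarrow> t j x \<in> C_per"
      "AE x in lebesgue_on S. (\<lambda>j. t j x) \<longlonglongrightarrow> \<Psi> x" by (rule strongly_measurable_onE) (rule that, auto)
  have "AE x in lebesgue_on S. (\<lambda>j. a *\<^sub>R s j x + b *\<^sub>R t j x) \<longlonglongrightarrow> a *\<^sub>R \<Phi> x + b *\<^sub>R \<Psi> x"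
    using s(3) t(3) by eventually_elim (intro tendsto_intros)
  moreover have "simple_function (lebesgue_on S) (\<lambda>x. a *\<^sub>R s j x + b *\<^sub>R t j x)" for j
    by (rule simple_function_compose2[OF s(1) t(1)])
  ultimately show ?thesis using assms s(2) t(2) unfolding strongly_measurable_on_def
    by (intro conjI exI[of _ "\<lambda>j x. a *\<^sub>R s j x + b *\<^sub>R t j x"]) auto
qed

lemma strongly_measurable_on_tensor:
  assumes "f \<in> borel_measurable (lebesgue_on S)" "g \<in> C_per"
  shows "strongly_measurable_on S (\<lambda>x. f x *\<^sub>R g)"
proof -
  obtain s where s: "\<And>j. simple_function (lebesgue_on S) (s j)" "\<And>x. x \<in> S \<Longrightarrow> (\<lambda>j. s j x) \<longlonglongrightarrow> f x"
    using borel_measurable_implies_sequence_metric[OF assms(1), of 0] by auto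
  have "AE x in lebesgue_on S. (\<lambda>j. s j x *\<^sub>R g) \<longlonglongrightarrow> f x *\<^sub>R g"
    by (rule AE_I2) (auto intro!: tendsto_intros s(2))
  moreover have "simple_function (lebesgue_on S) (\<lambda>x. s j x *\<^sub>R g)" for j
    by (rule simple_function_compose1[OF s(1)])
  ultimately show ?thesis using assms(2) unfolding strongly_measurable_on_def
    by (intro conjI exI[of _ "\<lambda>j x. s j x *\<^sub>R g"]) auto
qed

lemma strongly_measurable_on_norm:
  assumes S: "S \<in> sets lebesgue" and "strongly_measurable_on S \<Phi>"
  shows "(\<lambda>x. norm (\<Phi> x)) \<in> borel_measurable (lebesgue_on S)"
proof -
  from assms(2) obtain s where "\<And>j. simple_function (lebesgue_on S) (s j)" "\<And>j x. x \<in> S \<Longrightarrow> s j x \<in> C_per"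
      "AE x in lebesgue_on S. (\<lambda>j. s j x) \<longlonglongrightarrow> \<Phi> x" by (rule strongly_measurable_onE) (rule that, auto)
  note s = this(1,3)
  show ?thesis
  proof (rule borel_measurable_lebesgue_on_AE_LIMSEQ[OF S])
    show "(\<lambda>x. norm (s j x)) \<in> borel_measurable (lebesgue_on S)" for j
      by (rule borel_measurable_simple_function, rule simple_function_compose1[OF s(1)])
    show "AE x in lebesgue_on S. (\<lambda>j. norm (s j x)) \<longlonglongrightarrow> norm (\<Phi> x)"
      using s(2) by eventually_elim (intro tendsto_intros)
  qed
qed

lemma L2_C_per_norm_sq_int:
  assumes S: "S \<in> sets lebesgue" and "\<Phi> \<in> L2_C_per S"
  shows "sq_int (lebesgue_on S) (\<lambda>x. norm (\<Phi> x))"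
  using assms strongly_measurable_on_norm[OF S] by (auto simp: sq_int_def L2_C_per_iff)

lemma L2_C_per_linear:
  assumes S: "S \<in> sets lebesgue" and \<Phi>: "\<Phi> \<in> L2_C_per S" "\<Psi> \<in> L2_C_per S"
  shows "(\<lambda>x. a *\<^sub>R \<Phi> x + b *\<^sub>R \<Psi> x) \<in> L2_C_per S"
proof -
  have sm: "strongly_measurable_on S (\<lambda>x. a *\<^sub>R \<Phi> x + b *\<^sub>R \<Psi> x)"
    using \<Phi> by (intro strongly_measurable_on_linear) (auto simp: L2_C_per_iff)
  have "sq_int (lebesgue_on S) (\<lambda>x. \<bar>a\<bar> * norm (\<Phi> x) + \<bar>b\<bar> * norm (\<Psi> x))"
    by (intro sq_int_add sq_int_scale L2_C_per_norm_sq_int S \<Phi>)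
  then have "integrable (lebesgue_on S) (\<lambda>x. (\<bar>a\<bar> * norm (\<Phi> x) + \<bar>b\<bar> * norm (\<Psi> x))\<^sup>2)"
    by (simp add: sq_int_def)
  then have "integrable (lebesgue_on S) (\<lambda>x. (norm (a *\<^sub>R \<Phi> x + b *\<^sub>R \<Psi> x))\<^sup>2)"
  proof (rule Bochner_Integration.integrable_bound)
    show "(\<lambda>x. (norm (a *\<^sub>R \<Phi> x + b *\<^sub>R \<Psi> x))\<^sup>2) \<in> borel_measurable (lebesgue_on S)"
      using strongly_measurable_on_norm[OF S sm] by measurable
    have "norm (a *\<^sub>R \<Phi> x + b *\<^sub>R \<Psi> x) \<le> \<bar>a\<bar> * norm (\<Phi> x) + \<bar>b\<bar> * norm (\<Psi> x)" for x
      by (rule order_trans[OF norm_triangle_ineq]) simp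
    then show "AE x in lebesgue_on S. norm ((norm (a *\<^sub>R \<Phi> x + b *\<^sub>R \<Psi> x))\<^sup>2)
        \<le> norm ((\<bar>a\<bar> * norm (\<Phi> x) + \<bar>b\<bar> * norm (\<Psi> x))\<^sup>2)"
      by (intro AE_I2) (auto intro!: power_mono)
  qed
  with sm show ?thesis by (simp add: L2_C_per_iff)
qed

lemma L2_C_per_diff:
  assumes "S \<in> sets lebesgue" "\<Phi> \<in> L2_C_per S" "\<Psi> \<in> L2_C_per S"
  shows "(\<lambda>x. \<Phi> x - \<Psi> x) \<in> L2_C_per S"
  using L2_C_per_linear[OF assms, of 1 "-1"] by simp

lemma L2_C_per_tensor:
  assumes "sq_int (lebesgue_on S) f" "g \<in> C_per"
  shows "(\<lambda>x. f x *\<^sub>R g) \<in> L2_C_per S"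
  using assms strongly_measurable_on_tensor[of f S g]
  by (auto simp: L2_C_per_iff sq_int_def power_mult_distrib)

definition L2C_norm :: "(real^'n) set \<Rightarrow> (real^'n \<Rightarrow> ((real^'m) \<Rightarrow>\<^sub>C real)) \<Rightarrow> real" where
  "L2C_norm S \<Phi> = sqrt (LINT x|lebesgue_on S. (norm (\<Phi> x))\<^sup>2)"

text \<open>
With \<open>p\<close> the identity this concerns \<open>\<Phi>(x)(R x / \<eta>)\<close> on \<open>S\<close>; with \<open>p\<close> the first projection it concerns
\<open>\<Phi>(x)(y)\<close> on \<open>S \<times> Y\<close>. In both cases the value is dominated by the supremum norm of \<open>\<Phi>(p z)\<close>, and \<open>p\<close> preserves
measure.
\<close>

lemma L2_C_per_evaluation:
  fixes p :: "'a::euclidean_space \<Rightarrow> real^'n" and q :: "'a \<Rightarrow> real^'m"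
  assumes S: "S \<in> sets lebesgue" and T: "T \<in> sets lebesgue"
    and p[measurable]: "p \<in> lebesgue_on T \<rightarrow>\<^sub>M lebesgue_on S"
    and distr: "distr (lebesgue_on T) (lebesgue_on S) p = lebesgue_on S"
    and q[measurable]: "q \<in> borel_measurable (lebesgue_on T)"
    and \<Phi>: "\<Phi> \<in> L2_C_per S"
  shows "sq_int (lebesgue_on T) (\<lambda>z. apply_bcontfun (\<Phi> (p z)) (q z))" (is "sq_int _ ?f")
    and "sqrt (LINT z|lebesgue_on T. (apply_bcontfun (\<Phi> (p z)) (q z))\<^sup>2) \<le> L2C_norm S \<Phi>"
proof -
  from \<Phi> have "strongly_measurable_on S \<Phi>" by (simp add: L2_C_per_iff)
  then obtain s where "\<And>j. simple_function (lebesgue_on S) (s j)" "\<And>j x. x \<in> S \<Longrightarrow> s j x \<in> C_per"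
      "AE x in lebesgue_on S. (\<lambda>j. s j x) \<longlonglongrightarrow> \<Phi> x" by (rule strongly_measurable_onE) (rule that, auto)
  note s = this(1,3)
  have meas[measurable]: "?f \<in> borel_measurable (lebesgue_on T)"
  proof (rule borel_measurable_lebesgue_on_AE_LIMSEQ[OF T])
    show "(\<lambda>z. apply_bcontfun (s j (p z)) (q z)) \<in> borel_measurable (lebesgue_on T)" for j
    proof (rule measurable_compose_countable'[where g="\<lambda>z. s j (p z)" and I="s j ` S" and f="\<lambda>c z. apply_bcontfun c (q z)"])
      show "(\<lambda>z. apply_bcontfun c (q z)) \<in> borel_measurable (lebesgue_on T)" for c :: "(real^'m) \<Rightarrow>\<^sub>C real"
      proof -
        have "apply_bcontfun c \<in> borel_measurable borel"
          by (rule borel_measurable_continuous_onI) simp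
        then show ?thesis by measurable
      qed
      show "countable (s j ` S)" using simple_functionD(1)[OF s(1)[of j]] by (auto intro: countable_finite)
      have "s j \<in> lebesgue_on S \<rightarrow>\<^sub>M count_space UNIV" by (rule measurable_simple_function[OF s(1)])
      then have "s j \<in> lebesgue_on S \<rightarrow>\<^sub>M count_space (s j ` S)"
        by (auto simp: measurable_def)
      then show "(\<lambda>z. s j (p z)) \<in> lebesgue_on T \<rightarrow>\<^sub>M count_space (s j ` S)" by measurable
    qed
    have "AE z in lebesgue_on T. (\<lambda>j. s j (p z)) \<longlonglongrightarrow> \<Phi> (p z)"
      by (rule AE_distrD[OF p], unfold distr) (rule s(2))
    then show "AE z in lebesgue_on T. (\<lambda>j. apply_bcontfun (s j (p z)) (q z)) \<longlonglongrightarrow> ?f z"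
    proof eventually_elim
      case (elim z)
      show ?case
      proof (rule tendsto_dist_iff[THEN iffD2], rule Lim_null_comparison)
        show "eventually (\<lambda>j. norm (dist (apply_bcontfun (s j (p z)) (q z)) (?f z)) \<le> dist (s j (p z)) (\<Phi> (p z))) sequentially"
          by (auto simp: dist_bounded)
        show "(\<lambda>j. dist (s j (p z)) (\<Phi> (p z))) \<longlonglongrightarrow> 0" using elim by (simp add: tendsto_dist_iff[symmetric])
      qed
    qed
  qed
  have int: "integrable (lebesgue_on S) (\<lambda>x. (norm (\<Phi> x))\<^sup>2)" using \<Phi> by (simp add: L2_C_per_iff)
  then have "integrable (distr (lebesgue_on T) (lebesgue_on S) p) (\<lambda>x. (norm (\<Phi> x))\<^sup>2)" by (simp add: distr)
  then have int2: "integrable (lebesgue_on T) (\<lambda>z. (norm (\<Phi> (p z)))\<^sup>2)" by (rule integrable_distr[OF p])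
  have le: "(?f z)\<^sup>2 \<le> (norm (\<Phi> (p z)))\<^sup>2" for z
    using norm_bounded[of "\<Phi> (p z)" "q z"] by (metis abs_le_square_iff abs_norm_cancel real_norm_def)
  show sq: "sq_int (lebesgue_on T) ?f" unfolding sq_int_def
    using meas by (intro conjI Bochner_Integration.integrable_bound[OF int2]) (auto simp: le)
  have "(LINT z|lebesgue_on T. (?f z)\<^sup>2) \<le> (LINT z|lebesgue_on T. (norm (\<Phi> (p z)))\<^sup>2)"
    using sq int2 le by (intro integral_mono) (auto simp: sq_int_def)
  also have "\<dots> = (LINT x|distr (lebesgue_on T) (lebesgue_on S) p. (norm (\<Phi> x))\<^sup>2)"
    using int by (intro integral_distr[symmetric, OF p]) auto
  finally show "sqrt (LINT z|lebesgue_on T. (?f z)\<^sup>2) \<le> L2C_norm S \<Phi>"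
    unfolding L2C_norm_def distr by (rule real_sqrt_le_mono)
qed

text \<open>
Pairing with a fixed \<open>L\<^sup>2\<close> function is a bounded linear functional, with a bound that does not see how fast the
argument \<open>q\<close> oscillates.
\<close>

lemma L2_C_per_pairing:
  fixes p :: "'a::euclidean_space \<Rightarrow> real^'n" and q :: "'a \<Rightarrow> real^'m"
  assumes ST: "S \<in> sets lebesgue" "T \<in> sets lebesgue" "p \<in> lebesgue_on T \<rightarrow>\<^sub>M lebesgue_on S"
      "distr (lebesgue_on T) (lebesgue_on S) p = lebesgue_on S" "q \<in> borel_measurable (lebesgue_on T)"
    and v: "sq_int (lebesgue_on T) v" and \<Phi>: "\<Phi> \<in> L2_C_per S"
  shows "\<Psi> \<in> L2_C_per S \<Longrightarrow> (LINT z|lebesgue_on T. v z * apply_bcontfun (a *\<^sub>R \<Phi> (p z) + b *\<^sub>R \<Psi> (p z)) (q z)) =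
      a * (LINT z|lebesgue_on T. v z * apply_bcontfun (\<Phi> (p z)) (q z)) +
      b * (LINT z|lebesgue_on T. v z * apply_bcontfun (\<Psi> (p z)) (q z))"
    and "\<bar>LINT z|lebesgue_on T. v z * apply_bcontfun (\<Phi> (p z)) (q z)\<bar> \<le>
      sqrt (LINT z|lebesgue_on T. (v z)\<^sup>2) * L2C_norm S \<Phi>"
proof -
  note ev = L2_C_per_evaluation[OF ST]
  show "\<bar>LINT z|lebesgue_on T. v z * apply_bcontfun (\<Phi> (p z)) (q z)\<bar> \<le>
      sqrt (LINT z|lebesgue_on T. (v z)\<^sup>2) * L2C_norm S \<Phi>"
    by (rule order_trans[OF Cauchy_Schwarz_sq_int[OF v ev(1)[OF \<Phi>]]])
      (intro mult_left_mono ev(2)[OF \<Phi>], simp)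
  assume \<Psi>: "\<Psi> \<in> L2_C_per S"
  have "(LINT z|lebesgue_on T. v z * apply_bcontfun (a *\<^sub>R \<Phi> (p z) + b *\<^sub>R \<Psi> (p z)) (q z)) =
      (LINT z|lebesgue_on T. a * (v z * apply_bcontfun (\<Phi> (p z)) (q z)) + b * (v z * apply_bcontfun (\<Psi> (p z)) (q z)))"
    by (rule Bochner_Integration.integral_cong) (auto simp: algebra_simps)
  then show "(LINT z|lebesgue_on T. v z * apply_bcontfun (a *\<^sub>R \<Phi> (p z) + b *\<^sub>R \<Psi> (p z)) (q z)) =
      a * (LINT z|lebesgue_on T. v z * apply_bcontfun (\<Phi> (p z)) (q z)) +
      b * (LINT z|lebesgue_on T. v z * apply_bcontfun (\<Psi> (p z)) (q z))"
    using sq_int_mult[OF v ev(1)[OF \<Phi>]] sq_int_mult[OF v ev(1)[OF \<Psi>]] by simp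
qed

lemma L2_C_per_simple_approx:
  fixes \<Phi> :: "real^'n \<Rightarrow> ((real^'m) \<Rightarrow>\<^sub>C real)"
  assumes S: "S \<in> sets lebesgue" and \<Phi>: "\<Phi> \<in> L2_C_per S" and "e > 0"
  obtains s where "simple_function (lebesgue_on S) s" "\<And>x. x \<in> S \<Longrightarrow> s x \<in> C_per"
    "s \<in> L2_C_per S" "L2C_norm S (\<lambda>x. \<Phi> x - s x) < e"
proof -
  from \<Phi> have "strongly_measurable_on S \<Phi>" by (simp add: L2_C_per_iff)
  then obtain s where s: "\<And>j. simple_function (lebesgue_on S) (s j)" "\<And>j x. x \<in> S \<Longrightarrow> s j x \<in> C_per"
      "AE x in lebesgue_on S. (\<lambda>j. s j x) \<longlonglongrightarrow> \<Phi> x" by (rule strongly_measurable_onE) (rule that, auto)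
  note nm[measurable] = strongly_measurable_on_norm[OF S]
  have sm\<Phi>: "strongly_measurable_on S \<Phi>" using \<Phi> by (simp add: L2_C_per_iff)
  \<comment> \<open>Truncation where \<open>s j\<close> exceeds \<open>2 \<parallel>\<Phi>\<parallel>\<close> keeps the functions simple and supplies an integrable majorant.\<close>
  define t where "t j x = (if norm (s j x) \<le> 2 * norm (\<Phi> x) then s j x else 0)" for j x
  have tn: "norm (t j x) \<le> 2 * norm (\<Phi> x)" for j x by (simp add: t_def)
  have t_simple: "simple_function (lebesgue_on S) (t j)" for j
  proof -
    have [measurable]: "(\<lambda>x. norm (s j x)) \<in> borel_measurable (lebesgue_on S)" "(\<lambda>x. norm (\<Phi> x)) \<in> borel_measurable (lebesgue_on S)"
      using nm[OF sm\<Phi>] by (auto intro!: borel_measurable_simple_function simple_function_compose1[OF s(1)])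
    have "{x \<in> space (lebesgue_on S). norm (s j x) \<le> 2 * norm (\<Phi> x)} \<in> sets (lebesgue_on S)" by measurable
    from simple_function_If_set[OF s(1)[of j] simple_function_const[of _ 0] , of "{x \<in> space (lebesgue_on S). norm (s j x) \<le> 2 * norm (\<Phi> x)}"] this
    have "simple_function (lebesgue_on S) (\<lambda>x. if x \<in> {x \<in> space (lebesgue_on S). norm (s j x) \<le> 2 * norm (\<Phi> x)} then s j x else 0)"
      by (auto simp: Int_absorb2 subset_eq)
    then show ?thesis by (rule simple_function_cong[THEN iffD1, rotated]) (auto simp: t_def)
  qed
  have t_per: "t j x \<in> C_per" if "x \<in> S" for j x using s(2)[OF that] by (simp add: t_def)
  have t_sm: "strongly_measurable_on S (t j)" for j
    unfolding strongly_measurable_on_def using t_simple t_per by (intro conjI exI[of _ "\<lambda>_. t j"]) auto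
  have int: "integrable (lebesgue_on S) (\<lambda>x. (norm (\<Phi> x))\<^sup>2)" using \<Phi> by (simp add: L2_C_per_iff)
  have t_L2: "t j \<in> L2_C_per S" for j
  proof -
    have "integrable (lebesgue_on S) (\<lambda>x. (norm (t j x))\<^sup>2)"
    proof (rule Bochner_Integration.integrable_bound)
      show "integrable (lebesgue_on S) (\<lambda>x. 4 * (norm (\<Phi> x))\<^sup>2)" using int by simp
      show "AE x in lebesgue_on S. norm ((norm (t j x))\<^sup>2) \<le> norm (4 * (norm (\<Phi> x))\<^sup>2)"
      proof (rule AE_I2)
        show "norm ((norm (t j x))\<^sup>2) \<le> norm (4 * (norm (\<Phi> x))\<^sup>2)" for x
          using power_mono[OF tn[of j x] norm_ge_zero, of 2] by (simp add: power_mult_distrib)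
      qed
    qed (use nm[OF t_sm[of j]] in measurable)
    then show ?thesis using t_sm by (simp add: L2_C_per_iff)
  qed
  have "(\<lambda>j. LINT x|lebesgue_on S. (norm (\<Phi> x - t j x))\<^sup>2) \<longlonglongrightarrow> (LINT x|lebesgue_on S. 0)"
  proof (rule integral_dominated_convergence[where w="\<lambda>x. 9 * (norm (\<Phi> x))\<^sup>2"])
    show "integrable (lebesgue_on S) (\<lambda>x. 9 * (norm (\<Phi> x))\<^sup>2)" using int by simp
    show "AE x in lebesgue_on S. (\<lambda>j. (norm (\<Phi> x - t j x))\<^sup>2) \<longlonglongrightarrow> 0"
      using s(3)
    proof eventually_elim
      case (elim x)
      have "(\<lambda>j. t j x) \<longlonglongrightarrow> \<Phi> x"
      proof (cases "\<Phi> x = 0")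
        case True
        then have "t j x = \<Phi> x" for j using tn[of j x] by simp
        then show ?thesis by simp
      next
        case False
        have "(\<lambda>j. norm (s j x)) \<longlonglongrightarrow> norm (\<Phi> x)" using elim by (rule tendsto_norm)
        moreover have "norm (\<Phi> x) < 2 * norm (\<Phi> x)" using False by simp
        ultimately have "eventually (\<lambda>j. norm (s j x) < 2 * norm (\<Phi> x)) sequentially" by (rule order_tendstoD)
        then have "eventually (\<lambda>j. s j x = t j x) sequentially" by eventually_elim (simp add: t_def)
        then show ?thesis using elim by (rule Lim_transform_eventually[rotated])
      qed
      then have "(\<lambda>j. (norm (\<Phi> x - t j x))\<^sup>2) \<longlonglongrightarrow> (norm (\<Phi> x - \<Phi> x))\<^sup>2" by (intro tendsto_intros)
      then show ?case by simp
    qed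
    show "AE x in lebesgue_on S. norm ((norm (\<Phi> x - t j x))\<^sup>2) \<le> 9 * (norm (\<Phi> x))\<^sup>2" for j
    proof (intro AE_I2)
      fix x
      have "norm (\<Phi> x - t j x) \<le> norm (\<Phi> x) + norm (t j x)" by (rule norm_triangle_ineq4)
      also have "\<dots> \<le> 3 * norm (\<Phi> x)" using tn[of j x] by simp
      finally have "(norm (\<Phi> x - t j x))\<^sup>2 \<le> (3 * norm (\<Phi> x))\<^sup>2" by (rule power_mono) simp
      then show "norm ((norm (\<Phi> x - t j x))\<^sup>2) \<le> 9 * (norm (\<Phi> x))\<^sup>2" by (simp add: power_mult_distrib)
    qed
    show "(\<lambda>x. (norm (\<Phi> x - t j x))\<^sup>2) \<in> borel_measurable (lebesgue_on S)" for j
      using L2_C_per_diff[OF S \<Phi> t_L2[of j]] by (simp add: L2_C_per_iff)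
  qed simp
  then have "(\<lambda>j. L2C_norm S (\<lambda>x. \<Phi> x - t j x)) \<longlonglongrightarrow> sqrt 0"
    unfolding L2C_norm_def by (intro tendsto_real_sqrt) simp
  then have "eventually (\<lambda>j. L2C_norm S (\<lambda>x. \<Phi> x - t j x) < e) sequentially"
    using \<open>e > 0\<close> by (intro order_tendstoD) auto
  then obtain j where "L2C_norm S (\<lambda>x. \<Phi> x - t j x) < e" by (auto simp: eventually_sequentially)
  with t_simple t_per t_L2 that show ?thesis by blast
qed

lemma periodic_continuous_bcontfun:
  fixes f :: "real^'m \<Rightarrow> real"
  assumes "continuous_on UNIV f" "periodic f"
  shows "f \<in> bcontfun"
proof -
  obtain h where h: "continuous_on (range torus_map) h" "\<And>y. h (torus_map y) = f y"
    using periodic_factor_torus[OF assms] by blast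
  have "bounded (h ` range torus_map)"
    by (intro compact_imp_bounded compact_continuous_image h compact_torus)
  then obtain b where "\<And>y. norm (h (torus_map y)) \<le> b" by (auto simp: bounded_iff)
  then show ?thesis using assms(1) h(2) by (intro bcontfun_normI[of f b]) auto
qed

lemma apply_Bcontfun_periodic:
  fixes f :: "real^'m \<Rightarrow> real"
  assumes "continuous_on UNIV f" "periodic f"
  shows "apply_bcontfun (Bcontfun f) = f" "Bcontfun f \<in> C_per"
  using Bcontfun_inverse[OF periodic_continuous_bcontfun[OF assms]] assms(2) by (simp_all add: C_per_def)

lemma Bcontfun_trig_poly:
  assumes "trig_poly f"
  shows "apply_bcontfun (Bcontfun f) = f" "Bcontfun f \<in> C_per"
  using apply_Bcontfun_periodic[OF continuous_trig_poly[OF assms] periodic_trig_poly[OF assms]] .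

section \<open>Convergence of uniformly bounded functionals\<close>

text \<open>
Uniformly bounded functionals on \<open>L\<^sup>2(S, C\<^sub>p\<^sub>e\<^sub>r)\<close>: the set where they converge to a given bounded functional is
a closed subspace, so it suffices to know convergence on a set with dense span.
\<close>

locale bounded_functionals =
  fixes S :: "(real^'n) set"
    and F :: "nat \<Rightarrow> (real^'n \<Rightarrow> ((real^'m) \<Rightarrow>\<^sub>C real)) \<Rightarrow> real"
    and G :: "(real^'n \<Rightarrow> ((real^'m) \<Rightarrow>\<^sub>C real)) \<Rightarrow> real" and K :: real
  assumes S: "S \<in> sets lebesgue" and S_finite: "emeasure lebesgue S < \<infinity>"
    and F_linear: "\<And>n \<Phi> \<Psi> a b. \<Phi> \<in> L2_C_per S \<Longrightarrow> \<Psi> \<in> L2_C_per S \<Longrightarrow>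
      F n (\<lambda>x. a *\<^sub>R \<Phi> x + b *\<^sub>R \<Psi> x) = a * F n \<Phi> + b * F n \<Psi>"
    and G_linear: "\<And>\<Phi> \<Psi> a b. \<Phi> \<in> L2_C_per S \<Longrightarrow> \<Psi> \<in> L2_C_per S \<Longrightarrow>
      G (\<lambda>x. a *\<^sub>R \<Phi> x + b *\<^sub>R \<Psi> x) = a * G \<Phi> + b * G \<Psi>"
    and F_bound: "\<And>n \<Phi>. \<Phi> \<in> L2_C_per S \<Longrightarrow> \<bar>F n \<Phi>\<bar> \<le> K * L2C_norm S \<Phi>"
    and G_bound: "\<And>\<Phi>. \<Phi> \<in> L2_C_per S \<Longrightarrow> \<bar>G \<Phi>\<bar> \<le> K * L2C_norm S \<Phi>"

begin

definition converges :: "(real^'n \<Rightarrow> ((real^'m) \<Rightarrow>\<^sub>C real)) \<Rightarrow> bool" where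
  "converges \<Phi> \<longleftrightarrow> \<Phi> \<in> L2_C_per S \<and> (\<lambda>n. F n \<Phi>) \<longlonglongrightarrow> G \<Phi>"

lemma converges_linear:
  assumes "converges \<Phi>" "converges \<Psi>" shows "converges (\<lambda>x. a *\<^sub>R \<Phi> x + b *\<^sub>R \<Psi> x)"
  using assms unfolding converges_def
  by (auto simp: F_linear G_linear L2_C_per_linear[OF S] intro!: tendsto_intros)

lemma sq_int_const: "sq_int (lebesgue_on S) (\<lambda>_. c)"
  by (rule sq_int_bounded_on[OF S S_finite, of _ "\<bar>c\<bar>"]) auto

lemma converges_0: "converges (\<lambda>x. 0)"
proof -
  have 0: "(\<lambda>x. 0 :: (real^'m) \<Rightarrow>\<^sub>C real) \<in> L2_C_per S"
    using L2_C_per_tensor[OF sq_int_const[of 0], of 0] by simp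
  have "F n (\<lambda>x. 0) = 0" "G (\<lambda>x. 0) = 0" for n
    using F_linear[OF 0 0, of n 0 0] G_linear[OF 0 0, of 0 0] by simp_all
  with 0 show ?thesis by (simp add: converges_def)
qed

lemma converges_sum:
  assumes "finite I" "\<And>i. i \<in> I \<Longrightarrow> converges (\<Phi> i)"
  shows "converges (\<lambda>x. \<Sum>i\<in>I. \<Phi> i x)"
  using assms
proof (induction I)
  case (insert i I)
  then show ?case using converges_linear[of "\<Phi> i" "\<lambda>x. \<Sum>i\<in>I. \<Phi> i x" 1 1] by simp
qed (simp add: converges_0)

lemma converges_closure:
  assumes \<Phi>: "\<Phi> \<in> L2_C_per S"
    and approx: "\<And>e. e > 0 \<Longrightarrow> \<exists>\<Psi>. converges \<Psi> \<and> L2C_norm S (\<lambda>x. \<Phi> x - \<Psi> x) \<le> e"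
  shows "converges \<Phi>"
  unfolding converges_def
proof (intro conjI \<Phi> LIMSEQ_I)
  fix r :: real assume "r > 0"
  define e where "e = r / (3 * (\<bar>K\<bar> + 1))"
  have "e > 0" using \<open>r > 0\<close> by (simp add: e_def)
  have Ke: "\<bar>K\<bar> * e < r / 3"
  proof -
    have "\<bar>K\<bar> * e < (\<bar>K\<bar> + 1) * e" using \<open>e > 0\<close> by (simp add: algebra_simps)
    also have "\<dots> = r / 3"
    proof -
      have "k * (r / (3 * k)) = r / 3" if "k \<noteq> 0" for k :: real using that by simp
      moreover have "\<bar>K\<bar> + 1 \<noteq> 0" by linarith
      ultimately show ?thesis unfolding e_def by blast
    qed
    finally show ?thesis .
  qed
  obtain \<Psi> where \<Psi>: "converges \<Psi>" "L2C_norm S (\<lambda>x. \<Phi> x - \<Psi> x) \<le> e" using approx[OF \<open>e > 0\<close>] by blast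
  have \<Psi>L: "\<Psi> \<in> L2_C_per S" using \<Psi> by (simp add: converges_def)
  have D: "(\<lambda>x. \<Phi> x - \<Psi> x) \<in> L2_C_per S" by (rule L2_C_per_diff[OF S \<Phi> \<Psi>L])
  have "K * L2C_norm S (\<lambda>x. \<Phi> x - \<Psi> x) \<le> \<bar>K\<bar> * e"
    using \<Psi>(2) by (intro mult_mono) (auto simp: L2C_norm_def)
  then have KD: "K * L2C_norm S (\<lambda>x. \<Phi> x - \<Psi> x) < r / 3" using Ke by simp
  have Fd: "\<bar>F n \<Phi> - F n \<Psi>\<bar> < r / 3" for n
    using F_linear[OF \<Phi> \<Psi>L, of n 1 "-1"] F_bound[OF D, of n] KD by simp
  have Gd: "\<bar>G \<Phi> - G \<Psi>\<bar> < r / 3"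
    using G_linear[OF \<Phi> \<Psi>L, of 1 "-1"] G_bound[OF D] KD by simp
  have "(\<lambda>n. F n \<Psi>) \<longlonglongrightarrow> G \<Psi>" using \<Psi> by (simp add: converges_def)
  from LIMSEQ_D[OF this, of "r/3"] \<open>r > 0\<close> obtain N where N: "\<And>n. n \<ge> N \<Longrightarrow> norm (F n \<Psi> - G \<Psi>) < r / 3"
    by auto
  have "norm (F n \<Phi> - G \<Phi>) < r" if "n \<ge> N" for n
    using N[OF that] Fd[of n] Gd by (simp only: real_norm_def)
  then show "\<exists>no. \<forall>n\<ge>no. norm (F n \<Phi> - G \<Phi>) < r" by blast
qed

lemma sq_int_indicator:
  assumes "A \<in> sets lebesgue" shows "sq_int (lebesgue_on S) (indicator A)"
proof (rule sq_int_bounded_on[OF S S_finite, of _ 1])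
  show "indicator A \<in> borel_measurable (lebesgue_on S)"
    using assms by (intro measurable_restrict_space1) simp
qed simp

lemma L2_C_per_indicator:
  "A \<in> sets lebesgue \<Longrightarrow> g \<in> C_per \<Longrightarrow> (\<lambda>x. indicator A x *\<^sub>R g) \<in> L2_C_per S"
  by (rule L2_C_per_tensor[OF sq_int_indicator])

text \<open>
For fixed \<open>g\<close>, the sets \<open>A\<close> for which convergence holds on \<open>1\<^sub>A g\<close> form a Dynkin class; countable disjoint unions are
limits of finite ones in the norm of \<open>L\<^sup>2(S, C\<^sub>p\<^sub>e\<^sub>r)\<close>.
\<close>

lemma converges_indicator_borel:
  assumes g: "g \<in> C_per"
    and \<B>: "Int_stable \<B>" "sets borel = sigma_sets UNIV \<B>" "UNIV \<in> \<B>"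
    and converges: "\<And>B. B \<in> \<B> \<Longrightarrow> converges (\<lambda>x. indicator B x *\<^sub>R g)"
    and A: "A \<in> sets borel"
  shows "converges (\<lambda>x. indicator A x *\<^sub>R g)"
proof (rule sigma_sets_induct_disjoint[OF \<B>(1), of UNIV A])
  show "A \<in> sigma_sets UNIV \<B>" using A \<B>(2) by simp
  show "converges (\<lambda>x. indicator {} x *\<^sub>R g)" using converges_0 by simp
next
  fix B assume "converges (\<lambda>x. indicator B x *\<^sub>R g)"
  from converges_linear[OF converges[OF \<B>(3)] this, of 1 "-1"]
  have "converges (\<lambda>x. indicator UNIV x *\<^sub>R g - indicator B x *\<^sub>R g)" by simp
  also have "(\<lambda>x. indicator UNIV x *\<^sub>R g - indicator B x *\<^sub>R g) = (\<lambda>x. indicator (UNIV - B) x *\<^sub>R g)"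
    by (auto simp: indicator_def)
  finally show "converges (\<lambda>x. indicator (UNIV - B) x *\<^sub>R g)" .
next
  fix B :: "nat \<Rightarrow> (real^'n) set"
  assume disj: "disjoint_family B" and B: "range B \<subseteq> sigma_sets UNIV \<B>"
    and IH: "\<And>i. converges (\<lambda>x. indicator (B i) x *\<^sub>R g)"
  have Bb[measurable]: "B i \<in> sets borel" for i using B \<B>(2) by auto
  let ?s = "\<lambda>N x. \<Sum>i<N. indicator (B i) x :: real"
  let ?d = "\<lambda>N x. indicator (\<Union>i. B i) x - ?s N x"
  have sums: "(\<lambda>i. indicator (B i) x :: real) sums indicator (\<Union>i. B i) x" for x
    using disj by (intro indicator_sums) (auto simp: disjoint_family_on_def)
  have s01: "0 \<le> ?d N x" "?d N x \<le> 1" for N x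
  proof -
    have "?s N x \<le> (\<Sum>i. indicator (B i) x)"
      using sums[of x] by (intro sum_le_suminf) (auto simp: sums_iff)
    then show "0 \<le> ?d N x" using sums[of x] by (simp add: sums_iff)
    have "0 \<le> ?s N x" by (intro sum_nonneg) auto
    moreover have "(indicator (\<Union>i. B i) x :: real) \<le> 1" by (rule indicator_le_1)
    ultimately show "?d N x \<le> 1" by linarith
  qed
  have UB: "(\<Union>i. B i) \<in> sets lebesgue" using Bb by (intro sets_completionI_sets) auto
  have "(\<lambda>N. LINT x|lebesgue_on S. (?d N x * norm g)\<^sup>2) \<longlonglongrightarrow> (LINT x|lebesgue_on S. 0)"
  proof (rule integral_dominated_convergence[where w="\<lambda>_. (norm g)\<^sup>2"])
    show "AE x in lebesgue_on S. (\<lambda>N. (?d N x * norm g)\<^sup>2) \<longlonglongrightarrow> 0"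
    proof (rule AE_I2)
      fix x
      have "(\<lambda>N. ?s N x) \<longlonglongrightarrow> indicator (\<Union>i. B i) x" using sums[of x] by (simp add: sums_def)
      then have "(\<lambda>N. (?d N x * norm g)\<^sup>2) \<longlonglongrightarrow> ((indicator (\<Union>i. B i) x - indicator (\<Union>i. B i) x) * norm g)\<^sup>2"
        by (intro tendsto_intros)
      then show "(\<lambda>N. (?d N x * norm g)\<^sup>2) \<longlonglongrightarrow> 0" by simp
    qed
    show "integrable (lebesgue_on S) (\<lambda>_. (norm g)\<^sup>2)" using sq_int_const[of "norm g"] by (simp add: sq_int_def)
    show "(\<lambda>x. (?d N x * norm g)\<^sup>2) \<in> borel_measurable (lebesgue_on S)" for N
    proof -
      have "(\<lambda>x. (?d N x * norm g)\<^sup>2) \<in> borel_measurable borel" by measurable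
      then show ?thesis by (intro measurable_restrict_space1 measurable_completion) simp
    qed
    show "AE x in lebesgue_on S. norm ((?d N x * norm g)\<^sup>2) \<le> (norm g)\<^sup>2" for N
    proof (rule AE_I2)
      fix x
      have "?d N x * norm g \<le> 1 * norm g" using s01[of x N] by (intro mult_right_mono) auto
      moreover have "0 \<le> ?d N x * norm g" using s01[of x N] by (intro mult_nonneg_nonneg) auto
      ultimately show "norm ((?d N x * norm g)\<^sup>2) \<le> (norm g)\<^sup>2" using power_mono[of "?d N x * norm g" "norm g" 2] by simp
    qed
  qed simp
  then have lim: "(\<lambda>N. sqrt (LINT x|lebesgue_on S. (?d N x * norm g)\<^sup>2)) \<longlonglongrightarrow> sqrt 0"
    by (intro tendsto_real_sqrt) simp
  show "converges (\<lambda>x. indicator (\<Union>i. B i) x *\<^sub>R g)"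
  proof (rule converges_closure[OF L2_C_per_indicator[OF UB g]])
    fix e :: real assume "e > 0"
    with order_tendstoD(2)[OF lim, of e]
    obtain N where N: "sqrt (LINT x|lebesgue_on S. (?d N x * norm g)\<^sup>2) < e" by (auto simp: eventually_sequentially)
    have "converges (\<lambda>x. \<Sum>i<N. indicator (B i) x *\<^sub>R g)" by (intro converges_sum IH) auto
    moreover have "(norm (indicator (\<Union>i. B i) x *\<^sub>R g - (\<Sum>i<N. indicator (B i) x *\<^sub>R g)))\<^sup>2 = (?d N x * norm g)\<^sup>2" for x
    proof -
      have "indicator (\<Union>i. B i) x *\<^sub>R g - (\<Sum>i<N. indicator (B i) x *\<^sub>R g) = ?d N x *\<^sub>R g"
        by (simp only: scaleR_left_diff_distrib scaleR_sum_left)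
      then show ?thesis by (simp add: power_mult_distrib)
    qed
    ultimately show "\<exists>\<Psi>. converges \<Psi> \<and> L2C_norm S (\<lambda>x. indicator (\<Union>i. B i) x *\<^sub>R g - \<Psi> x) \<le> e"
      using N by (intro exI[of _ "\<lambda>x. \<Sum>i<N. indicator (B i) x *\<^sub>R g"]) (simp add: L2C_norm_def)
  qed
qed (use converges in auto)

lemma L2C_norm_AE_0:
  assumes "AE x in lebesgue_on S. \<Phi> x = 0" shows "L2C_norm S \<Phi> = 0"
  unfolding L2C_norm_def using assms by (subst integral_eq_zero_AE) auto

lemma converges_indicator_lebesgue:
  assumes g: "g \<in> C_per" and A: "A \<in> sets lebesgue"
    and converges: "\<And>B. B \<in> sets borel \<Longrightarrow> converges (\<lambda>x. indicator B x *\<^sub>R g)"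
  shows "converges (\<lambda>x. indicator A x *\<^sub>R g)"
proof (rule converges_closure[OF L2_C_per_indicator[OF A g]])
  fix e :: real assume "e > 0"
  obtain B N N' where B: "A = B \<union> N" "N \<subseteq> N'" "N' \<in> null_sets lborel" "B \<in> sets lborel"
    using A by (elim sets_completionE)
  have "AE x in lebesgue. x \<notin> N'" using B(3) by (intro AE_completion AE_not_in)
  then have "AE x in lebesgue_on S. x \<notin> N'" using S by (subst AE_restrict_space_iff) auto
  then have "AE x in lebesgue_on S. indicator A x *\<^sub>R g - indicator B x *\<^sub>R g = 0"
    by eventually_elim (use B in \<open>auto simp: indicator_def\<close>)
  from L2C_norm_AE_0[OF this] show "\<exists>\<Psi>. converges \<Psi> \<and> L2C_norm S (\<lambda>x. indicator A x *\<^sub>R g - \<Psi> x) \<le> e"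
    using B(4) \<open>e > 0\<close> by (intro exI[of _ "\<lambda>x. indicator B x *\<^sub>R g"]) (auto intro!: converges)
qed

lemma L2C_norm_indicator_le:
  assumes "norm g \<le> e" "A \<in> sets lebesgue"
  shows "L2C_norm S (\<lambda>x. indicator A x *\<^sub>R g) \<le> sqrt (measure lebesgue S) * e"
proof -
  have e: "e \<ge> 0" using assms(1) norm_ge_zero order_trans by blast
  have "(LINT x|lebesgue_on S. (norm (indicator A x *\<^sub>R g))\<^sup>2) \<le> (LINT x|lebesgue_on S. e\<^sup>2)"
  proof (rule integral_mono)
    show "integrable (lebesgue_on S) (\<lambda>x. (norm (indicator A x *\<^sub>R g))\<^sup>2)"
      using sq_int_indicator[OF assms(2)] by (simp add: sq_int_def power_mult_distrib)
    show "integrable (lebesgue_on S) (\<lambda>x. e\<^sup>2)" using sq_int_const[of e] by (simp add: sq_int_def)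
    show "(norm (indicator A x *\<^sub>R g))\<^sup>2 \<le> e\<^sup>2" for x
      using assms(1) e by (intro power_mono) (auto simp: indicator_def)
  qed
  also have "\<dots> = measure lebesgue S * e\<^sup>2" using S by (simp add: measure_restrict_space)
  finally have "L2C_norm S (\<lambda>x. indicator A x *\<^sub>R g) \<le> sqrt (measure lebesgue S * e\<^sup>2)"
    unfolding L2C_norm_def by (rule real_sqrt_le_mono)
  then show ?thesis using e by (simp add: real_sqrt_mult)
qed

lemma converges_indicator_C_per:
  assumes g: "g \<in> C_per" and A: "A \<in> sets lebesgue"
    and converges: "\<And>k j. integer_vec k \<Longrightarrow> converges (\<lambda>x. indicator A x *\<^sub>R Bcontfun (trig k j))"
  shows "converges (\<lambda>x. indicator A x *\<^sub>R g)"
proof (rule converges_closure[OF L2_C_per_indicator[OF A g]])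
  fix e :: real assume "e > 0"
  have trig: "converges (\<lambda>x. indicator A x *\<^sub>R Bcontfun f)" if "trig_poly f" for f
    using that
  proof induction
    case (trig k j)
    then show ?case by (rule converges)
  next
    case (add f h)
    have "Bcontfun (\<lambda>y. f y + h y) = Bcontfun f + Bcontfun h"
      using add by (intro bcontfun_eqI) (simp add: Bcontfun_trig_poly trig_poly.add)
    with converges_linear[OF add(3,4), of 1 1] show ?case by (simp add: scaleR_add_right)
  next
    case (scale f c)
    have "Bcontfun (\<lambda>y. c * f y) = c *\<^sub>R Bcontfun f"
      using scale by (intro bcontfun_eqI) (simp add: Bcontfun_trig_poly trig_poly.scale)
    with converges_linear[OF scale(2) converges_0, of c 0] show ?case by (simp add: mult.commute)
  qed
  define d where "d = e / (sqrt (measure lebesgue S) + 1)"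
  have "d > 0" using \<open>e > 0\<close> by (simp add: d_def add_nonneg_pos)
  have g': "continuous_on UNIV (apply_bcontfun g)" "periodic (apply_bcontfun g)"
    using g by (auto simp: C_per_def)
  obtain f where f: "trig_poly f" "\<And>y. \<bar>apply_bcontfun g y - f y\<bar> < d"
    using trig_poly_dense[OF g' \<open>d > 0\<close>] by blast
  have "norm (g - Bcontfun f) \<le> d"
    using f(2) by (intro norm_bound) (simp add: Bcontfun_trig_poly[OF f(1)] less_imp_le)
  from L2C_norm_indicator_le[OF this A]
  have "L2C_norm S (\<lambda>x. indicator A x *\<^sub>R (g - Bcontfun f)) \<le> sqrt (measure lebesgue S) * d" .
  also have "\<dots> \<le> (sqrt (measure lebesgue S) + 1) * d" using \<open>d > 0\<close> by (simp add: algebra_simps)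
  also have "\<dots> = e" by (simp add: d_def) (smt (verit) real_sqrt_ge_zero measure_nonneg)
  finally show "\<exists>\<Psi>. converges \<Psi> \<and> L2C_norm S (\<lambda>x. indicator A x *\<^sub>R g - \<Psi> x) \<le> e"
    using trig[OF f(1)] by (intro exI[of _ "\<lambda>x. indicator A x *\<^sub>R Bcontfun f"]) (simp add: scaleR_diff_right)
qed

text \<open>
The density chain: from the generating sets to Borel and then Lebesgue sets, from characters to all continuous
periodic functions, from these tensors to simple functions, and from simple functions to the whole space.
\<close>

theorem converges_if_generators:
  assumes \<B>: "Int_stable \<B>" "sets borel = sigma_sets UNIV \<B>" "UNIV \<in> \<B>"
    and converges: "\<And>B k j. B \<in> \<B> \<Longrightarrow> integer_vec k \<Longrightarrow> converges (\<lambda>x. indicator B x *\<^sub>R Bcontfun (trig k j))"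
    and \<Phi>: "\<Phi> \<in> L2_C_per S"
  shows "converges \<Phi>"
proof (rule converges_closure[OF \<Phi>])
  fix e :: real assume "e > 0"
  from L2_C_per_simple_approx[OF S \<Phi> this]
  obtain s where s: "simple_function (lebesgue_on S) s" "\<And>x. x \<in> S \<Longrightarrow> s x \<in> C_per"
    "s \<in> L2_C_per S" "L2C_norm S (\<lambda>x. \<Phi> x - s x) < e" by blast
  let ?t = "\<lambda>x. \<Sum>c\<in>s ` S. indicator (s -` {c} \<inter> S) x *\<^sub>R c"
  have fin: "finite (s ` S)" using simple_functionD(1)[OF s(1)] by simp
  have converges_ind: "converges (\<lambda>x. indicator A x *\<^sub>R g)" if "g \<in> C_per" "A \<in> sets lebesgue" for A g
  proof (rule converges_indicator_C_per[OF that])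
    fix k :: "real^'m" and j assume k: "integer_vec k"
    have c: "Bcontfun (trig k j) \<in> C_per" by (rule Bcontfun_trig_poly[OF trig_poly.trig[OF k]])
    show "converges (\<lambda>x. indicator A x *\<^sub>R Bcontfun (trig k j))"
      by (rule converges_indicator_lebesgue[OF c that(2)], rule converges_indicator_borel[OF c \<B> converges[OF _ k]])
  qed
  have "converges ?t"
  proof (intro converges_sum fin converges_ind)
    fix c assume "c \<in> s ` S"
    then show "c \<in> C_per" using s(2) by auto
    have "s -` {c} \<inter> S \<in> sets (lebesgue_on S)" using simple_functionD(2)[OF s(1)] by simp
    then show "s -` {c} \<inter> S \<in> sets lebesgue" using S by (auto simp: sets_restrict_space_iff)
  qed
  moreover have "?t x = s x" if "x \<in> S" for x
  proof -
    have "?t x = (\<Sum>c\<in>s ` S. if c = s x then s x else 0)"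
      using that by (intro sum.cong) (auto simp: indicator_def)
    also have "\<dots> = s x" using fin that by simp
    finally show ?thesis .
  qed
  then have "L2C_norm S (\<lambda>x. \<Phi> x - ?t x) = L2C_norm S (\<lambda>x. \<Phi> x - s x)"
    unfolding L2C_norm_def by (intro arg_cong[where f=sqrt] Bochner_Integration.integral_cong) auto
  ultimately show "\<exists>\<Psi>. converges \<Psi> \<and> L2C_norm S (\<lambda>x. \<Phi> x - \<Psi> x) \<le> e"
    using s(4) by (intro exI[of _ ?t]) auto
qed

end

section \<open>Existence of two-scale limits\<close>

lemma diagonal_convergent_subsequence:
  fixes a :: "'i \<Rightarrow> nat \<Rightarrow> real"
  assumes "countable I" and bdd: "\<And>i. i \<in> I \<Longrightarrow> Bseq (a i)"
  obtains r :: "nat \<Rightarrow> nat" where "strict_mono r" "\<And>i. i \<in> I \<Longrightarrow> convergent (\<lambda>n. a i (r n))"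
proof (cases "I = {}")
  case True
  then show ?thesis using that[of id] by (auto simp: strict_mono_def)
next
  case False
  define P where "P k s \<longleftrightarrow> convergent (\<lambda>n. a (from_nat_into I k) (s n))" for k and s :: "nat \<Rightarrow> nat"
  interpret subseqs P
  proof
    fix k and s :: "nat \<Rightarrow> nat" assume "strict_mono s"
    have "Bseq (a (from_nat_into I k))" by (rule bdd[OF from_nat_into[OF False]])
    then have "Bseq (\<lambda>n. a (from_nat_into I k) (s n))" by (rule Bseq_subseq)
    then have "bounded (range (\<lambda>n. a (from_nat_into I k) (s n)))" by (simp add: Bseq_eq_bounded)
    from bounded_imp_convergent_subsequence[OF this]
    obtain l r where "strict_mono r" "((\<lambda>n. a (from_nat_into I k) (s n)) \<circ> r) \<longlonglongrightarrow> l" by blast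
    then show "\<exists>r'. strict_mono r' \<and> P k (s \<circ> r')"
      unfolding P_def by (intro exI[of _ r]) (auto simp: convergent_def o_def)
  qed
  have "convergent (\<lambda>n. a i (diagseq n))" if i: "i \<in> I" for i
  proof -
    obtain k where k: "from_nat_into I k = i" using from_nat_into_surj[OF assms(1) i] by blast
    have "P k (diagseq \<circ> ((+) (Suc k)))"
    proof (rule diagseq_holds)
      fix r s n assume "strict_mono (r :: nat \<Rightarrow> nat)" "P n s"
      then show "P n (s \<circ> r)" unfolding P_def
        using convergent_subseq_convergent[of "\<lambda>m. a (from_nat_into I n) (s m)" r] by (simp add: o_def)
    qed
    then have "convergent (\<lambda>n. a i (diagseq (n + Suc k)))" unfolding P_def k by (simp add: add.commute)
    then show ?thesis by (subst (asm) convergent_ignore_initial_segment)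
  qed
  with subseq_diagseq that show ?thesis by blast
qed

text \<open>
Finite intersections of members of a countable base. Countability serves the diagonal argument, openness the mean
value property, and stability under intersections the Dynkin class argument.
\<close>

lemma countable_open_generator:
  obtains \<B> :: "'a::second_countable_topology set set"
  where "countable \<B>" "Int_stable \<B>" "\<And>B. B \<in> \<B> \<Longrightarrow> open B"
    "sets borel = sigma_sets UNIV \<B>" "UNIV \<in> \<B>"
proof -
  obtain C :: "'a set set" where C: "countable C" "topological_basis C" using ex_countable_basis by blast
  let ?\<B> = "Inter ` {F. finite F \<and> F \<subseteq> C}"
  have op: "open B" if "B \<in> ?\<B>" for B
    using that C(2) topological_basis_open by (auto intro!: open_Inter)
  show ?thesis
  proof
    show "countable ?\<B>" using C(1) by (intro countable_image countable_Collect_finite_subset)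
    show "Int_stable ?\<B>"
    proof (rule Int_stableI)
      fix A B assume "A \<in> ?\<B>" "B \<in> ?\<B>"
      then obtain F G where "finite F" "F \<subseteq> C" "A = \<Inter>F" "finite G" "G \<subseteq> C" "B = \<Inter>G" by auto
      then show "A \<inter> B \<in> ?\<B>" by (intro image_eqI[of _ _ "F \<union> G"]) auto
    qed
    show "sets borel = sigma_sets UNIV ?\<B>"
    proof -
      have "sets borel = sigma_sets UNIV C" by (subst borel_eq_countable_basis[OF C]) simp
      also have "\<dots> = sigma_sets UNIV ?\<B>"
      proof (rule sigma_sets_eqI)
        fix A assume "A \<in> C"
        then have "A \<in> ?\<B>" by (intro image_eqI[of _ _ "{A}"]) auto
        then show "A \<in> sigma_sets UNIV ?\<B>" by auto
      next
        fix B assume "B \<in> ?\<B>"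
        then have "B \<in> sets borel" using op by auto
        then show "B \<in> sigma_sets UNIV C" by (simp add: \<open>sets borel = sigma_sets UNIV C\<close>)
      qed
      finally show ?thesis .
    qed
    show "UNIV \<in> ?\<B>" by (intro image_eqI[of _ _ "{}"]) auto
  qed (use op in auto)
qed

context oscillation begin

definition pairing :: "(real^'n) set \<Rightarrow> (nat \<Rightarrow> real^'n \<Rightarrow> real) \<Rightarrow> nat \<Rightarrow> ((real^'n) \<times> (real^'m) \<Rightarrow> real) \<Rightarrow> real" where
  "pairing S v n f = (LINT x|lebesgue_on S. v n x * f (x, fast n x))"

text \<open>
The scalar limit arises as the Riesz representative of the limit functional on tensor polynomials; density then
extends the convergence to every admissible test function.
\<close>

theorem two_scale_limit_exists:
  fixes S :: "(real^'n) set" and v :: "nat \<Rightarrow> real^'n \<Rightarrow> real"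
  assumes S: "open S" "bounded S"
    and v: "\<And>n. sq_int (lebesgue_on S) (v n)" and C: "\<And>n. sqrt (LINT x|lebesgue_on S. (v n x)\<^sup>2) \<le> C"
    and \<B>: "Int_stable \<B>" "\<And>B. B \<in> \<B> \<Longrightarrow> open B" "sets borel = sigma_sets UNIV \<B>" "UNIV \<in> \<B>"
    and conv: "\<And>B k j. B \<in> \<B> \<Longrightarrow> integer_vec k \<Longrightarrow>
      convergent (\<lambda>n. pairing S v n (\<lambda>z. indicator B (fst z) * trig k j (snd z)))"
  obtains w where "w \<in> borel_measurable borel" "sq_int (lebesgue_on (S \<times> unit_cell)) w"
    "\<And>\<Phi>. \<Phi> \<in> L2_C_per S \<Longrightarrow> (\<lambda>n. LINT x|lebesgue_on S. v n x * apply_bcontfun (\<Phi> x) (fast n x)) \<longlonglongrightarrow>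
      (LINT z|lebesgue_on (S \<times> unit_cell). w z * apply_bcontfun (\<Phi> (fst z)) (snd z))"
proof -
  let ?U = "unit_cell :: (real^'m) set"
  let ?D = "tensor_poly \<B> :: ((real^'n) \<times> (real^'m) \<Rightarrow> real) set"
  note Sm = open_bounded_lebesgue[OF S]
  have SU: "S \<times> ?U \<in> sets lebesgue" "emeasure lebesgue (S \<times> ?U) < \<infinity>"
    using sets_lebesgue_Times_borel[OF Sm(2) borel_unit_cell] Sm(3)
    by (auto simp: emeasure_lebesgue_Times_cell[OF Sm(2)])
  have Bb: "B \<in> sets borel" if "B \<in> \<B>" for B using \<B>(2)[OF that] by simp
  have BInt: "A \<inter> B \<in> \<B>" if "A \<in> \<B>" "B \<in> \<B>" for A B using \<B>(1) that by (auto simp: Int_stable_def)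
  have sqf: "sq_int (lebesgue_on S) (\<lambda>x. f (x, fast n x))" if "f \<in> ?D" for f n
    by (rule tensor_poly_sq_int[OF that Bb Sm(2,3) fast_pair_measurable])
  have sqD: "sq_int (lebesgue_on (S \<times> ?U)) f" if "f \<in> ?D" for f
    using tensor_poly_sq_int[OF that Bb SU measurable_ident[unfolded id_def]] by simp
  have p_add: "pairing S v n (\<lambda>z. f z + g z) = pairing S v n f + pairing S v n g" if "f \<in> ?D" "g \<in> ?D" for f g n
    unfolding pairing_def using sq_int_mult[OF v sqf[OF that(1)], of n n] sq_int_mult[OF v sqf[OF that(2)], of n n]
    by (simp add: distrib_left)
  have p_scale: "pairing S v n (\<lambda>z. c * f z) = c * pairing S v n f" for f c n
    unfolding pairing_def by (simp add: mult.left_commute)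
  define l where "l f = lim (\<lambda>n. pairing S v n f)" for f
  have cv: "convergent (\<lambda>n. pairing S v n f)" if "f \<in> ?D" for f
    using that by induction (auto simp: p_add p_scale intro: conv convergent_add convergent_mult convergent_const)
  then have lim: "(\<lambda>n. pairing S v n f) \<longlonglongrightarrow> l f" if "f \<in> ?D" for f
    using that by (simp add: l_def convergent_LIMSEQ_iff)
  have C0: "C \<ge> 0" using C[of 0] by (rule order_trans[rotated]) simp
  \<comment> \<open>Boundedness of the limit functional in the norm of \<open>L\<^sup>2(S \<times> Y)\<close>: Cauchy--Schwarz before the limit,
    and the mean value property of \<open>f\<^sup>2\<close> in the limit.\<close>
  have bound: "\<bar>l f\<bar> \<le> C * sqrt (LINT z|lebesgue_on (S \<times> ?U). (f z)\<^sup>2)" if f: "f \<in> ?D" for f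
  proof (rule LIMSEQ_le)
    show "(\<lambda>n. \<bar>pairing S v n f\<bar>) \<longlonglongrightarrow> \<bar>l f\<bar>" by (intro tendsto_intros lim f)
    have "(\<lambda>z. f z * f z) \<in> ?D" by (rule tensor_poly_mult[OF BInt f f])
    from mean_value_tensor_poly[OF S \<B>(2) this]
    show "(\<lambda>n. C * sqrt (LINT x|lebesgue_on S. (f (x, fast n x))\<^sup>2)) \<longlonglongrightarrow> C * sqrt (LINT z|lebesgue_on (S \<times> ?U). (f z)\<^sup>2)"
      by (intro tendsto_intros) (simp add: power2_eq_square)
    show "\<exists>N. \<forall>n\<ge>N. \<bar>pairing S v n f\<bar> \<le> C * sqrt (LINT x|lebesgue_on S. (f (x, fast n x))\<^sup>2)"
      unfolding pairing_def
      by (intro exI allI impI order_trans[OF Cauchy_Schwarz_sq_int[OF v sqf[OF f]]] mult_right_mono C) simp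
  qed
  obtain u where u: "sq_int (lebesgue_on (S \<times> ?U)) u"
      "\<And>f. f \<in> ?D \<Longrightarrow> (LINT z|lebesgue_on (S \<times> ?U). u z * f z) = l f"
  proof (rule Riesz_representation_sq_int[of ?D "lebesgue_on (S \<times> ?U)" l C])
    show "?D \<noteq> {}" using tensor_poly.tensor[OF \<B>(4), of 0 0] by auto
    show "l (\<lambda>x. f x + g x) = l f + l g" if "f \<in> ?D" "g \<in> ?D" for f g
      using tendsto_add[OF lim[OF that(1)] lim[OF that(2)]] lim[OF tensor_poly.add[OF that]]
      unfolding p_add[OF that] by (rule LIMSEQ_unique[rotated])
    show "l (\<lambda>x. c * f x) = c * l f" if "f \<in> ?D" for f c
      using tendsto_mult_left[OF lim[OF that]] lim[OF tensor_poly.scale[OF that]]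
      unfolding p_scale by (rule LIMSEQ_unique[rotated])
  qed (auto intro: sqD tensor_poly.intros bound)
  have um: "u \<in> borel_measurable (lebesgue_on (S \<times> ?U))" using u(1) by (simp add: sq_int_def)
  obtain w where w: "w \<in> borel_measurable borel" "AE z in lebesgue_on (S \<times> ?U). u z = w z"
    using borel_representative[OF SU(1) um] by blast
  have wm: "w \<in> borel_measurable (lebesgue_on (S \<times> ?U))"
    by (rule borel_measurable_lebesgue_on[OF w(1)])
  have w_sq: "sq_int (lebesgue_on (S \<times> ?U)) w"
    unfolding sq_int_def
  proof (intro conjI wm)
    have "integrable (lebesgue_on (S \<times> ?U)) (\<lambda>z. (u z)\<^sup>2)" using u(1) by (simp add: sq_int_def)
    then show "integrable (lebesgue_on (S \<times> ?U)) (\<lambda>z. (w z)\<^sup>2)"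
      by (rule Bochner_Integration.integrable_cong_AE_imp) (use w(2) wm in \<open>auto intro!: borel_measurable_power\<close>)
  qed
  have w_eq: "(LINT z|lebesgue_on (S \<times> ?U). w z * f z) = l f" if f: "f \<in> ?D" for f
  proof -
    have "(LINT z|lebesgue_on (S \<times> ?U). w z * f z) = (LINT z|lebesgue_on (S \<times> ?U). u z * f z)"
    proof (rule integral_cong_AE)
      show "AE z in lebesgue_on (S \<times> ?U). w z * f z = u z * f z" using w(2) by eventually_elim simp
    qed (use sqD[OF f] wm um in \<open>auto simp: sq_int_def intro!: borel_measurable_times\<close>)
    then show ?thesis using u(2)[OF f] by simp
  qed
  let ?F = "\<lambda>n \<Phi>. LINT x|lebesgue_on S. v n x * apply_bcontfun (\<Phi> x :: (real^'m) \<Rightarrow>\<^sub>C real) (fast n x)"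
  let ?G = "\<lambda>\<Phi>. LINT z|lebesgue_on (S \<times> ?U). w z * apply_bcontfun (\<Phi> (fst z)) (snd z)"
  define K where "K = C + sqrt (LINT z|lebesgue_on (S \<times> ?U). (w z)\<^sup>2)"
  have fm: "fast n \<in> borel_measurable (lebesgue_on S)" for n
    by (intro borel_measurable_lebesgue_on) simp
  have sm: "snd \<in> borel_measurable (lebesgue_on (S \<times> ?U))"
    by (intro borel_measurable_lebesgue_on) (simp add: borel_prod[symmetric])
  note pF = L2_C_per_pairing[OF Sm(2,2) measurable_ident[unfolded id_def] distr_id fm v]
  note pG = L2_C_per_pairing[OF Sm(2) SU(1) distr_fst_lebesgue_on_cell[OF Sm(2)] sm w_sq]
  interpret bounded_functionals S ?F ?G K
  proof
    fix \<Phi> :: "real^'n \<Rightarrow> ((real^'m) \<Rightarrow>\<^sub>C real)" and n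
    assume \<Phi>: "\<Phi> \<in> L2_C_per S"
    have N: "0 \<le> L2C_norm S \<Phi>" by (simp add: L2C_norm_def)
    show "\<bar>?F n \<Phi>\<bar> \<le> K * L2C_norm S \<Phi>"
      by (rule order_trans[OF pF(2)[OF \<Phi>] mult_right_mono[OF _ N]])
        (simp add: K_def add_increasing2 C)
    show "\<bar>?G \<Phi>\<bar> \<le> K * L2C_norm S \<Phi>"
      by (rule order_trans[OF pG(2)[OF \<Phi>] mult_right_mono[OF _ N]]) (use C0 in \<open>simp add: K_def\<close>)
  qed (use Sm(2,3) pF(1) pG(1) in auto)
  show ?thesis
  proof (rule that[OF w(1) w_sq])
    fix \<Phi> :: "real^'n \<Rightarrow> ((real^'m) \<Rightarrow>\<^sub>C real)" assume \<Phi>: "\<Phi> \<in> L2_C_per S"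
    have "converges \<Phi>"
    proof (rule converges_if_generators[OF \<B>(1,3,4) _ \<Phi>])
      fix B and k :: "real^'m" and j assume B: "B \<in> \<B>" and k: "integer_vec k"
      let ?f = "\<lambda>z::(real^'n) \<times> (real^'m). indicator B (fst z) * trig k j (snd z)"
      have f: "?f \<in> ?D" by (rule tensor_poly.tensor[OF B k])
      note bc = Bcontfun_trig_poly[OF trig_poly.trig[OF k], of j]
      have BL: "B \<in> sets lebesgue" using Bb[OF B] by (intro sets_completionI_sets) simp
      from lim[OF f] w_eq[OF f] show "converges (\<lambda>x. indicator B x *\<^sub>R Bcontfun (trig k j))"
        unfolding converges_def using L2_C_per_indicator[OF BL bc(2)] by (simp add: bc(1) pairing_def)
    qed
    then show "(\<lambda>n. ?F n \<Phi>) \<longlonglongrightarrow> ?G \<Phi>" by (simp add: converges_def)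
  qed
qed

end

lemma norm_vec_power2: "(norm (v :: real^'n))\<^sup>2 = (\<Sum>i\<in>UNIV. (v $ i)\<^sup>2)"
  unfolding power2_norm_eq_inner inner_vec_def by (simp add: power2_eq_square)

lemma borel_measurable_vecI:
  fixes f :: "'a \<Rightarrow> real^'n"
  assumes "\<And>i. (\<lambda>x. f x $ i) \<in> borel_measurable M" shows "f \<in> borel_measurable M"
  unfolding borel_measurable_euclidean_space[of f]
  using assms by (auto simp: Basis_vec_def inner_axis)

lemma borel_measurable_vecD:
  fixes f :: "'a \<Rightarrow> real^'n"
  assumes "f \<in> borel_measurable M" shows "(\<lambda>x. f x $ i) \<in> borel_measurable M"
  using assms unfolding borel_measurable_euclidean_space[of f]
  by (auto simp: Basis_vec_def inner_axis)

lemma L2_on_vec_iff: "v \<in> L2_on S \<longleftrightarrow> (\<forall>i. sq_int (lebesgue_on S) (\<lambda>x. v x $ i))"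
  for v :: "'a::euclidean_space \<Rightarrow> real^'n"
proof
  assume v: "v \<in> L2_on S"
  show "\<forall>i. sq_int (lebesgue_on S) (\<lambda>x. v x $ i)"
  proof
    fix i
    have m: "(\<lambda>x. v x $ i) \<in> borel_measurable (lebesgue_on S)"
      using v by (intro borel_measurable_vecD) (simp add: L2_on_def)
    have "integrable (lebesgue_on S) (\<lambda>x. (norm (v x))\<^sup>2)" using v by (simp add: L2_on_def)
    moreover have "norm ((v x $ i)\<^sup>2) \<le> norm ((norm (v x))\<^sup>2)" for x
      using power_mono[OF component_le_norm_cart[of "v x" i] abs_ge_zero, of 2] by simp
    ultimately have "integrable (lebesgue_on S) (\<lambda>x. (v x $ i)\<^sup>2)"
      by (rule Bochner_Integration.integrable_bound[OF _ borel_measurable_power[OF m] AE_I2])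
    with m show "sq_int (lebesgue_on S) (\<lambda>x. v x $ i)" by (simp add: sq_int_def)
  qed
next
  assume "\<forall>i. sq_int (lebesgue_on S) (\<lambda>x. v x $ i)"
  then have v: "(\<lambda>x. v x $ i) \<in> borel_measurable (lebesgue_on S)"
      "integrable (lebesgue_on S) (\<lambda>x. (v x $ i)\<^sup>2)" for i unfolding sq_int_def by blast+
  have "v \<in> borel_measurable (lebesgue_on S)" by (rule borel_measurable_vecI) (rule v(1))
  moreover have "integrable (lebesgue_on S) (\<lambda>x. \<Sum>i\<in>UNIV. (v x $ i)\<^sup>2)"
    by (rule Bochner_Integration.integrable_sum) (rule v(2))
  ultimately show "v \<in> L2_on S" by (simp only: L2_on_def norm_vec_power2 mem_Collect_eq conj_ac)
qed

lemma L2_norm_component_le: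
  fixes v :: "'a::euclidean_space \<Rightarrow> real^'n"
  assumes "v \<in> L2_on S"
  shows "sqrt (LINT x|lebesgue_on S. (v x $ i)\<^sup>2) \<le> L2_norm S v"
  unfolding L2_norm_def
proof (intro real_sqrt_le_mono integral_mono)
  show "integrable (lebesgue_on S) (\<lambda>x. (v x $ i)\<^sup>2)" using assms by (simp add: L2_on_vec_iff sq_int_def)
  show "integrable (lebesgue_on S) (\<lambda>x. (norm (v x))\<^sup>2)" using assms by (simp add: L2_on_def)
  show "(v x $ i)\<^sup>2 \<le> (norm (v x))\<^sup>2" for x
    using power_mono[OF component_le_norm_cart[of "v x" i] abs_ge_zero, of 2] by simp
qed

lemma countable_integer_vec: "countable {k :: real^'m. integer_vec k}"
proof -
  have "{k :: real^'m. integer_vec k} \<subseteq> range (\<lambda>l::int^'m. \<chi> i. of_int (l $ i))"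
  proof
    fix k :: "real^'m" assume "k \<in> {k. integer_vec k}"
    then have "k = (\<chi> i. of_int ((\<chi> i. \<lfloor>k $ i\<rfloor> :: int^'m) $ i))"
      by (simp add: integer_vec_def vec_eq_iff)
    then show "k \<in> range (\<lambda>l::int^'m. \<chi> i. of_int (l $ i))" by blast
  qed
  then show ?thesis by (rule countable_subset) auto
qed

text \<open>
The representative of \<open>y\<close> modulo \<open>\<int>\<^sup>m\<close> in the half-open cell.
\<close>

definition frac_vec :: "real^'m \<Rightarrow> real^'m" where
  "frac_vec y = (\<chi> i. frac (y $ i))"

lemma frac_vec_unit_cell: "y \<in> unit_cell \<Longrightarrow> frac_vec y = y"
  by (simp add: frac_vec_def unit_cell_def vec_eq_iff frac_eq less_imp_le)

lemma periodic_frac_vec: "periodic frac_vec"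
  unfolding periodic_def frac_vec_def integer_vec_def
  by (auto simp: vec_eq_iff frac_def elim!: Ints_cases)

lemma frac_vec_measurable: "frac_vec \<in> borel_measurable borel"
proof (rule borel_measurable_vecI)
  fix i :: 'a
  have [measurable]: "(\<lambda>y::real^'a. y $ i) \<in> borel_measurable borel" by (rule borel_measurable_vecD) simp
  show "(\<lambda>y::real^'a. frac_vec y $ i) \<in> borel_measurable borel"
    unfolding frac_vec_def vec_lambda_beta frac_def by measurable
qed

context oscillation begin

lemma oscillation_subsequence: "strict_mono r \<Longrightarrow> oscillation R (\<eta> \<circ> r)"
  using nonresonant eta_pos LIMSEQ_subseq_LIMSEQ[OF eta_lim] by unfold_locales auto

lemma weak_two_scale_converges_iff:
  "weak_two_scale_converges S R \<eta> v w \<longleftrightarrow> (\<forall>n. v n \<in> L2_on S) \<and> w \<in> L2_on (S \<times> unit_cell) \<and>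
     (\<forall>\<Phi>\<in>L2_C_per S. (\<lambda>n. LINT x|lebesgue_on S. v n x * apply_bcontfun (\<Phi> x) (fast n x)) \<longlonglongrightarrow>
        (LINT z|lebesgue_on (S \<times> unit_cell). w z * apply_bcontfun (\<Phi> (fst z)) (snd z)))"
  by (simp add: weak_two_scale_converges_def fast_def)

lemma L2_on_real_iff: "v \<in> L2_on S \<longleftrightarrow> sq_int (lebesgue_on S) (v :: _ \<Rightarrow> real)"
  by (simp add: L2_on_def sq_int_def)

text \<open>
The subsequence is chosen once for all components, by a diagonal argument over components, generating sets and
characters.
\<close>

theorem two_scale_compactness:
  fixes S :: "(real^'n) set" and u :: "nat \<Rightarrow> real^'n \<Rightarrow> real^'n"
  assumes S: "open S" "bounded S"
    and u: "\<And>n. u n \<in> L2_on S" and C: "\<And>n. L2_norm S (u n) \<le> C"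
  obtains r :: "nat \<Rightarrow> nat" and u0 :: "(real^'n) \<times> (real^'m) \<Rightarrow> real^'n"
  where "strict_mono r" "u0 \<in> borel_measurable borel" "\<And>x. periodic (\<lambda>y. u0 (x, y))"
    "u0 \<in> L2_on (S \<times> unit_cell)"
    "\<And>i. weak_two_scale_converges S R (\<eta> \<circ> r) (\<lambda>n x. u (r n) x $ i) (\<lambda>z. u0 z $ i)"
proof -
  let ?U = "unit_cell :: (real^'m) set"
  note SL = open_bounded_lebesgue(2)[OF S] and finS = open_bounded_lebesgue(3)[OF S]
  obtain \<B> :: "(real^'n) set set" where \<B>: "countable \<B>" "Int_stable \<B>" "\<And>B. B \<in> \<B> \<Longrightarrow> open B"
    "sets borel = sigma_sets UNIV \<B>" "UNIV \<in> \<B>" by (rule countable_open_generator) (rule that, blast+)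
  have ui: "sq_int (lebesgue_on S) (\<lambda>x. u n x $ i)" for n i using u[of n] by (simp add: L2_on_vec_iff)
  have Ci: "sqrt (LINT x|lebesgue_on S. (u n x $ i)\<^sup>2) \<le> C" for n i
    by (rule order_trans[OF L2_norm_component_le[OF u] C])
  let ?I = "(UNIV :: 'n set) \<times> \<B> \<times> {k :: real^'m. integer_vec k} \<times> (UNIV :: int set)"
  define a where "a p = (case p of (i, B, k, j) \<Rightarrow>
    \<lambda>n. pairing S (\<lambda>n x. u n x $ i) n (\<lambda>z. indicator B (fst z) * trig k j (snd z)))" for p
  have I: "countable ?I"
    using \<B>(1) countable_integer_vec by (intro countable_SIGMA) (auto intro: countable_finite)
  have bounded: "Bseq (a p)" if pI: "p \<in> ?I" for p
  proof -
    obtain i B k j where p: "p = (i, B, k, j)" "B \<in> \<B>" using pI by (cases p) auto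
    let ?f = "\<lambda>n x. indicator B x * trig k j (fast n x) :: real"
    have [measurable]: "B \<in> sets borel" using \<B>(3)[OF p(2)] by simp
    have sq: "sq_int (lebesgue_on S) (?f n)" for n
    proof (rule sq_int_bounded_on[OF SL finS, where K=1])
      have [measurable]: "trig k j \<in> borel_measurable borel"
        by (intro borel_measurable_continuous_onI continuous_trig continuous_on_id)
      show "?f n \<in> borel_measurable (lebesgue_on S)"
        by (rule borel_measurable_lebesgue_on) measurable
    qed (auto simp: indicator_def abs_trig_le)
    have fin: "finite_measure (lebesgue_on S)"
      using SL finS by (intro finite_measureI) (simp add: emeasure_restrict_space)
    have "sqrt (LINT x|lebesgue_on S. (?f n x)\<^sup>2) \<le> sqrt (LINT x|lebesgue_on S. 1)" for n
    proof (intro real_sqrt_le_mono integral_mono)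
      show "(?f n x)\<^sup>2 \<le> 1" for x using abs_trig_le[of k j "fast n x"] by (auto simp: indicator_def abs_square_le_1)
    qed (use sq finite_measure.integrable_const[OF fin] in \<open>auto simp: sq_int_def\<close>)
    moreover have "C \<ge> 0" using Ci[of 0 undefined] by (rule order_trans[rotated]) simp
    ultimately have "norm (a p n) \<le> C * sqrt (LINT x|lebesgue_on S. 1)" for n
      unfolding a_def p(1) prod.case pairing_def fst_conv snd_conv real_norm_def
      by (intro order_trans[OF Cauchy_Schwarz_sq_int[OF ui sq]] mult_mono Ci) auto
    then show ?thesis by (rule BseqI')
  qed
  obtain r :: "nat \<Rightarrow> nat" where r: "strict_mono r" "\<And>p. p \<in> ?I \<Longrightarrow> convergent (\<lambda>n. a p (r n))"
    by (rule diagonal_convergent_subsequence[of ?I a, OF I bounded]) (simp, rule that, blast+)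
  interpret sub: oscillation R "\<eta> \<circ> r" by (rule oscillation_subsequence[OF r(1)])
  have fast_r: "sub.fast n x = fast (r n) x" for n x by (simp add: fast_def sub.fast_def)
  define L where "L i w \<longleftrightarrow> w \<in> borel_measurable borel \<and> sq_int (lebesgue_on (S \<times> ?U)) w \<and>
     (\<forall>\<Phi>\<in>L2_C_per S. (\<lambda>n. LINT x|lebesgue_on S. u (r n) x $ i * apply_bcontfun (\<Phi> x) (sub.fast n x)) \<longlonglongrightarrow>
      (LINT z|lebesgue_on (S \<times> ?U). w z * apply_bcontfun (\<Phi> (fst z)) (snd z)))" for i w
  have "\<exists>w. L i w" for i
  proof (rule sub.two_scale_limit_exists[OF S, of "\<lambda>n x. u (r n) x $ i" C \<B>])
    fix B and k :: "real^'m" and j assume "B \<in> \<B>" "integer_vec k"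
    then show "convergent (\<lambda>n. sub.pairing S (\<lambda>n x. u (r n) x $ i) n (\<lambda>z. indicator B (fst z) * trig k j (snd z)))"
      using r(2)[of "(i, B, k, j)"] by (simp add: a_def pairing_def sub.pairing_def fast_r)
  qed (use ui Ci \<B> in \<open>auto simp: L_def\<close>)
  then have "\<forall>i. \<exists>w. L i w" by blast
  from choice[OF this] obtain w where "\<forall>i. L i (w i)" by blast
  then have w: "w i \<in> borel_measurable borel" "sq_int (lebesgue_on (S \<times> ?U)) (w i)"
    "\<And>\<Phi>. \<Phi> \<in> L2_C_per S \<Longrightarrow> (\<lambda>n. LINT x|lebesgue_on S. u (r n) x $ i * apply_bcontfun (\<Phi> x) (sub.fast n x)) \<longlonglongrightarrow>
      (LINT z|lebesgue_on (S \<times> ?U). w i z * apply_bcontfun (\<Phi> (fst z)) (snd z))" for i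
    unfolding L_def by blast+
  \<comment> \<open>The limit only matters on the open cell; folding its second argument back into the cell makes every
    section periodic without destroying Borel measurability.\<close>
  define u0 where "u0 z = (\<chi> i. w i (fst z, frac_vec (snd z)))" for z
  have u0w: "u0 z $ i = w i z" if "z \<in> S \<times> ?U" for z i
    using that by (auto simp: u0_def frac_vec_unit_cell)
  have u0i: "sq_int (lebesgue_on (S \<times> ?U)) (\<lambda>z. u0 z $ i)" for i
  proof -
    have "(\<lambda>z. u0 z $ i) \<in> borel_measurable (lebesgue_on (S \<times> ?U)) \<longleftrightarrow> w i \<in> borel_measurable (lebesgue_on (S \<times> ?U))"
      by (rule measurable_cong) (rule u0w, simp)
    moreover have "integrable (lebesgue_on (S \<times> ?U)) (\<lambda>z. (u0 z $ i)\<^sup>2) \<longleftrightarrow> integrable (lebesgue_on (S \<times> ?U)) (\<lambda>z. (w i z)\<^sup>2)"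
      by (rule Bochner_Integration.integrable_cong[OF refl], subst u0w) simp_all
    ultimately show ?thesis using w(2)[of i] by (simp add: sq_int_def)
  qed
  show ?thesis
  proof (rule that[OF r(1)])
    show "u0 \<in> borel_measurable borel"
    proof (rule borel_measurable_vecI)
      fix i
      have "(\<lambda>z::(real^'n) \<times> (real^'m). (fst z, frac_vec (snd z))) \<in> borel \<rightarrow>\<^sub>M borel"
        using frac_vec_measurable unfolding borel_prod[symmetric] by measurable
      from measurable_compose[OF this w(1)[of i]] show "(\<lambda>z. u0 z $ i) \<in> borel_measurable borel"
        by (simp add: u0_def)
    qed
    show "periodic (\<lambda>y. u0 (x, y))" for x
      using periodic_frac_vec unfolding periodic_def u0_def fst_conv snd_conv by metis
    show "u0 \<in> L2_on (S \<times> ?U)" using u0i by (simp add: L2_on_vec_iff)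
    show "weak_two_scale_converges S R (\<eta> \<circ> r) (\<lambda>n x. u (r n) x $ i) (\<lambda>z. u0 z $ i)" for i
      unfolding sub.weak_two_scale_converges_iff L2_on_real_iff
    proof (intro conjI allI ballI ui u0i)
      fix \<Phi> :: "real^'n \<Rightarrow> ((real^'m) \<Rightarrow>\<^sub>C real)" assume \<Phi>: "\<Phi> \<in> L2_C_per S"
      have "(LINT z|lebesgue_on (S \<times> ?U). u0 z $ i * apply_bcontfun (\<Phi> (fst z)) (snd z)) =
        (LINT z|lebesgue_on (S \<times> ?U). w i z * apply_bcontfun (\<Phi> (fst z)) (snd z))"
        by (rule Bochner_Integration.integral_cong) (auto simp: u0w)
      with w(3)[OF \<Phi>, of i]
      show "(\<lambda>n. LINT x|lebesgue_on S. u (r n) x $ i * apply_bcontfun (\<Phi> x) (sub.fast n x)) \<longlonglongrightarrow>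
        (LINT z|lebesgue_on (S \<times> ?U). u0 z $ i * apply_bcontfun (\<Phi> (fst z)) (snd z))" by simp
    qed
  qed
qed

end

section \<open>Smooth functions and the fundamental lemma of the calculus of variations\<close>

lemma has_derivative_grad:
  fixes f :: "real^'n \<Rightarrow> real"
  assumes "f differentiable (at x)"
  shows "(f has_derivative (\<lambda>v. grad f x \<bullet> v)) (at x)"
proof -
  let ?D = "frechet_derivative f (at x)"
  have D: "(f has_derivative ?D) (at x)" using assms frechet_derivative_works by blast
  then interpret linear ?D by (rule has_derivative_linear)
  have "?D v = grad f x \<bullet> v" for v
  proof -
    have "?D v = ?D (\<Sum>i\<in>UNIV. v $ i *\<^sub>R axis i 1)"
      using basis_expansion[of v] by (simp add: scalar_mult_eq_scaleR)
    also have "\<dots> = (\<Sum>i\<in>UNIV. v $ i * ?D (axis i 1))" by (simp add: sum scaleR)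
    finally show ?thesis by (simp add: grad_def inner_vec_def mult.commute)
  qed
  then have "?D = (\<lambda>v. grad f x \<bullet> v)" by auto
  with D show ?thesis by simp
qed

lemma grad_eqI:
  assumes "(f has_derivative (\<lambda>v. g \<bullet> v)) (at x)" shows "grad f x = g"
  by (simp add: grad_def vec_eq_iff frechet_derivative_at[OF assms, symmetric] inner_axis)

lemma grad_add:
  assumes "f differentiable (at x)" "g differentiable (at x)"
  shows "grad (\<lambda>x. f x + g x) x = grad f x + grad g x"
  using has_derivative_add[OF assms[THEN has_derivative_grad]]
  by (intro grad_eqI) (simp add: inner_add_left)

lemma grad_mult:
  assumes "f differentiable (at x)" "g differentiable (at x)"
  shows "grad (\<lambda>x. f x * g x) x = f x *\<^sub>R grad g x + g x *\<^sub>R grad f x"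
  using has_derivative_mult[OF assms[THEN has_derivative_grad]]
  by (intro grad_eqI) (simp add: inner_add_left mult.commute)

lemma grad_const: "grad (\<lambda>x. c) x = 0"
  by (rule grad_eqI) simp

lemma grad_compose_linear:
  fixes w :: "real^'m \<Rightarrow> real" and A :: "real^'n^'m"
  assumes "w differentiable (at (A *v x))"
  shows "(\<lambda>x. w (A *v x)) differentiable (at x)"
    and "grad (\<lambda>x. w (A *v x)) x = transpose A *v grad w (A *v x)"
proof -
  have "((\<lambda>x. A *v x) has_derivative (\<lambda>v. A *v v)) (at x)"
    by (rule bounded_linear_imp_has_derivative) (simp add: linear_conv_bounded_linear[symmetric])
  from has_derivative_compose[OF this has_derivative_grad[OF assms]]
  have D: "((\<lambda>x. w (A *v x)) has_derivative (\<lambda>v. grad w (A *v x) \<bullet> (A *v v))) (at x)" .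
  then show "(\<lambda>x. w (A *v x)) differentiable (at x)" by (rule differentiableI)
  have "grad w (A *v x) \<bullet> (A *v v) = (transpose A *v grad w (A *v x)) \<bullet> v" for v
    by (simp add: transpose_matrix_vector dot_lmul_matrix)
  with D show "grad (\<lambda>x. w (A *v x)) x = transpose A *v grad w (A *v x)"
    by (intro grad_eqI) simp
qed

lemma C_k_continuous: "C_k k f \<Longrightarrow> continuous_on UNIV f"
  by (cases k) (auto intro!: differentiable_imp_continuous_on simp: differentiable_on_def
      differentiable_at_imp_differentiable_on)

lemma C_k_Suc_imp: "C_k (Suc k) f \<Longrightarrow> C_k k f"
proof (induction k arbitrary: f)
  case 0
  then show ?case using C_k_continuous by (metis C_k.simps(1))
next
  case (Suc k)
  then show ?case by (metis C_k.simps(2))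
qed

lemma C_k_const: "C_k k (\<lambda>x. c)"
  by (induction k arbitrary: c) (simp_all add: grad_const)

lemma C_k_add: "C_k k f \<Longrightarrow> C_k k g \<Longrightarrow> C_k k (\<lambda>x. f x + g x)"
proof (induction k arbitrary: f g)
  case 0 then show ?case by (simp add: continuous_on_add)
next
  case (Suc k) then show ?case by (simp add: grad_add)
qed

lemma C_k_mult: "C_k k f \<Longrightarrow> C_k k g \<Longrightarrow> C_k k (\<lambda>x. f x * g x)"
proof (induction k arbitrary: f g)
  case 0 then show ?case by (simp add: continuous_on_mult)
next
  case (Suc k)
  have fg: "C_k k f" "C_k k g" using Suc.prems[THEN C_k_Suc_imp] .
  from Suc show ?case by (auto simp: grad_mult intro!: C_k_add Suc.IH fg)
qed

lemma C_k_sum: "finite I \<Longrightarrow> (\<And>i. i \<in> I \<Longrightarrow> C_k k (f i)) \<Longrightarrow> C_k k (\<lambda>x. \<Sum>i\<in>I. f i x)"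
  by (induction I rule: finite_induct) (auto intro: C_k_add C_k_const)

lemma C_k_prod: "finite I \<Longrightarrow> (\<And>i. i \<in> I \<Longrightarrow> C_k k (f i)) \<Longrightarrow> C_k k (\<lambda>x. \<Prod>i\<in>I. f i x)"
  by (induction I rule: finite_induct) (auto intro: C_k_mult C_k_const)

text \<open>
By induction on \<open>k\<close>, since the gradient of \<open>w \<circ> A\<close> is \<open>A\<^sup>T (\<nabla>w \<circ> A)\<close>.
\<close>

lemma C_k_compose_linear:
  fixes w :: "real^'m \<Rightarrow> real" and A :: "real^'n^'m"
  shows "C_k k w \<Longrightarrow> C_k k (\<lambda>x. w (A *v x))"
proof (induction k arbitrary: w)
  case 0
  then show ?case
    by (auto intro!: continuous_on_compose2[of UNIV w] matrix_vector_mult_linear_continuous_on)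
next
  case (Suc k)
  have "C_k k (\<lambda>x. \<Sum>j\<in>UNIV. transpose A $ i $ j * grad w (A *v x) $ j)" for i
    using Suc by (intro C_k_sum C_k_mult C_k_const) auto
  moreover have "grad (\<lambda>x. w (A *v x)) x $ i = (\<Sum>j\<in>UNIV. transpose A $ i $ j * grad w (A *v x) $ j)" for x i
    using Suc.prems by (subst grad_compose_linear) (auto simp: matrix_vector_mult_def)
  ultimately show ?case using Suc.prems by (simp add: grad_compose_linear(1))
qed

lemma smooth_const: "smooth (\<lambda>x. c)"
  by (simp add: smooth_def C_k_const)

lemma smooth_mult: "smooth f \<Longrightarrow> smooth g \<Longrightarrow> smooth (\<lambda>x. f x * g x)"
  by (simp add: smooth_def C_k_mult)

lemma smooth_compose_linear: "smooth w \<Longrightarrow> smooth (\<lambda>x. w (A *v x))"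
  by (simp add: smooth_def C_k_compose_linear)

lemma smooth_imp_differentiable: "smooth f \<Longrightarrow> f differentiable (at x)"
  unfolding smooth_def by (drule spec[of _ "Suc 0"]) simp

lemma smooth_imp_continuous: "smooth f \<Longrightarrow> continuous_on UNIV f"
  unfolding smooth_def by (drule spec[of _ 0]) simp

lemma smooth_grad: "smooth f \<Longrightarrow> smooth (\<lambda>x. grad f x $ i)"
  unfolding smooth_def by (metis C_k.simps(2))

text \<open>
Exhibiting a family that is stable under partial derivatives replaces the computation of higher derivatives.
\<close>

lemma smooth_family:
  assumes "\<And>f x. f \<in> \<F> \<Longrightarrow> f differentiable (at x)" "\<And>f i. f \<in> \<F> \<Longrightarrow> (\<lambda>x. grad f x $ i) \<in> \<F>"
    and "f \<in> \<F>"
  shows "smooth f"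
proof -
  have "f \<in> \<F> \<Longrightarrow> C_k k f" for k f
  proof (induction k arbitrary: f)
    case 0
    then show ?case using assms(1)
      by (auto intro!: differentiable_imp_continuous_on simp: differentiable_on_def differentiable_at_imp_differentiable_on)
  next
    case (Suc k) then show ?case using assms by auto
  qed
  with assms(3) show ?thesis by (simp add: smooth_def)
qed

text \<open>
The class of functions \<open>p(1/t) exp(-1/t)\<close>, extended by \<open>0\<close>, is stable under differentiation; \<open>flat 1\<close> is the classical
smooth function that is flat at \<open>0\<close>.
\<close>

definition flat :: "real poly \<Rightarrow> real \<Rightarrow> real" where
  "flat p t = (if t > 0 then poly p (1 / t) * exp (- (1 / t)) else 0)"

lemma flat_tendsto_0: "(flat p \<longlongrightarrow> 0) (at_right 0)"
proof -
  have "((\<lambda>x. poly p x * exp (- x)) \<longlongrightarrow> (\<Sum>i\<le>degree p. coeff p i * 0)) at_top"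
  proof -
    have "((\<lambda>x. \<Sum>i\<le>degree p. coeff p i * (x ^ i / exp x)) \<longlongrightarrow> (\<Sum>i\<le>degree p. coeff p i * 0)) at_top"
      by (intro tendsto_intros tendsto_power_div_exp_0)
    moreover have "(\<Sum>i\<le>degree p. coeff p i * (x ^ i / exp x)) = poly p x * exp (- x)" for x :: real
      by (simp add: poly_altdef sum_distrib_right exp_minus divide_inverse mult.assoc)
    ultimately show ?thesis by simp
  qed
  from filterlim_compose[OF this filterlim_inverse_at_top_right]
  have "((\<lambda>t. poly p (inverse t) * exp (- inverse t)) \<longlongrightarrow> 0) (at_right 0)" by simp
  moreover have "eventually (\<lambda>t. poly p (inverse t) * exp (- inverse t) = flat p t) (at_right 0)"
    by (auto simp: flat_def eventually_at_filter inverse_eq_divide)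
  ultimately show ?thesis by (rule Lim_transform_eventually)
qed

lemma flat_DERIV: "(flat p has_field_derivative flat ([:0, 0, 1:] * (p - pderiv p)) t) (at t)"
proof -
  consider "t > 0" | "t < 0" | "t = 0" by linarith
  then show ?thesis
  proof cases
    case 1
    have "((\<lambda>t. poly p (1 / t) * exp (- (1 / t))) has_field_derivative flat ([:0, 0, 1:] * (p - pderiv p)) t) (at t)"
      using 1 by (auto intro!: derivative_eq_intros DERIV_chain2[OF poly_DERIV] simp: flat_def field_simps power2_eq_square)
    moreover have "eventually (\<lambda>s. s \<in> {0<..}) (nhds t)" using 1 by (intro eventually_nhds_in_open) auto
    then have "eventually (\<lambda>s. flat p s = poly p (1 / s) * exp (- (1 / s))) (nhds t)"
      by eventually_elim (simp add: flat_def)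
    ultimately show ?thesis by (subst DERIV_cong_ev[OF refl _ refl])
  next
    case 2
    have "((\<lambda>t. 0) has_field_derivative flat ([:0, 0, 1:] * (p - pderiv p)) t) (at t)"
      using 2 by (simp add: flat_def)
    moreover have "eventually (\<lambda>s. s \<in> {..<0}) (nhds t)" using 2 by (intro eventually_nhds_in_open) auto
    then have "eventually (\<lambda>s. flat p s = 0) (nhds t)"
      by eventually_elim (simp add: flat_def)
    ultimately show ?thesis by (subst DERIV_cong_ev[OF refl _ refl])
  next
    case 3
    have "((\<lambda>s. (flat p s - flat p 0) / (s - 0)) \<longlongrightarrow> 0) (at 0)"
    proof (rule filterlim_split_at)
      have "eventually (\<lambda>s. 0 = (flat p s - flat p 0) / (s - 0)) (at_left (0::real))"
        by (auto simp: flat_def eventually_at_filter)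
      then show "((\<lambda>s. (flat p s - flat p 0) / (s - 0)) \<longlongrightarrow> 0) (at_left 0)"
        by (rule Lim_transform_eventually[OF tendsto_const])
      have "eventually (\<lambda>s. flat ([:0, 1:] * p) s = (flat p s - flat p 0) / (s - 0)) (at_right (0::real))"
        by (auto simp: flat_def eventually_at_filter)
      then show "((\<lambda>s. (flat p s - flat p 0) / (s - 0)) \<longlongrightarrow> 0) (at_right 0)"
        by (rule Lim_transform_eventually[OF flat_tendsto_0])
    qed
    then show ?thesis using 3 by (simp add: has_field_derivative_iff) (simp add: flat_def)
  qed
qed

lemma smooth_flat_coordinate:
  fixes i :: "'n::finite"
  shows "smooth (\<lambda>x::real^'n. flat p (c * x $ i + d))"
proof -
  let ?\<F> = "{f. \<exists>a p. f = (\<lambda>x::real^'n. a * flat p (c * x $ i + d))}"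
  show ?thesis
  proof (rule smooth_family[where \<F>="?\<F>"])
    fix f assume "f \<in> ?\<F>"
    then obtain a p where f: "f = (\<lambda>x. a * flat p (c * x $ i + d))" by blast
    let ?q = "[:0, 0, 1:] * (p - pderiv p)"
    have D: "(f has_derivative (\<lambda>v. ((a * c * flat ?q (c * x $ i + d)) *\<^sub>R axis i 1) \<bullet> v)) (at x)" for x
    proof -
      have "((\<lambda>x::real^'n. c * x $ i + d) has_derivative (\<lambda>v. c * v $ i)) (at x)"
        by (auto intro!: derivative_eq_intros bounded_linear_imp_has_derivative[OF bounded_linear_vec_nth])
      from has_derivative_compose[OF this flat_DERIV[THEN has_field_derivative_imp_has_derivative], of p]
      have "((\<lambda>x::real^'n. flat p (c * x $ i + d)) has_derivative (\<lambda>v. flat ?q (c * x $ i + d) * (c * v $ i))) (at x)" .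
      from has_derivative_mult_right[OF this, of a] show ?thesis
        unfolding f by (simp add: inner_axis' mult_ac)
    qed
    show "f differentiable (at x)" for x using D by (rule differentiableI)
    have "grad f x $ j = (a * c * axis i 1 $ j) * flat ?q (c * x $ i + d)" for x j
      using grad_eqI[OF D] by simp
    then show "(\<lambda>x. grad f x $ j) \<in> ?\<F>" for j by auto
  next
    show "(\<lambda>x::real^'n. flat p (c * x $ i + d)) \<in> ?\<F>"
      by (auto intro!: exI[of _ 1] exI[of _ p])
  qed
qed

text \<open>
Smooth, supported in the closed box, and increasing to the indicator of the open box as \<open>N\<close> grows, because
\<open>flat 1 (N t) = exp(-1/(N t))\<close> tends to \<open>1\<close> for \<open>t > 0\<close>.
\<close>

definition bump :: "real^'n \<Rightarrow> real^'n \<Rightarrow> nat \<Rightarrow> real^'n \<Rightarrow> real" where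
  "bump a b N x = (\<Prod>i\<in>UNIV. flat 1 (real (Suc N) * (x $ i - a $ i)) * flat 1 (real (Suc N) * (b $ i - x $ i)))"

lemma flat_1_bounds: "0 \<le> flat 1 t" "flat 1 t \<le> 1" "t \<le> 0 \<Longrightarrow> flat 1 t = 0"
  by (auto simp: flat_def)

lemma bump_bounds: "0 \<le> bump a b N x" "bump a b N x \<le> 1"
  unfolding bump_def by (auto intro!: prod_nonneg prod_le_1 mult_nonneg_nonneg mult_le_one flat_1_bounds)

lemma bump_eq_0: "x \<notin> box a b \<Longrightarrow> bump a b N x = 0"
  unfolding bump_def mem_box_cart
  by (auto simp: not_less intro!: prod_zero flat_1_bounds(3) mult_nonneg_nonpos)

lemma smooth_bump: "smooth (bump a b N)"
proof -
  have eq: "real (Suc N) * (x $ i - a $ i) = real (Suc N) * x $ i + (- real (Suc N) * a $ i)"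
    "real (Suc N) * (b $ i - x $ i) = - real (Suc N) * x $ i + real (Suc N) * b $ i" for x i
    by (simp_all add: algebra_simps)
  have "C_k k (bump a b N)" for k
    unfolding bump_def eq
    by (intro C_k_prod C_k_mult smooth_flat_coordinate[unfolded smooth_def, THEN spec]) simp
  then show ?thesis by (simp add: smooth_def)
qed

lemma bump_tendsto: "(\<lambda>N. bump a b N x) \<longlonglongrightarrow> indicator (box a b) x"
proof (cases "x \<in> box a b")
  case False
  then show ?thesis by (simp add: bump_eq_0)
next
  case True
  have lim: "(\<lambda>N. flat 1 (real (Suc N) * t)) \<longlonglongrightarrow> 1" if "t > 0" for t :: real
  proof -
    have "filterlim (\<lambda>N. real (Suc N) * t) at_top sequentially"
      by (intro filterlim_at_top_mult_tendsto_pos[OF tendsto_const that]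
          filterlim_compose[OF filterlim_real_sequentially filterlim_Suc])
    from real_tendsto_divide_at_top[OF tendsto_const[of 1] this]
    have "(\<lambda>N. exp (- (1 / (real (Suc N) * t)))) \<longlonglongrightarrow> exp (- 0)" by (intro tendsto_intros)
    then show ?thesis using that by (simp add: flat_def)
  qed
  have "(\<lambda>N. bump a b N x) \<longlonglongrightarrow> (\<Prod>i\<in>(UNIV :: 'a set). 1 * 1)"
    unfolding bump_def using True by (intro tendsto_prod tendsto_mult lim) (auto simp: mem_box_cart)
  with True show ?thesis by simp
qed

lemma bump_test_function:
  assumes "cbox a b \<subseteq> S" shows "bump a b N \<in> test_functions S"
proof -
  have "{x. bump a b N x \<noteq> 0} \<subseteq> cbox a b" using bump_eq_0[of _ a b N] box_subset_cbox by blast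
  then have sub: "closure {x. bump a b N x \<noteq> 0} \<subseteq> cbox a b" by (rule closure_minimal) (rule closed_cbox)
  then have "compact (closure {x. bump a b N x \<noteq> 0})"
    using compact_Int_closed[OF compact_cbox closed_closure, of a b "{x. bump a b N x \<noteq> 0}"]
    by (simp add: Int_absorb1)
  with sub assms show ?thesis by (auto simp: test_functions_def smooth_bump)
qed

lemma fundamental_lemma_box:
  fixes v :: "real^'n \<Rightarrow> real"
  assumes S: "open S" "bounded S" and v: "sq_int (lebesgue_on S) v"
    and zero: "\<And>\<phi>. \<phi> \<in> test_functions S \<Longrightarrow> (LINT x|lebesgue_on S. v x * \<phi> x) = 0"
    and cb: "cbox c d \<subseteq> S"
  shows "(LINT x|lebesgue_on S. v x * indicator (box c d) x) = 0"
proof -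
  have iv: "integrable (lebesgue_on S) v" by (rule sq_int_integrable[OF open_bounded_lebesgue(2,3)[OF S] v])
  have "(\<lambda>N. LINT x|lebesgue_on S. v x * bump c d N x) \<longlonglongrightarrow> (LINT x|lebesgue_on S. v x * indicator (box c d) x)"
  proof (rule integral_dominated_convergence[where w="\<lambda>x. \<bar>v x\<bar>"])
    have [measurable]: "v \<in> borel_measurable (lebesgue_on S)" using v by (simp add: sq_int_def)
    have "indicator (box c d) \<in> borel_measurable (lebesgue_on S)"
      by (intro borel_measurable_lebesgue_on) simp
    then show "(\<lambda>x. v x * indicator (box c d) x) \<in> borel_measurable (lebesgue_on S)" by measurable
    have "bump c d N \<in> borel_measurable (lebesgue_on S)" for N
      by (intro borel_measurable_lebesgue_on borel_measurable_continuous_onI smooth_imp_continuous smooth_bump)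
    then show "(\<lambda>x. v x * bump c d N x) \<in> borel_measurable (lebesgue_on S)" for N by measurable
    show "AE x in lebesgue_on S. (\<lambda>N. v x * bump c d N x) \<longlonglongrightarrow> v x * indicator (box c d) x"
      by (intro AE_I2 tendsto_intros bump_tendsto)
    show "AE x in lebesgue_on S. norm (v x * bump c d N x) \<le> \<bar>v x\<bar>" for N
      by (intro AE_I2) (auto simp: abs_mult bump_bounds intro!: mult_right_le_one_le)
  qed (use iv in auto)
  moreover have "(LINT x|lebesgue_on S. v x * bump c d N x) = 0" for N
    by (rule zero[OF bump_test_function[OF cb]])
  ultimately show ?thesis by (simp add: LIMSEQ_const_iff)
qed

text \<open>
On a box compactly contained in \<open>S\<close> the functional \<open>\<Phi> \<mapsto> \<integral> v \<Phi>\<close> vanishes on indicators of subboxes. By the density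
result above, applied to the constant sequence \<open>0\<close>, it vanishes on everything. The periodic
variable is frozen at \<open>0\<close>.
\<close>

theorem fundamental_lemma_calculus_of_variations:
  fixes v :: "real^'n \<Rightarrow> real"
  assumes S: "open S" "bounded S" and v: "sq_int (lebesgue_on S) v"
    and zero: "\<And>\<phi>. \<phi> \<in> test_functions S \<Longrightarrow> (LINT x|lebesgue_on S. v x * \<phi> x) = 0"
  shows "AE x in lebesgue_on S. v x = 0"
proof -
  have SL: "S \<in> sets lebesgue" by (rule open_bounded_lebesgue[OF S])
  have vm: "v \<in> borel_measurable (lebesgue_on S)" using v by (simp add: sq_int_def)
  have box: "AE x in lebesgue. x \<in> box a b \<longrightarrow> v x = 0" if ab: "cbox a b \<subseteq> S" for a b
  proof -
    let ?Q = "box a b"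
    have QS: "?Q \<subseteq> S" using ab box_subset_cbox by blast
    have QL: "?Q \<in> sets lebesgue" by (intro sets_completionI_sets) simp
    have finQ: "emeasure lebesgue ?Q < \<infinity>" by (simp add: emeasure_lborel_box_eq)
    have vQ: "sq_int (lebesgue_on ?Q) v"
    proof -
      have "v \<in> borel_measurable (lebesgue_on ?Q)" by (rule measurable_restrict_mono[OF vm QS])
      moreover have "integrable (lebesgue_on ?Q) (\<lambda>x. (v x)\<^sup>2)"
        using v set_integrable_subset[OF _ QL QS, of "\<lambda>x. (v x)\<^sup>2"] QL SL
        by (simp add: sq_int_def integrable_restrict_space set_integrable_def)
      ultimately show ?thesis by (simp add: sq_int_def)
    qed
    let ?G = "\<lambda>\<Phi>. LINT x|lebesgue_on ?Q. v x * apply_bcontfun (\<Phi> x :: (real^'n) \<Rightarrow>\<^sub>C real) 0"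
    note pair = L2_C_per_pairing[OF QL QL measurable_ident[unfolded id_def] distr_id borel_measurable_const vQ]
    interpret bounded_functionals ?Q "\<lambda>_ _. 0" ?G "sqrt (LINT x|lebesgue_on ?Q. (v x)\<^sup>2)"
    proof
      fix \<Phi> :: "real^'n \<Rightarrow> ((real^'n) \<Rightarrow>\<^sub>C real)" assume \<Phi>: "\<Phi> \<in> L2_C_per ?Q"
      show "\<bar>?G \<Phi>\<bar> \<le> sqrt (LINT x|lebesgue_on ?Q. (v x)\<^sup>2) * L2C_norm ?Q \<Phi>" by (rule pair(2)[OF \<Phi>])
    qed (use QL finQ pair(1) in \<open>auto simp: L2C_norm_def\<close>)
    let ?\<B> = "insert UNIV (range (\<lambda>(c, d). box c d)) :: (real^'n) set set"
    have "converges \<Phi>" if \<Phi>: "\<Phi> \<in> L2_C_per ?Q" for \<Phi> :: "real^'n \<Rightarrow> ((real^'n) \<Rightarrow>\<^sub>C real)"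
    proof (rule converges_if_generators[OF _ _ _ _ \<Phi>])
      show "Int_stable ?\<B>" by (auto simp: Int_stable_def box_Int_box)
      show "sets borel = sigma_sets UNIV ?\<B>"
      proof -
        have 1: "sets borel = sigma_sets UNIV (range (\<lambda>(c, d). box c d) :: (real^'n) set set)"
          by (subst borel_eq_box) simp
        also have "\<dots> = sigma_sets UNIV ?\<B>"
          by (rule sigma_sets_eqI) (auto intro: sigma_sets_top)
        finally show ?thesis .
      qed
      fix B and k :: "real^'n" and j assume B: "B \<in> ?\<B>" and k: "integer_vec k"
      note bc = Bcontfun_trig_poly[OF trig_poly.trig[OF k], of j]
      obtain c d where cd: "?Q \<inter> B = box c d"
      proof (cases "B = UNIV")
        case True
        then show ?thesis using that[of a b] by simp
      next
        case False
        then obtain c' d' where "B = box c' d'" using B by auto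
        then show ?thesis using that[OF box_Int_box[of a b c' d', folded \<open>B = box c' d'\<close>]] by blast
      qed
      have "cbox c d \<subseteq> S \<or> box c d = {}"
      proof (cases "box c d = {}")
        case False
        have "closure (box c d) \<subseteq> closure ?Q" using cd by (intro closure_mono) auto
        also have "\<dots> \<subseteq> cbox a b" by (rule closure_minimal) (auto intro: box_subset_cbox[THEN subsetD])
        finally show ?thesis using ab False by (auto simp: closure_box)
      qed simp
      then have "(LINT x|lebesgue_on S. v x * indicator (box c d) x) = 0"
        using fundamental_lemma_box[OF assms(1,2) v zero] by fastforce
      then have "(LINT x|lebesgue_on ?Q. v x * indicator B x) = 0"
        unfolding integral_lebesgue_on_subset[OF SL QL QS] cd[symmetric] by (simp add: indicator_inter_arith mult_ac)
      then have "?G (\<lambda>x. indicator B x *\<^sub>R Bcontfun (trig k j)) = 0"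
        by (simp add: bc(1) mult.assoc[symmetric])
      moreover have "B \<in> sets lebesgue" using B by (intro sets_completionI_sets) auto
      ultimately show "converges (\<lambda>x. indicator B x *\<^sub>R Bcontfun (trig k j))"
        unfolding converges_def using L2_C_per_indicator bc(2) by simp
    qed simp
    then have G0: "?G \<Phi> = 0" if "\<Phi> \<in> L2_C_per ?Q" for \<Phi>
      using that by (simp add: converges_def LIMSEQ_const_iff)
    have one: "trig_poly (\<lambda>y::real^'n. 1)" by (rule trig_poly_const)
    \<comment> \<open>\<open>v\<close> itself is admissible as a test function, which makes \<open>\<integral> v\<^sup>2\<close> vanish.\<close>
    from G0[OF L2_C_per_tensor[OF vQ Bcontfun_trig_poly(2)[OF one]]]
    have "(LINT x|lebesgue_on ?Q. (v x)\<^sup>2) = 0" by (simp add: Bcontfun_trig_poly(1)[OF one] power2_eq_square)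
    then have "AE x in lebesgue_on ?Q. (v x)\<^sup>2 = 0"
      using vQ by (subst (asm) integral_nonneg_eq_0_iff_AE) (auto simp: sq_int_def)
    then show ?thesis using QL by (subst (asm) AE_restrict_space_iff) auto
  qed
  obtain \<D> where \<D>: "countable \<D>" "\<And>X. X \<in> \<D> \<Longrightarrow> \<exists>a b. X = box a b \<and> cbox a b \<subseteq> S" "S = \<Union>\<D>"
  proof -
    let ?\<D> = "{X. \<exists>a b. X = box a b \<and> cbox a b \<subseteq> S}"
    have "S = \<Union>?\<D>"
    proof
      show "S \<subseteq> \<Union>?\<D>"
      proof
        fix x assume "x \<in> S"
        then obtain a b where "x \<in> box a b" "cbox a b \<subseteq> S"
          by (rule open_contains_cbox[OF S(1)])
        then show "x \<in> \<Union>?\<D>" by blast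
      qed
      show "\<Union>?\<D> \<subseteq> S" using box_subset_cbox by blast
    qed
    have "open X" if "X \<in> ?\<D>" for X using that by auto
    from Lindelof[OF this] obtain \<D>' where \<D>': "\<D>' \<subseteq> ?\<D>" "countable \<D>'" "\<Union>\<D>' = \<Union>?\<D>" .
    show ?thesis
    proof (rule that[OF \<D>'(2)])
      show "\<exists>a b. X = box a b \<and> cbox a b \<subseteq> S" if "X \<in> \<D>'" for X using subsetD[OF \<D>'(1) that] by simp
      show "S = \<Union>\<D>'" unfolding \<D>'(3) by (rule \<open>S = \<Union>?\<D>\<close>)
    qed
  qed
  have "AE x in lebesgue. \<forall>X\<in>\<D>. x \<in> X \<longrightarrow> v x = 0"
  proof (rule AE_ball_countable'[OF _ \<D>(1)])
    fix X assume "X \<in> \<D>"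
    then obtain a b where "X = box a b" "cbox a b \<subseteq> S" using \<D>(2) by blast
    with box[of a b] show "AE x in lebesgue. x \<in> X \<longrightarrow> v x = 0" by simp
  qed
  then have "AE x in lebesgue. x \<in> S \<longrightarrow> v x = 0"
    by (rule AE_mp[OF _ AE_I2]) (simp add: \<D>(3))
  then show ?thesis using SL by (subst AE_restrict_space_iff) auto
qed

section \<open>A countable family of periodic test functions\<close>

lemma grad_periodic:
  fixes w :: "real^'m \<Rightarrow> real"
  assumes w: "smooth w" "periodic w"
  shows "periodic (grad w)"
  unfolding periodic_def
proof (intro allI impI)
  fix k y :: "real^'m" assume k: "integer_vec k"
  have "((\<lambda>y. w (y + k)) has_derivative (\<lambda>v. grad w (y + k) \<bullet> v)) (at y)"
    by (rule has_derivative_compose[where f="\<lambda>y. y + k" and f'="\<lambda>v. v", OF _ has_derivative_grad[OF smooth_imp_differentiable[OF w(1)]]])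
      (auto intro!: derivative_eq_intros)
  moreover have "(\<lambda>y. w (y + k)) = w" using w(2) k by (auto simp: periodic_def)
  ultimately show "grad w (y + k) = grad w y" by (intro grad_eqI[symmetric]) simp
qed

lemma periodic_transpose_grad:
  fixes w :: "real^'m \<Rightarrow> real" and R :: "real^'n^'m"
  assumes "smooth w" "periodic w"
  shows "continuous_on UNIV (\<lambda>y. (transpose R *v grad w y) $ i)" "periodic (\<lambda>y. (transpose R *v grad w y) $ i)"
proof -
  have "continuous_on UNIV (\<lambda>y. grad w y $ j)" for j
    by (rule smooth_imp_continuous[OF smooth_grad[OF assms(1)]])
  then show "continuous_on UNIV (\<lambda>y. (transpose R *v grad w y) $ i)"
    by (auto simp: matrix_vector_mult_def intro!: continuous_on_sum continuous_on_mult continuous_on_const)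
  show "periodic (\<lambda>y. (transpose R *v grad w y) $ i)"
    using grad_periodic[OF assms] by (simp add: periodic_def)
qed

text \<open>
Trigonometric polynomials with rational coefficients, indexed by a countable type.
\<close>

primrec rational_trig :: "(rat \<times> (int^'m) \<times> int) list \<Rightarrow> real^'m \<Rightarrow> real" where
  "rational_trig [] y = 0"
| "rational_trig (c # cs) y = of_rat (fst c) * trig (\<chi> i. of_int (fst (snd c) $ i)) (snd (snd c)) y + rational_trig cs y"

lemma rational_trig_append: "rational_trig (cs @ ds) y = rational_trig cs y + rational_trig ds y"
  by (induction cs) auto

lemma rational_trig_scale: "rational_trig (map (\<lambda>c. (q * fst c, snd c)) cs) y = of_rat q * rational_trig cs y"
  by (induction cs) (auto simp: algebra_simps of_rat_mult)

lemma rational_trig_bounded: "\<exists>K>0. \<forall>y. \<bar>rational_trig cs y\<bar> \<le> K"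
proof (induction cs)
  case Nil
  then show ?case by (auto intro: exI[of _ 1])
next
  case (Cons c cs)
  then obtain K where K: "K > 0" "\<forall>y. \<bar>rational_trig cs y\<bar> \<le> K" by blast
  have "\<bar>rational_trig (c # cs) y\<bar> \<le> \<bar>of_rat (fst c)\<bar> + K" for y
  proof -
    have "\<bar>of_rat (fst c) * trig (\<chi> i. of_int (fst (snd c) $ i)) (snd (snd c)) y\<bar> \<le> \<bar>of_rat (fst c)\<bar>"
      unfolding abs_mult by (intro mult_right_le_one_le abs_trig_le) auto
    then show ?thesis using K(2)[rule_format, of y] by simp
  qed
  with K(1) show ?case by (intro exI[of _ "\<bar>of_rat (fst c)\<bar> + K"]) (auto intro: add_nonneg_pos)
qed

lemma rational_trig_dense_trig_poly:
  assumes "trig_poly f"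
  shows "\<forall>e>0. \<exists>cs. \<forall>y. \<bar>f y - rational_trig cs y\<bar> < e"
  using assms
proof induction
  case (trig k j)
  have "\<forall>i. \<exists>n::int. k $ i = of_int n" using \<open>integer_vec k\<close> by (auto simp: integer_vec_def elim!: Ints_cases)
  then obtain l where "\<And>i. k $ i = of_int (l i)" by metis
  then have "(\<chi> i. of_int ((\<chi> i. l i) $ i)) = k" by (simp add: vec_eq_iff)
  then have "rational_trig [(1, \<chi> i. l i, j)] y = trig k j y" for y by simp
  then show ?case by (intro allI impI exI[of _ "[(1, \<chi> i. l i, j)]"]) simp
next
  case (add f g)
  show ?case
  proof (intro allI impI)
    fix e :: real assume "e > 0"
    then have "e / 2 > 0" by simp
    with add(3,4) obtain cs ds where cs: "\<forall>y. \<bar>f y - rational_trig cs y\<bar> < e / 2"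
        and ds: "\<forall>y. \<bar>g y - rational_trig ds y\<bar> < e / 2"
      by meson
    have "\<bar>f y + g y - rational_trig (cs @ ds) y\<bar> < e" for y
      using cs[rule_format, of y] ds[rule_format, of y] unfolding rational_trig_append by linarith
    then show "\<exists>cs. \<forall>y. \<bar>f y + g y - rational_trig cs y\<bar> < e" by blast
  qed
next
  case (scale f c)
  show ?case
  proof (intro allI impI)
    fix e :: real assume "e > 0"
    define d where "d = e / (2 * (\<bar>c\<bar> + 1))"
    have c1: "\<bar>c\<bar> + 1 > 0" by linarith
    have d: "d > 0" using \<open>e > 0\<close> c1 by (simp add: d_def)
    have cd: "\<bar>c\<bar> * d < e / 2"
    proof -
      have "\<bar>c\<bar> * d < (\<bar>c\<bar> + 1) * d" using d by simp
      also have "\<dots> = e / 2"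
      proof -
        have "k * (e / (2 * k)) = e / 2" if "k > 0" for k :: real using that by simp
        from this[OF c1] show ?thesis by (simp only: d_def)
      qed
      finally show ?thesis .
    qed
    obtain cs where cs: "\<forall>y. \<bar>f y - rational_trig cs y\<bar> < d" using scale(2) d by blast
    obtain K where K: "K > 0" "\<forall>y. \<bar>rational_trig cs y\<bar> \<le> K" using rational_trig_bounded by blast
    obtain q where q: "c < of_rat q" "of_rat q < c + e / (2 * K)"
      using of_rat_dense[of c "c + e / (2 * K)"] \<open>e > 0\<close> K(1) by auto
    have "\<bar>c * f y - rational_trig (map (\<lambda>c. (q * fst c, snd c)) cs) y\<bar> < e" for y
    proof -
      have "c * f y - of_rat q * rational_trig cs y = c * (f y - rational_trig cs y) + (c - of_rat q) * rational_trig cs y"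
        by (simp add: algebra_simps)
      also have "\<bar>\<dots>\<bar> \<le> \<bar>c\<bar> * \<bar>f y - rational_trig cs y\<bar> + \<bar>c - of_rat q\<bar> * \<bar>rational_trig cs y\<bar>"
        by (metis abs_mult abs_triangle_ineq)
      also have "\<dots> \<le> \<bar>c\<bar> * d + (e / (2 * K)) * K"
        using cs[rule_format, of y] K(2)[rule_format, of y] q K(1) \<open>e > 0\<close>
        by (intro add_mono mult_mono) auto
      also have "\<dots> < e" using cd K(1) by simp
      finally show ?thesis unfolding rational_trig_scale .
    qed
    then show "\<exists>cs. \<forall>y. \<bar>c * f y - rational_trig cs y\<bar> < e" by blast
  qed
qed

lemma rational_trig_dense:
  fixes g :: "real^'m \<Rightarrow> real"
  assumes "continuous_on UNIV g" "periodic g" "e > 0"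
  obtains cs where "\<And>y. \<bar>g y - rational_trig cs y\<bar> < e"
proof -
  obtain f where f: "trig_poly f" "\<And>y. \<bar>g y - f y\<bar> < e / 2"
    using trig_poly_dense[OF assms(1,2), of "e/2"] assms(3) by auto
  obtain cs where cs: "\<And>y. \<bar>f y - rational_trig cs y\<bar> < e / 2"
    using rational_trig_dense_trig_poly[OF f(1)] assms(3) by (meson half_gt_zero)
  have "\<bar>g y - rational_trig cs y\<bar> < e" for y using f(2)[of y] cs[of y] by linarith
  then show ?thesis by (rule that)
qed

text \<open>
A subset of a separable metric space is separable; here the subset consists of the gradients of periodic test functions,
measured in the uniform norm.
\<close>

lemma countable_gradient_dense_test_functions:
  obtains W :: "(real^'m \<Rightarrow> real) set" where "countable W" "W \<subseteq> periodic_test_functions"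
    "\<And>w e. w \<in> periodic_test_functions \<Longrightarrow> e > 0 \<Longrightarrow> \<exists>w'\<in>W. \<forall>y i. \<bar>grad w y $ i - grad w' y $ i\<bar> < e"
proof -
  define P where "P L N w \<longleftrightarrow> w \<in> periodic_test_functions \<and>
      (\<forall>y i. \<bar>grad w y $ i - rational_trig (L i) y\<bar> < 1 / real (Suc N))"
    for L :: "'m \<Rightarrow> (rat \<times> (int^'m) \<times> int) list" and N :: nat and w :: "real^'m \<Rightarrow> real"
  \<comment> \<open>One test function is picked for every rational trigonometric approximation that some gradient admits.\<close>
  define W where "W = (\<lambda>(L, N). SOME w. P L N w) ` {(L, N). \<exists>w. P L N w}"
  have some: "P L N (SOME w. P L N w)" if "P L N w" for L N w using that by (rule someI[of "P L N"])
  show ?thesis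
  proof
    show "countable W" unfolding W_def by (intro countable_image countableI_type)
    show "W \<subseteq> periodic_test_functions" using some by (auto simp: W_def P_def)
    fix w :: "real^'m \<Rightarrow> real" and e :: real assume w: "w \<in> periodic_test_functions" and e: "e > 0"
    obtain N where N: "1 / real (Suc N) < e / 2" using nat_approx_posE[of "e/2"] e by auto
    have w': "smooth w" "periodic w" using w by (auto simp: periodic_test_functions_def)
    have "\<exists>cs. \<forall>y. \<bar>grad w y $ i - rational_trig cs y\<bar> < 1 / real (Suc N)" for i
    proof -
      have "periodic (\<lambda>y. grad w y $ i)" using grad_periodic[OF w'] by (simp add: periodic_def)
      from rational_trig_dense[OF smooth_imp_continuous[OF smooth_grad[OF w'(1)]] this, of "1 / real (Suc N)"]
      show ?thesis by (metis of_nat_0_less_iff zero_less_Suc zero_less_divide_1_iff)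
    qed
    then obtain L where L: "\<And>i y. \<bar>grad w y $ i - rational_trig (L i) y\<bar> < 1 / real (Suc N)" by metis
    then have Pw: "P L N w" using w by (simp add: P_def)
    let ?w = "SOME w. P L N w"
    have "?w \<in> W" unfolding W_def using Pw by (intro image_eqI[of _ _ "(L, N)"]) auto
    moreover have "\<bar>grad w y $ i - grad ?w y $ i\<bar> < e" for y i
    proof -
      have "\<bar>grad ?w y $ i - rational_trig (L i) y\<bar> < 1 / real (Suc N)" using some[OF Pw] by (simp add: P_def)
      then show ?thesis using L[where i=i and y=y] N by linarith
    qed
    ultimately show "\<exists>w'\<in>W. \<forall>y i. \<bar>grad w y $ i - grad w' y $ i\<bar> < e" by blast
  qed
qed

section \<open>The divergence of two-scale limits\<close>

lemma continuous_grad_test_function: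
  assumes "\<phi> \<in> test_functions S" shows "continuous_on UNIV (\<lambda>x. grad \<phi> x $ i)"
  using assms by (auto simp: test_functions_def intro!: smooth_imp_continuous smooth_grad)

lemma L2_C_per_continuous_tensor:
  fixes f :: "real^'n \<Rightarrow> real" and g :: "real^'m \<Rightarrow> real"
  assumes S: "open S" "bounded S" and "continuous_on UNIV f" "continuous_on UNIV g" "periodic g"
  shows "(\<lambda>x. f x *\<^sub>R Bcontfun g) \<in> L2_C_per S" "apply_bcontfun (f x *\<^sub>R Bcontfun g) y = f x * g y"
  using apply_Bcontfun_periodic[OF assms(4,5)] continuous_sq_int[OF S assms(3)]
  by (auto intro: L2_C_per_tensor)

lemma inner_integral_componentwise:
  fixes v g :: "'a::euclidean_space \<Rightarrow> real^'n"
  assumes "\<And>i. sq_int (lebesgue_on T) (\<lambda>z. v z $ i)" "\<And>i. sq_int (lebesgue_on T) (\<lambda>z. g z $ i)"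
  shows "(LINT z|lebesgue_on T. v z \<bullet> g z) = (\<Sum>i\<in>UNIV. LINT z|lebesgue_on T. v z $ i * g z $ i)"
    and "integrable (lebesgue_on T) (\<lambda>z. v z \<bullet> g z)"
  using sq_int_mult[OF assms] by (simp_all add: inner_vec_def)

text \<open>
The factor \<open>c\<close> will be \<open>\<eta>\<close> and \<open>A\<close> will be \<open>R/\<eta>\<close>, so that the first gradient term is of order one and the second
of order \<open>\<eta>\<close>.
\<close>

lemma oscillating_test_function:
  fixes w :: "real^'m \<Rightarrow> real" and \<phi> :: "real^'n \<Rightarrow> real" and A :: "real^'n^'m"
  assumes \<phi>: "\<phi> \<in> test_functions S" and w: "smooth w"
  shows "(\<lambda>x. c * (\<phi> x * w (A *v x))) \<in> test_functions S"
    and "grad (\<lambda>x. c * (\<phi> x * w (A *v x))) x =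
      (c * \<phi> x) *\<^sub>R (transpose A *v grad w (A *v x)) + (c * w (A *v x)) *\<^sub>R grad \<phi> x"
proof -
  have sm: "smooth \<phi>" "smooth (\<lambda>x. w (A *v x))"
    using \<phi> smooth_compose_linear[OF w] by (auto simp: test_functions_def)
  let ?\<psi> = "\<lambda>x. c * (\<phi> x * w (A *v x))"
  have "closure {x. ?\<psi> x \<noteq> 0} \<subseteq> closure {x. \<phi> x \<noteq> 0}" by (rule closure_mono) auto
  moreover from this have "compact (closure {x. ?\<psi> x \<noteq> 0})"
    using compact_Int_closed[of "closure {x. \<phi> x \<noteq> 0}" "closure {x. ?\<psi> x \<noteq> 0}"] \<phi>
    by (simp add: test_functions_def Int_absorb1)
  ultimately show "?\<psi> \<in> test_functions S"
    using \<phi> smooth_mult[OF smooth_const[of c] smooth_mult[OF sm]] by (auto simp: test_functions_def)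
  note d = sm[THEN smooth_imp_differentiable]
  have "grad ?\<psi> x = c *\<^sub>R grad (\<lambda>x. \<phi> x * w (A *v x)) x"
    using grad_mult[of "\<lambda>x. c" x "\<lambda>x. \<phi> x * w (A *v x)"] smooth_imp_differentiable[OF smooth_mult[OF sm]]
    by (simp add: grad_const)
  also have "\<dots> = c *\<^sub>R (\<phi> x *\<^sub>R (transpose A *v grad w (A *v x)) + w (A *v x) *\<^sub>R grad \<phi> x)"
    by (simp add: grad_mult[OF d] grad_compose_linear(2)[OF smooth_imp_differentiable[OF w]])
  finally show "grad ?\<psi> x = (c * \<phi> x) *\<^sub>R (transpose A *v grad w (A *v x)) + (c * w (A *v x)) *\<^sub>R grad \<phi> x"
    by (simp add: scaleR_add_right)
qed

context oscillation begin

lemma weak_two_scale_tensor: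
  assumes "weak_two_scale_converges S R \<eta> v w" "open S" "bounded S"
    "continuous_on UNIV f" "continuous_on UNIV g" "periodic g"
  shows "(\<lambda>n. LINT x|lebesgue_on S. v n x * (f x * g (fast n x))) \<longlonglongrightarrow>
    (LINT z|lebesgue_on (S \<times> unit_cell). w z * (f (fst z) * g (snd z)))"
proof -
  note T = L2_C_per_continuous_tensor[OF assms(2-6)]
  from assms(1) have "\<forall>\<Phi>\<in>L2_C_per S. (\<lambda>n. LINT x|lebesgue_on S. v n x * apply_bcontfun (\<Phi> x) (fast n x)) \<longlonglongrightarrow>
      (LINT z|lebesgue_on (S \<times> unit_cell). w z * apply_bcontfun (\<Phi> (fst z)) (snd z))"
    unfolding weak_two_scale_converges_iff by blast
  from bspec[OF this T(1)] show ?thesis unfolding T(2) .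
qed

text \<open>
Testing with \<open>\<eta> \<phi>(x) w(R x / \<eta>)\<close>: the term of order one converges to the claimed expression, and the other term is
\<open>\<eta>\<close> times a convergent sequence.
\<close>

lemma two_scale_limit_oscillating_divergence:
  fixes u0 :: "(real^'n) \<times> (real^'m) \<Rightarrow> real^'n"
  assumes S: "open S" "bounded S"
    and conv: "\<And>i. weak_two_scale_converges S R \<eta> (\<lambda>n x. u n x $ i) (\<lambda>z. u0 z $ i)"
    and div: "\<And>n. div_free_on S (u n)"
    and \<phi>: "\<phi> \<in> test_functions S" and w: "smooth w" "periodic w"
  shows "(\<Sum>i\<in>UNIV. LINT z|lebesgue_on (S \<times> unit_cell). u0 z $ i * (\<phi> (fst z) * (transpose R *v grad w (snd z)) $ i)) = 0"
proof -
  have ui: "sq_int (lebesgue_on S) (\<lambda>x. u n x $ i)" for n i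
    using conv[of i] by (simp add: weak_two_scale_converges_iff L2_on_real_iff)
  have \<phi>c: "continuous_on UNIV \<phi>" using \<phi> by (auto simp: test_functions_def intro: smooth_imp_continuous)
  have \<phi>ic: "continuous_on UNIV (\<lambda>x. grad \<phi> x $ i)" for i by (rule continuous_grad_test_function[OF \<phi>])
  have wc: "continuous_on UNIV w" by (rule smooth_imp_continuous[OF w(1)])
  let ?d = "\<lambda>i y. (transpose R *v grad w y) $ i"
  have dc: "continuous_on UNIV (?d i)" "periodic (?d i)" for i using periodic_transpose_grad[OF w] by auto
  let ?F = "\<lambda>n i. LINT x|lebesgue_on S. u n x $ i * (\<phi> x * ?d i (fast n x))"
  let ?G = "\<lambda>n i. LINT x|lebesgue_on S. u n x $ i * (grad \<phi> x $ i * w (fast n x))"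
  have F: "(\<lambda>n. ?F n i) \<longlonglongrightarrow> (LINT z|lebesgue_on (S \<times> unit_cell). u0 z $ i * (\<phi> (fst z) * ?d i (snd z)))" for i
    by (rule weak_two_scale_tensor[OF conv S \<phi>c dc])
  have G: "(\<lambda>n. ?G n i) \<longlonglongrightarrow> (LINT z|lebesgue_on (S \<times> unit_cell). u0 z $ i * (grad \<phi> (fst z) $ i * w (snd z)))" for i
    by (rule weak_two_scale_tensor[OF conv S \<phi>ic wc w(2)])
  have eq: "(\<Sum>i\<in>UNIV. ?F n i) = - (\<eta> n * (\<Sum>i\<in>UNIV. ?G n i))" for n
  proof -
    let ?A = "(1 / \<eta> n) *\<^sub>R R"
    have A: "?A *v x = fast n x" for x by (simp add: fast_def scaleR_matrix_vector_assoc)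
    have tA: "transpose ?A *v v = (1 / \<eta> n) *\<^sub>R (transpose R *v v)" for v
      by (simp only: transpose_scalar scaleR_matrix_vector_assoc)
    let ?\<psi> = "\<lambda>x. \<eta> n * (\<phi> x * w (?A *v x))"
    have "?\<psi> \<in> test_functions S" by (rule oscillating_test_function(1)[OF \<phi> w(1)])
    with div[of n] have "(LINT x|lebesgue_on S. u n x \<bullet> grad ?\<psi> x) = 0"
      unfolding div_free_on_def distr_div_def by fastforce
    moreover have gr: "grad ?\<psi> x $ i = \<phi> x * ?d i (fast n x) + \<eta> n * (grad \<phi> x $ i * w (fast n x))" for x i
      by (subst oscillating_test_function(2)[OF \<phi> w(1)], unfold A tA, use eta_pos[of n] in simp)
    have sq1: "sq_int (lebesgue_on S) (\<lambda>x. \<phi> x * ?d i (fast n x))"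
      and sq2: "sq_int (lebesgue_on S) (\<lambda>x. grad \<phi> x $ i * w (fast n x))" for i
      by (intro continuous_sq_int[OF S] continuous_on_mult \<phi>c \<phi>ic continuous_on_compose2[OF dc(1) continuous_fast]
          continuous_on_compose2[OF wc continuous_fast]; simp)+
    have "(LINT x|lebesgue_on S. u n x \<bullet> grad ?\<psi> x) =
      (\<Sum>i\<in>UNIV. LINT x|lebesgue_on S. u n x $ i * grad ?\<psi> x $ i)"
      by (rule inner_integral_componentwise(1)[OF ui]) (unfold gr, intro sq_int_add sq_int_scale sq1 sq2)
    also have "\<dots> = (\<Sum>i\<in>UNIV. ?F n i + \<eta> n * ?G n i)"
    proof (rule sum.cong[OF refl])
      fix i
      have "(LINT x|lebesgue_on S. u n x $ i * grad ?\<psi> x $ i) =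
        (LINT x|lebesgue_on S. u n x $ i * (\<phi> x * ?d i (fast n x)) + \<eta> n * (u n x $ i * (grad \<phi> x $ i * w (fast n x))))"
        unfolding gr by (rule Bochner_Integration.integral_cong) (auto simp: algebra_simps)
      also have "\<dots> = ?F n i + \<eta> n * ?G n i"
        using sq_int_mult[OF ui sq1, of n i i] sq_int_mult[OF ui sq2, of n i i] by simp
      finally show "(LINT x|lebesgue_on S. u n x $ i * grad ?\<psi> x $ i) = ?F n i + \<eta> n * ?G n i" .
    qed
    ultimately show ?thesis by (simp add: sum.distrib sum_distrib_left)
  qed
  have "(\<lambda>n. - (\<eta> n * (\<Sum>i\<in>UNIV. ?G n i))) \<longlonglongrightarrow>
     - (0 * (\<Sum>i\<in>UNIV. LINT z|lebesgue_on (S \<times> unit_cell). u0 z $ i * (grad \<phi> (fst z) $ i * w (snd z))))"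
    by (intro tendsto_intros eta_lim G)
  moreover have "(\<lambda>n. \<Sum>i\<in>UNIV. ?F n i) \<longlonglongrightarrow> (\<Sum>i\<in>UNIV. LINT z|lebesgue_on (S \<times> unit_cell). u0 z $ i * (\<phi> (fst z) * ?d i (snd z)))"
    by (intro tendsto_intros F)
  ultimately show ?thesis unfolding eq by (simp add: LIMSEQ_unique)
qed

lemma two_scale_limit_mean_divergence:
  fixes u0 :: "(real^'n) \<times> (real^'m) \<Rightarrow> real^'n"
  assumes S: "open S" "bounded S"
    and conv: "\<And>i. weak_two_scale_converges S R \<eta> (\<lambda>n x. u n x $ i) (\<lambda>z. u0 z $ i)"
    and div: "\<And>n. div_free_on S (u n)" and \<phi>: "\<phi> \<in> test_functions S"
  shows "(\<Sum>i\<in>UNIV. LINT z|lebesgue_on (S \<times> unit_cell). u0 z $ i * grad \<phi> (fst z) $ i) = 0"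
proof -
  have ui: "sq_int (lebesgue_on S) (\<lambda>x. u n x $ i)" for n i
    using conv[of i] by (simp add: weak_two_scale_converges_iff L2_on_real_iff)
  have \<phi>ic: "continuous_on UNIV (\<lambda>x. grad \<phi> x $ i)" for i by (rule continuous_grad_test_function[OF \<phi>])
  have "(\<lambda>n. LINT x|lebesgue_on S. u n x $ i * grad \<phi> x $ i) \<longlonglongrightarrow> (LINT z|lebesgue_on (S \<times> unit_cell). u0 z $ i * grad \<phi> (fst z) $ i)" for i
    using weak_two_scale_tensor[OF conv[of i] S \<phi>ic[of i], of "\<lambda>_. 1"] by (simp add: periodic_def)
  then have "(\<lambda>n. \<Sum>i\<in>UNIV. LINT x|lebesgue_on S. u n x $ i * grad \<phi> x $ i) \<longlonglongrightarrow>
      (\<Sum>i\<in>UNIV. LINT z|lebesgue_on (S \<times> unit_cell). u0 z $ i * grad \<phi> (fst z) $ i)"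
    by (intro tendsto_intros)
  moreover have "(\<Sum>i\<in>UNIV. LINT x|lebesgue_on S. u n x $ i * grad \<phi> x $ i) = 0" for n
    using div[of n] \<phi> inner_integral_componentwise(1)[of S "u n" "grad \<phi>", OF ui continuous_sq_int[OF S \<phi>ic]]
    by (simp add: div_free_on_def distr_div_def)
  ultimately show ?thesis by (simp add: LIMSEQ_const_iff)
qed

end

text \<open>
For fixed \<open>v\<close> the functional \<open>w \<mapsto> div\<^sub>R v (w)\<close> depends continuously on \<open>\<nabla>w\<close> in the uniform norm.
\<close>

lemma cell_divergence_dense:
  fixes v :: "real^'m \<Rightarrow> real^'n" and R :: "real^'n^'m"
  assumes v: "v \<in> L2_on unit_cell"
    and W: "\<And>w. w \<in> W \<Longrightarrow> distr_div_R R v w = 0" "W \<subseteq> periodic_test_functions"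
    and dense: "\<And>w e. w \<in> periodic_test_functions \<Longrightarrow> e > 0 \<Longrightarrow> \<exists>w'\<in>W. \<forall>y i. \<bar>grad w y $ i - grad w' y $ i\<bar> < e"
  shows "div_R_free R v"
  unfolding div_R_free_def
proof
  fix w :: "real^'m \<Rightarrow> real" assume w: "w \<in> periodic_test_functions"
  let ?U = "unit_cell :: (real^'m) set"
  have cell: "open ?U" "bounded ?U" by (auto simp: unit_cell_eq_box open_box bounded_box)
  have vi: "sq_int (lebesgue_on ?U) (\<lambda>y. v y $ i)" for i using v by (simp add: L2_on_vec_iff)
  have "sq_int (lebesgue_on ?U) (\<lambda>y. norm (v y))" using v by (auto simp: L2_on_def sq_int_def intro: borel_measurable_norm)
  from sq_int_integrable[OF open_bounded_lebesgue(2,3)[OF cell] this]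
  have vn: "integrable (lebesgue_on ?U) (\<lambda>y. norm (v y))" .
  obtain B where B: "B > 0" "\<And>x. norm (transpose R *v x) \<le> B * norm x"
    using linear_bounded_pos[OF matrix_vector_mul_linear[of "transpose R"]] by blast
  define M where "M = (LINT y|lebesgue_on ?U. norm (v y)) * (B * real CARD('m))"
  have M0: "M \<ge> 0" unfolding M_def using B(1) by (intro mult_nonneg_nonneg) auto
  have sm: "sq_int (lebesgue_on ?U) (\<lambda>y. (transpose R *v grad w y) $ i)" if "w \<in> periodic_test_functions" for w i
    using that by (intro continuous_sq_int[OF cell] periodic_transpose_grad) (auto simp: periodic_test_functions_def)
  have le: "\<bar>distr_div_R R v w\<bar> \<le> M * e" if e: "e > 0" for e
  proof -
    obtain w' where w': "w' \<in> W" "\<And>y i. \<bar>grad w y $ i - grad w' y $ i\<bar> < e" using dense[OF w e] by blast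
    have w'T: "w' \<in> periodic_test_functions" using w'(1) W(2) by blast
    let ?d = "\<lambda>y. v y \<bullet> (transpose R *v grad w y) - v y \<bullet> (transpose R *v grad w' y)"
    note i = inner_integral_componentwise(2)[OF vi sm[OF w]] inner_integral_componentwise(2)[OF vi sm[OF w'T]]
    have "\<bar>distr_div_R R v w\<bar> = \<bar>distr_div_R R v w - distr_div_R R v w'\<bar>" using W(1)[OF w'(1)] by simp
    also have "\<dots> = norm (LINT y|lebesgue_on ?U. ?d y)"
      unfolding distr_div_R_def Bochner_Integration.integral_diff[OF i] by simp
    also have "\<dots> \<le> (LINT y|lebesgue_on ?U. norm (v y) * (B * (real CARD('m) * e)))"
    proof (rule Bochner_Integration.integral_norm_bound_integral)
      fix y
      have "norm (grad w y - grad w' y) \<le> (\<Sum>i\<in>UNIV. \<bar>(grad w y - grad w' y) $ i\<bar>)" by (rule norm_le_l1_cart)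
      also have "\<dots> \<le> real CARD('m) * e"
        by (rule sum_bounded_above) (auto intro: less_imp_le w'(2))
      finally have "B * norm (grad w y - grad w' y) \<le> B * (real CARD('m) * e)"
        using B(1) by (intro mult_left_mono) auto
      with B(2) have "norm (transpose R *v (grad w y - grad w' y)) \<le> B * (real CARD('m) * e)"
        by (rule order_trans)
      moreover have "?d y = v y \<bullet> (transpose R *v (grad w y - grad w' y))"
        by (simp only: matrix_vector_mult_diff_distrib inner_diff_right)
      ultimately show "norm (?d y) \<le> norm (v y) * (B * (real CARD('m) * e))"
        unfolding real_norm_def
        by (metis Cauchy_Schwarz_ineq2 mult_left_mono norm_ge_zero order_trans)
    qed (intro Bochner_Integration.integrable_diff i, intro integrable_mult_left vn)
    also have "\<dots> = M * e" by (simp add: M_def)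
    finally show ?thesis .
  qed
  have "\<bar>distr_div_R R v w\<bar> \<le> d" if "d > 0" for d
  proof -
    have "\<bar>distr_div_R R v w\<bar> \<le> M * (d / (M + 1))" using that M0 by (intro le) simp
    also have "\<dots> \<le> d" using that M0 by (simp add: field_simps)
    finally show ?thesis .
  qed
  then have "\<bar>distr_div_R R v w\<bar> \<le> 0" by (rule field_le_epsilon) simp
  then show "distr_div_R R v w = 0" by simp
qed

context oscillation begin

theorem two_scale_limit_div_free:
  fixes u0 :: "(real^'n) \<times> (real^'m) \<Rightarrow> real^'n"
  assumes S: "open S" "bounded S"
    and conv: "\<And>i. weak_two_scale_converges S R \<eta> (\<lambda>n x. u n x $ i) (\<lambda>z. u0 z $ i)"
    and div: "\<And>n. div_free_on S (u n)"
    and u0: "u0 \<in> borel_measurable borel" "u0 \<in> L2_on (S \<times> unit_cell)"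
  shows "AE x in lebesgue_on S. (\<lambda>y. u0 (x, y)) \<in> L2_on unit_cell"
    and "AE x in lebesgue_on S. div_R_free R (\<lambda>y. u0 (x, y))"
    and "div_free_on S (\<lambda>x. LINT y|lebesgue_on unit_cell. u0 (x, y))"
proof -
  let ?U = "unit_cell :: (real^'m) set"
  note Sb = open_bounded_lebesgue(1)[OF S]
  have cell: "open ?U" "bounded ?U" by (auto simp: unit_cell_eq_box open_box bounded_box)
  have SU: "open (S \<times> ?U)" "bounded (S \<times> ?U)"
    using S cell by (auto intro: open_Times bounded_Times)
  have u0i: "sq_int (lebesgue_on (S \<times> ?U)) (\<lambda>z. u0 z $ i)" for i using u0(2) by (simp add: L2_on_vec_iff)
  have u0m: "(\<lambda>z. u0 z $ i) \<in> borel_measurable borel" for i by (rule borel_measurable_vecD[OF u0(1)])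
  have pair: "(\<lambda>y::real^'m. (x, y)) \<in> borel \<rightarrow>\<^sub>M borel" for x :: "real^'n"
    using measurable_Pair1'[of x borel borel] by (simp add: borel_prod)
  have sec: "(\<lambda>y. u0 (x, y) $ i) \<in> borel_measurable (lebesgue_on ?U)" for x i
    by (rule borel_measurable_lebesgue_on) (rule measurable_compose[OF pair u0m])
  have "AE x in lebesgue_on S. \<forall>i. integrable (lebesgue_on ?U) (\<lambda>y. (u0 (x, y) $ i)\<^sup>2)"
    unfolding AE_all_countable
  proof
    fix i
    show "AE x in lebesgue_on S. integrable (lebesgue_on ?U) (\<lambda>y. (u0 (x, y) $ i)\<^sup>2)"
      by (rule Fubini_cell(2)[OF Sb, of "\<lambda>z. (u0 z $ i)\<^sup>2"])
        (use u0i u0m in \<open>auto simp: sq_int_def intro!: borel_measurable_power\<close>)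
  qed
  then show L2: "AE x in lebesgue_on S. (\<lambda>y. u0 (x, y)) \<in> L2_on ?U"
    by eventually_elim (simp add: L2_on_vec_iff sq_int_def sec)
  obtain W :: "(real^'m \<Rightarrow> real) set" where W: "countable W" "W \<subseteq> periodic_test_functions"
    "\<And>w e. w \<in> periodic_test_functions \<Longrightarrow> e > 0 \<Longrightarrow> \<exists>w'\<in>W. \<forall>y i. \<bar>grad w y $ i - grad w' y $ i\<bar> < e"
    by (rule countable_gradient_dense_test_functions) (rule that, blast+)
  \<comment> \<open>For a single \<open>w\<close> the exceptional set is null; countability of \<open>W\<close> allows the union of these sets.\<close>
  have "AE x in lebesgue_on S. distr_div_R R (\<lambda>y. u0 (x, y)) w = 0" if "w \<in> W" for w
  proof -
    have w: "smooth w" "periodic w" using that W(2) by (auto simp: periodic_test_functions_def)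
    let ?g = "\<lambda>z. transpose R *v grad w (snd z)"
    let ?f = "\<lambda>z. u0 z \<bullet> ?g z"
    have gc: "continuous_on UNIV (\<lambda>y. (transpose R *v grad w y) $ i)" for i by (rule periodic_transpose_grad(1)[OF w])
    have gc2: "continuous_on UNIV (\<lambda>z::(real^'n) \<times> (real^'m). ?g z $ i)" for i
      by (rule continuous_on_compose2[OF gc continuous_on_snd[OF continuous_on_id]]) simp
    have gsq: "sq_int (lebesgue_on (S \<times> ?U)) (\<lambda>z. ?g z $ i)" for i by (rule continuous_sq_int[OF SU gc2])
    have gm: "(\<lambda>z::(real^'n) \<times> (real^'m). ?g z $ i) \<in> borel_measurable borel" for i
      by (rule borel_measurable_continuous_onI[OF gc2])
    have fm: "?f \<in> borel_measurable borel"
      unfolding inner_vec_def inner_real_def by (intro borel_measurable_sum borel_measurable_times u0m gm)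
    have fsq: "sq_int (lebesgue_on (S \<times> ?U)) ?f"
    proof -
      have "compact (closure ?U)" using cell(2) by (simp add: compact_closure)
      then have bd: "bounded ((\<lambda>y. (transpose R *v grad w y) $ i) ` closure ?U)" for i
        by (intro compact_imp_bounded compact_continuous_image continuous_on_subset[OF gc]) auto
      have "\<exists>K. \<forall>y\<in>?U. \<bar>(transpose R *v grad w y) $ i\<bar> \<le> K" for i
        using bd[of i] closure_subset[of ?U] by (fastforce simp: bounded_iff)
      then obtain K where K: "\<And>i y. y \<in> ?U \<Longrightarrow> \<bar>(transpose R *v grad w y) $ i\<bar> \<le> K i" by metis
      have summand: "sq_int (lebesgue_on (S \<times> ?U)) (\<lambda>z. u0 z $ i * ?g z $ i)" for i
        by (rule sq_int_mult_bounded[OF u0i borel_measurable_lebesgue_on[OF gm], of _ "K i"]) (use K in auto)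
      have "sq_int (lebesgue_on (S \<times> ?U)) (\<lambda>z. \<Sum>i\<in>I. u0 z $ i * ?g z $ i)" if "finite I" for I
        using that by (induction I) (auto simp: sq_int_def[of _ "\<lambda>_. 0"] simp del: transpose_matrix_vector intro!: sq_int_add summand)
      then show ?thesis by (simp add: inner_vec_def)
    qed
    let ?v = "\<lambda>x. LINT y|lebesgue_on ?U. ?f (x, y)"
    have vsq: "sq_int (lebesgue_on S) ?v" by (rule sq_int_cell_mean[OF Sb fm fsq])
    have "AE x in lebesgue_on S. ?v x = 0"
    proof (rule fundamental_lemma_calculus_of_variations[OF S vsq])
      fix \<phi> assume \<phi>: "\<phi> \<in> test_functions S"
      have \<phi>c: "continuous_on UNIV \<phi>" using \<phi> by (auto simp: test_functions_def intro: smooth_imp_continuous)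
      have \<phi>c2: "continuous_on UNIV (\<lambda>z::(real^'n) \<times> (real^'m). \<phi> (fst z))"
        by (rule continuous_on_compose2[OF \<phi>c continuous_on_fst[OF continuous_on_id]]) simp
      have \<phi>sq: "sq_int (lebesgue_on (S \<times> ?U)) (\<lambda>z. \<phi> (fst z))" by (rule continuous_sq_int[OF SU \<phi>c2])
      have pm: "(\<lambda>z. ?f z * \<phi> (fst z)) \<in> borel_measurable borel"
        by (intro borel_measurable_times fm borel_measurable_continuous_onI[OF \<phi>c2])
      have "(LINT x|lebesgue_on S. ?v x * \<phi> x) = (LINT x|lebesgue_on S. LINT y|lebesgue_on ?U. ?f (x, y) * \<phi> (fst (x, y)))"
        by simp
      also have "\<dots> = (LINT z|lebesgue_on (S \<times> ?U). ?f z * \<phi> (fst z))"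
        by (rule Fubini_cell(1)[OF Sb pm sq_int_mult[OF fsq \<phi>sq], symmetric])
      also have "\<dots> = (LINT z|lebesgue_on (S \<times> ?U). u0 z \<bullet> (\<phi> (fst z) *\<^sub>R ?g z))"
        by (simp add: mult.commute)
      also have "\<dots> = (\<Sum>i\<in>UNIV. LINT z|lebesgue_on (S \<times> ?U). u0 z $ i * (\<phi> (fst z) *\<^sub>R ?g z) $ i)"
      proof (rule inner_integral_componentwise(1)[OF u0i])
        show "sq_int (lebesgue_on (S \<times> ?U)) (\<lambda>z. (\<phi> (fst z) *\<^sub>R ?g z) $ i)" for i
          unfolding vector_scaleR_component real_scaleR_def
          by (intro continuous_sq_int[OF SU] continuous_on_mult \<phi>c2 gc2)
      qed
      also have "\<dots> = 0"
        using two_scale_limit_oscillating_divergence[OF S conv div \<phi> w] by simp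
      finally show "(LINT x|lebesgue_on S. ?v x * \<phi> x) = 0" .
    qed
    then show ?thesis by eventually_elim (simp add: distr_div_R_def)
  qed
  then have "AE x in lebesgue_on S. \<forall>w\<in>W. distr_div_R R (\<lambda>y. u0 (x, y)) w = 0"
    by (intro AE_ball_countable' W(1))
  with L2 show "AE x in lebesgue_on S. div_R_free R (\<lambda>y. u0 (x, y))"
    by eventually_elim (rule cell_divergence_dense[OF _ _ W(2,3)], auto)
  show "div_free_on S (\<lambda>x. LINT y|lebesgue_on ?U. u0 (x, y))"
    unfolding div_free_on_def distr_div_def
  proof
    fix \<phi> assume \<phi>: "\<phi> \<in> test_functions S"
    have \<phi>ic: "continuous_on UNIV (\<lambda>z::(real^'n) \<times> (real^'m). grad \<phi> (fst z) $ i)" for i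
      by (rule continuous_on_compose2[OF continuous_grad_test_function[OF \<phi>, of i] continuous_on_fst[OF continuous_on_id]]) simp
    have fm: "(\<lambda>z. u0 z \<bullet> grad \<phi> (fst z)) \<in> borel_measurable borel"
      unfolding inner_vec_def inner_real_def
      by (intro borel_measurable_sum borel_measurable_times u0m borel_measurable_continuous_onI[OF \<phi>ic])
    note split = inner_integral_componentwise[of "S \<times> ?U" u0 "\<lambda>z. grad \<phi> (fst z)", OF u0i continuous_sq_int[OF SU \<phi>ic]]
    have int: "AE x in lebesgue_on S. (LINT y|lebesgue_on ?U. u0 (x, y)) \<bullet> grad \<phi> x = (LINT y|lebesgue_on ?U. u0 (x, y) \<bullet> grad \<phi> x)"
      using L2
    proof eventually_elim
      case (elim x)
      have "integrable (lebesgue_on ?U) (\<lambda>y. u0 (x, y) \<bullet> b)" if bB: "b \<in> Basis" for b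
      proof -
        obtain i where b: "b = axis i 1" using bB by (auto simp: Basis_vec_def)
        have "sq_int (lebesgue_on ?U) (\<lambda>y. u0 (x, y) $ i)" using elim by (simp add: L2_on_vec_iff)
        from sq_int_mult[OF this sq_int_cell_const] show ?thesis by (simp add: b inner_axis)
      qed
      then have "integrable (lebesgue_on ?U) (\<lambda>y. u0 (x, y))"
        by (subst euclidean_representation[symmetric]) (intro Bochner_Integration.integrable_sum integrable_scaleR_left)
      then show ?case by simp
    qed
    have "(LINT x|lebesgue_on S. (LINT y|lebesgue_on ?U. u0 (x, y)) \<bullet> grad \<phi> x) =
        (LINT x|lebesgue_on S. LINT y|lebesgue_on ?U. u0 (x, y) \<bullet> grad \<phi> (fst (x, y)))"
    proof (rule integral_cong_AE)
      show "(\<lambda>x. LINT y|lebesgue_on ?U. u0 (x, y) \<bullet> grad \<phi> (fst (x, y))) \<in> borel_measurable (lebesgue_on S)"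
        using Fubini_cell(3)[OF Sb fm split(2)] by (rule borel_measurable_integrable)
      then show "(\<lambda>x. (LINT y|lebesgue_on ?U. u0 (x, y)) \<bullet> grad \<phi> x) \<in> borel_measurable (lebesgue_on S)"
        by (rule borel_measurable_lebesgue_on_AE[rotated]) (use int Sb in \<open>auto intro!: sets_completionI_sets elim: eventually_mono\<close>)
    qed (use int in simp)
    also have "\<dots> = (LINT z|lebesgue_on (S \<times> ?U). u0 z \<bullet> grad \<phi> (fst z))"
      by (rule Fubini_cell(1)[OF Sb fm split(2), symmetric])
    also have "\<dots> = 0" unfolding split(1) by (rule two_scale_limit_mean_divergence[OF S conv div \<phi>])
    finally show "- (LINT x|lebesgue_on S. (LINT y|lebesgue_on ?U. u0 (x, y)) \<bullet> grad \<phi> x) = 0" by simp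
  qed
qed

end

theorem proposition10:
  fixes \<Omega> :: "(real^3) set"
    and R :: "real^3^'m"
    and \<eta> :: "nat \<Rightarrow> real"
    and u :: "nat \<Rightarrow> real^3 \<Rightarrow> real^3"
  assumes "open \<Omega>" and "bounded \<Omega>" and "lipschitz_boundary \<Omega>"
    and "CARD('m) > 3"
    and "\<And>k :: real^'m. integer_vec k \<Longrightarrow> k \<noteq> 0 \<Longrightarrow> transpose R *v k \<noteq> 0"
    and "\<And>n. \<eta> n > 0" and "\<eta> \<longlonglongrightarrow> 0"
    and "\<And>n. u n \<in> L2_on \<Omega>"
    and "\<exists>C. \<forall>n. L2_norm \<Omega> (u n) \<le> C"
    and "\<And>n. div_free_on \<Omega> (u n)"
  shows "\<exists>(r :: nat \<Rightarrow> nat) (u0 :: (real^3) \<times> (real^'m) \<Rightarrow> real^3).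
           strict_mono r \<and>
           u0 \<in> L2_H_div_R0 \<Omega> R \<and>
           (\<forall>i. weak_two_scale_converges \<Omega> R (\<eta> \<circ> r) (\<lambda>k x. u (r k) x $ i) (\<lambda>z. u0 z $ i)) \<and>
           (AE x in lebesgue_on \<Omega>. div_R_free R (\<lambda>y. u0 (x, y))) \<and>
           div_free_on \<Omega> (\<lambda>x. LINT y|lebesgue_on unit_cell. u0 (x, y))"
proof -
  interpret oscillation R \<eta> by unfold_locales (use assms in auto)
  obtain C where C: "\<And>n. L2_norm \<Omega> (u n) \<le> C" using assms(9) by blast
  obtain r :: "nat \<Rightarrow> nat" and u0 :: "(real^3) \<times> (real^'m) \<Rightarrow> real^3"
    where r: "strict_mono r" and u0: "u0 \<in> borel_measurable borel" "\<And>x. periodic (\<lambda>y. u0 (x, y))"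
      "u0 \<in> L2_on (\<Omega> \<times> unit_cell)"
      and conv: "\<And>i. weak_two_scale_converges \<Omega> R (\<eta> \<circ> r) (\<lambda>n x. u (r n) x $ i) (\<lambda>z. u0 z $ i)"
    by (rule two_scale_compactness[of \<Omega> u C, OF assms(1,2) assms(8) C]) (rule that, blast+)
  interpret sub: oscillation R "\<eta> \<circ> r" by (rule oscillation_subsequence[OF r])
  note lim = sub.two_scale_limit_div_free[OF assms(1,2) conv assms(10) u0(1,3)]
  from lim(1,2) have "AE x in lebesgue_on \<Omega>. (\<lambda>y. u0 (x, y)) \<in> H_div_R0 R"
    by eventually_elim (simp add: H_div_R0_def u0(2))
  then have "u0 \<in> L2_H_div_R0 \<Omega> R" using u0(3) by (simp add: L2_H_div_R0_def)
  with r conv lim(2,3) show ?thesis by blast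
qed

end
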